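(* There exists a system of Beurling primes $q=\{q_n\}_{n\geq1}$, with Beurling integers $\{\nu_n\}_{n\geq1}$, such that: (i) $\zeta_q(s)$ has an analytic continuation to $\{\Re s>1/2\}$ except for a simple pole at $s=1$; (ii) $\zeta_q(s)$ has no zeros in $\{\Re s>1/2\}$; (iii) $\pi_q(x)=\mathrm{li}(x)+O(1)$; (iv) there is $a>0$ such that for every $\varepsilon>0$, $N_q(x)=ax+O_\varepsilon(x^{1/2+\varepsilon})$; (v) Bohr's condition holds: there exist $c_1,c_2>0$ with $\nu_{n+1}-\nu_n\geq c_1\nu_{n+1}^{-c_2}$ for all $n\in\mathbb{N}$.
   Context: A system of Beurling primes is an increasing sequence $q=\{q_n\}$ of real numbers with $1<q_n\to\infty$ such that $\{\log q_n\}$ is linearly independent over $\mathbb{Q}$. The Beurling integers are all finite products of elements of $q$ (including $1$), listed increasingly as $\nu_1<\nu_2<\cdots$. $\zeta_q(s)=\sum_{n}\nu_n^{-s}=\prod_n(1-q_n^{-s})^{-1}$ for $\Re s$ large. $N_q(x)=\#\{n:\nu_n\leq x\}$, $\pi_q(x)=\#\{n:q_n\leq x\}$, and $\mathrm{li}(x)=\int_1^x(1-u^{-1})(\log u)^{-1}\,du$. *)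

theory Defs
  imports "HOL-Complex_Analysis.Complex_Analysis" "HOL-Library.Landau_Symbols" "HOL-Library.Multiset"
begin

definition beurling_primes :: "(nat \<Rightarrow> real) \<Rightarrow> bool" where
  "beurling_primes q \<longleftrightarrow>
     strict_mono q \<and> 1 < q 0 \<and> filterlim q at_top sequentially \<and>
     (\<forall>c :: nat \<Rightarrow> rat. finite {n. c n \<noteq> 0} \<longrightarrow>
        (\<Sum>n\<in>{n. c n \<noteq> 0}. of_rat (c n) * ln (q n)) = 0 \<longrightarrow> (\<forall>n. c n = 0))"

definition beurling_integers :: "(nat \<Rightarrow> real) \<Rightarrow> real set" where
  "beurling_integers q = {prod_mset (image_mset q M) | M. True}"

text \<open>The n-th Beurling integer in increasing order (0-indexed: beurling_nu q 0 = 1).\<close>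
definition beurling_nu :: "(nat \<Rightarrow> real) \<Rightarrow> nat \<Rightarrow> real" where
  "beurling_nu q n = (THE v. v \<in> beurling_integers q \<and> card {u \<in> beurling_integers q. u < v} = n)"

definition beurling_N :: "(nat \<Rightarrow> real) \<Rightarrow> real \<Rightarrow> real" where
  "beurling_N q x = real (card {v \<in> beurling_integers q. v \<le> x})"

definition beurling_pi :: "(nat \<Rightarrow> real) \<Rightarrow> real \<Rightarrow> real" where
  "beurling_pi q x = real (card {n. q n \<le> x})"

text \<open>zeta_q(s) = sum over Beurling integers of v^(-s) (meaningful where the sum converges).\<close>
definition beurling_zeta :: "(nat \<Rightarrow> real) \<Rightarrow> complex \<Rightarrow> complex" where
  "beurling_zeta q s = infsum (\<lambda>v. complex_of_real v powr (-s)) (beurling_integers q)"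

definition li_beurling :: "real \<Rightarrow> real" where
  "li_beurling x = integral {1..x} (\<lambda>u. (1 - 1/u) / ln u)"

end

(*
  Let li(x_n) = n and choose one prime q_n in each interval (x_{n+1}, x_{n+2}], so that pi_q = li + O(1)
  whatever the choice. Let T_n(s) be the integral of u^{-s} d li(u) over (x_n, x_{n+1}]; these integrals
  sum to log (s / (s - 1)), hence zeta_q(s) = s / (s - 1) exp (G(s)), where G(s) is the sum of the
  X_n(s) = q_n^{-s} - T_{n+1}(s) plus terms converging absolutely for Re s > 1/2. By telescoping, the sum
  of the X_n converges there too, which gives the continuation and the absence of zeros.

  If q_n is drawn with density d li, then Re X_n(s) is centred and bounded, so exp (Re X_n(s)) has mean
  at most exp (2 x_{n+1}^{-2 Re s}) by Hoeffding's lemma. The q_n are chosen one after the other so that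
  a weighted integral of exp (Re (X_0 + ... + X_n)) over countably many vertical lines to the right of
  1/2 stays bounded, and so that q_n avoids a set of small measure on which two products of primes come
  too close. The latter yields Bohr's condition and linear independence. The former is the Lindeloef
  bound in mean for zeta_q; it suffices to shift the contour in Perron's formula, smoothed over an
  interval of length sqrt x, and gives N_q(x) = a x + O(x^{1/2 + eps}).
*)
theory Submission
  imports Defs "HOL-Probability.Probability"
begin

section \<open>Fourier inversion and contour shift\<close>

text \<open>The obstacle is growth in the imaginary direction. Telescoping yields
  \<open>norm (G s) \<le> C + 2 * norm s\<close>, so that a priori \<open>exp (G s)\<close> may grow
  like \<open>exp (2 * \<bar>Im s\<bar>)\<close>: enough to justify moving a contour, useless for
  estimating the moved integral. No pointwise bound replaces it, since the shifted integral only
  sees the mean of \<open>norm (exp (G s))\<close> against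
  \<open>(1 + \<bar>t\<bar>) powr (- 1 - e)\<close>. Under a random choice Fubini controls this
  mean: the exponential moment bound at \<open>s\<close> does not depend on \<open>Im s\<close>, and
  the Hoeffding exponents are summable over n because \<open>Re s > 1 / 2\<close>. Choosing one
  prime at a time avoids a product space. Stage n may lose a factor \<open>1 + \<gamma> n\<close>
  with \<open>\<gamma>\<close> summable, and this room pays for excluding a set of measure
  \<open>\<gamma> n / 4\<close>. Thresholds for near coincidences are fixed in advance by replacing
  each q_i by its lower bound i + 2, so the bad set at stage n depends on earlier primes only.
  Finally zeta is compared with \<open>a * s / (s - 1)\<close>, where \<open>a = exp (G 1)\<close>:
  the difference has no pole, so the contour crosses no residue.\<close>

lemma integrable_pair_lborel_bound:
  fixes f :: "real \<times> real \<Rightarrow> complex"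
  assumes [measurable]: "f \<in> borel_measurable (lborel \<Otimes>\<^sub>M lborel)"
    and g: "integrable lborel (g :: real \<Rightarrow> real)" and h: "integrable lborel (h :: real \<Rightarrow> real)"
    and bound: "\<And>x y. norm (f (x, y)) \<le> g x * h y"
  shows "integrable (lborel \<Otimes>\<^sub>M lborel) f"
proof (rule lborel_pair.Fubini_integrable)
  have [measurable]: "g \<in> borel_measurable lborel" "h \<in> borel_measurable lborel"
    using g h by auto
  have inner: "integrable lborel (\<lambda>y. f (x, y))" for x
  proof (rule Bochner_Integration.integrable_bound)
    show "integrable lborel (\<lambda>y. g x * h y)" using h by simp
    show "AE y in lborel. norm (f (x, y)) \<le> norm (g x * h y)"
      by (intro AE_I2) (metis bound order_trans real_norm_def abs_ge_self)
  qed measurable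
  then show "AE x in lborel. integrable lborel (\<lambda>y. f (x, y))" by simp
  show "integrable lborel (\<lambda>x. LBINT y. norm (f (x, y)))"
  proof (rule Bochner_Integration.integrable_bound)
    show "integrable lborel (\<lambda>x. g x * (LBINT y. h y))" using g by simp
    show "AE x in lborel. norm (LBINT y. norm (f (x, y))) \<le> norm (g x * (LBINT y. h y))"
    proof (intro AE_I2)
      fix x
      have "(LBINT y. norm (f (x, y))) \<le> (LBINT y. g x * h y)"
        by (intro integral_mono bound integrable_norm inner) (use h in simp)
      then show "norm (LBINT y. norm (f (x, y))) \<le> norm (g x * (LBINT y. h y))"
        by simp
    qed
  qed measurable
qed measurable

text \<open>The substitution \<open>z = d * t\<close> in
  \<open>char_std_normal_distribution\<close>. Written through
  \<open>std_normal_density (y / d)\<close>, the transform is visibly \<open>2 * pi\<close> times an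
  approximate identity as \<open>d\<close> tends to 0.\<close>

lemma gaussian_fourier:
  fixes d y :: real
  assumes "d > 0"
  shows "integrable lborel (\<lambda>t. exp (- (d * t)\<^sup>2 / 2))"
    and "(CLBINT t. iexp (t * y) * of_real (exp (- (d * t)\<^sup>2 / 2)))
       = of_real (2 * pi / d * std_normal_density (y / d))"
proof -
  have std: "std_normal_density z = exp (- z\<^sup>2 / 2) / sqrt (2 * pi)" for z
    by (simp add: std_normal_density_def)
  have i0: "integrable lborel (\<lambda>z. exp (- z\<^sup>2 / 2 :: real))"
    using integrable_mult_right[OF integrable_normal_density[of 1 0], of "sqrt (2 * pi)"]
    by (simp add: std normal_density_def)
  show "integrable lborel (\<lambda>t. exp (- (d * t)\<^sup>2 / 2))"
    using lborel_integrable_real_affine[OF i0, of d 0] assms by simp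
  have "(CLINT z|std_normal_distribution. iexp (y / d * z)) = of_real (exp (- (y / d)\<^sup>2 / 2))"
    using char_std_normal_distribution unfolding char_def fun_eq_iff by blast
  moreover have "(CLINT z|std_normal_distribution. iexp (y / d * z))
      = (CLBINT z. std_normal_density z *\<^sub>R iexp (y / d * z))"
    by (subst integral_density) auto
  moreover have "... = (CLBINT z. iexp (y / d * z) * of_real (exp (- z\<^sup>2 / 2))) / of_real (sqrt (2 * pi))"
    unfolding integral_divide_zero[symmetric]
    by (intro Bochner_Integration.integral_cong) (auto simp: std scaleR_conv_of_real)
  ultimately have g: "(CLBINT z. iexp (y / d * z) * of_real (exp (- z\<^sup>2 / 2)))
       = of_real (sqrt (2 * pi) * exp (- (y / d)\<^sup>2 / 2))"
    by (simp add: field_simps)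
  have "(CLBINT z. iexp (y / d * z) * of_real (exp (- z\<^sup>2 / 2)))
      = \<bar>d\<bar> *\<^sub>R (CLBINT t. iexp (y / d * (0 + d * t)) * of_real (exp (- (0 + d * t)\<^sup>2 / 2)))"
    using assms by (intro lborel_integral_real_affine) auto
  also have "... = of_real d * (CLBINT t. iexp (t * y) * of_real (exp (- (d * t)\<^sup>2 / 2)))"
    using assms by (simp add: scaleR_conv_of_real mult.commute)
  finally have "of_real d * (CLBINT t. iexp (t * y) * of_real (exp (- (d * t)\<^sup>2 / 2)))
      = (of_real (sqrt (2 * pi) * exp (- (y / d)\<^sup>2 / 2)) :: complex)"
    using g by simp
  moreover have "sqrt (2 * pi) * exp (- (y / d)\<^sup>2 / 2) = d * (2 * pi / d * std_normal_density (y / d))"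
    using assms real_sqrt_mult_self[of "2 * pi"] by (simp add: std field_simps)
  ultimately have "of_real d * (CLBINT t. iexp (t * y) * of_real (exp (- (d * t)\<^sup>2 / 2)))
      = (of_real d * of_real (2 * pi / d * std_normal_density (y / d)) :: complex)"
    by (simp only: of_real_mult)
  then show "(CLBINT t. iexp (t * y) * of_real (exp (- (d * t)\<^sup>2 / 2)))
       = of_real (2 * pi / d * std_normal_density (y / d))"
    by (rule mult_left_cancel[THEN iffD1, rotated]) (use assms in simp)
qed

text \<open>A Gaussian factor is inserted under the inverse integral. As \<open>d\<close> tends to 0
  it disappears by dominated convergence (\<open>A1\<close>), while Fubini turns the same integral
  into \<open>2 * pi\<close> times a Gaussian mean of \<open>f\<close> around \<open>x\<close>
  (\<open>A2\<close>), which tends to \<open>f x\<close> by continuity and boundedness.\<close>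

lemma fourier_inversion:
  fixes f F :: "real \<Rightarrow> complex"
  assumes cont: "continuous_on UNIV f" and bound: "\<And>v. norm (f v) \<le> B"
    and int: "integrable lborel f"
    and F: "\<And>t. F t = (CLBINT v. f v * iexp (- (t * v)))"
    and intF: "integrable lborel F"
  shows "f x = (CLBINT t. F t * iexp (t * x)) / of_real (2 * pi)"
proof -
  define d where "d n = 1 / real (Suc n)" for n
  have d: "d n > 0" for n by (simp add: d_def)
  have d0: "d \<longlonglongrightarrow> 0" unfolding d_def using LIMSEQ_Suc[OF lim_const_over_n[of "1::real"]] by simp
  have [measurable]: "f \<in> borel_measurable borel" "F \<in> borel_measurable borel"
    using int intF by auto
  define A where "A n = (CLBINT t. F t * iexp (t * x) * of_real (exp (- (d n * t)\<^sup>2 / 2)))" for n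
  have A1: "A \<longlonglongrightarrow> (CLBINT t. F t * iexp (t * x))"
    unfolding A_def
  proof (rule integral_dominated_convergence[where w = "\<lambda>t. norm (F t)"])
    show "AE t in lborel. (\<lambda>n. F t * iexp (t * x) * of_real (exp (- (d n * t)\<^sup>2 / 2))) \<longlonglongrightarrow> F t * iexp (t * x)"
    proof (intro AE_I2)
      fix t
      have "(\<lambda>n. F t * iexp (t * x) * of_real (exp (- (d n * t)\<^sup>2 / 2)))
          \<longlonglongrightarrow> F t * iexp (t * x) * of_real (exp (- (0 * t)\<^sup>2 / 2))"
        by (intro tendsto_intros d0) auto
      then show "(\<lambda>n. F t * iexp (t * x) * of_real (exp (- (d n * t)\<^sup>2 / 2))) \<longlonglongrightarrow> F t * iexp (t * x)"
        by simp
    qed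
    show "AE t in lborel. norm (F t * iexp (t * x) * of_real (exp (- (d n * t)\<^sup>2 / 2))) \<le> norm (F t)" for n
      by (intro AE_I2) (simp add: norm_mult mult_left_le)
  qed (use intF in auto)
  have A2: "A n = 2 * pi * (CLBINT z. std_normal_density z *\<^sub>R f (x + d n * z))" for n
  proof -
    define K where "K t = exp (- (d n * t)\<^sup>2 / 2)" for t
    have iK: "integrable lborel K" unfolding K_def by (rule gaussian_fourier(1)[OF d])
    have [measurable]: "K \<in> borel_measurable borel" unfolding K_def by measurable
    let ?k = "\<lambda>(v, t). f v * iexp (t * (x - v)) * of_real (K t)"
    have "integrable (lborel \<Otimes>\<^sub>M lborel) ?k"
      by (rule integrable_pair_lborel_bound[where g = "\<lambda>v. norm (f v)" and h = "\<lambda>t. norm (K t)"])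
        (use iK int in \<open>auto simp: norm_mult\<close>)
    then have "(CLBINT t. CLBINT v. ?k (v, t)) = (CLBINT v. CLBINT t. ?k (v, t))"
      using lborel_pair.Fubini_integral[of "\<lambda>v t. ?k (v, t)"] by simp
    moreover have "(CLBINT t. CLBINT v. ?k (v, t)) = A n"
    proof -
      have e: "?k (v, t) = (f v * iexp (- (t * v))) * (iexp (t * x) * of_real (K t))" for v t
        by (simp add: algebra_simps exp_diff exp_minus field_simps)
      have "(CLBINT v. ?k (v, t)) = F t * iexp (t * x) * of_real (K t)" for t
        unfolding e F by (subst integral_mult_left_zero) (simp only: mult.assoc)
      then show ?thesis unfolding A_def K_def[symmetric] by (simp only:)
    qed
    moreover have "(CLBINT v. CLBINT t. ?k (v, t))
        = (CLBINT v. f v * of_real (2 * pi / d n * std_normal_density ((x - v) / d n)))"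
    proof (intro Bochner_Integration.integral_cong refl)
      fix v
      have "(CLBINT t. ?k (v, t)) = f v * (CLBINT t. iexp (t * (x - v)) * of_real (K t))"
        by (subst integral_mult_right_zero[symmetric]) (simp add: mult.assoc)
      also have "(CLBINT t. iexp (t * (x - v)) * of_real (K t))
          = of_real (2 * pi / d n * std_normal_density ((x - v) / d n))"
        unfolding K_def by (rule gaussian_fourier(2)[OF d])
      finally show "(CLBINT t. ?k (v, t)) = f v * of_real (2 * pi / d n * std_normal_density ((x - v) / d n))" .
    qed
    \<comment> \<open>The substitution \<open>v = x + d n * z\<close> trades the shrinking Gaussian
      for a fixed one, so that dominated convergence applies with majorant
      \<open>std_normal_density z * B\<close>.\<close>
    moreover have "(CLBINT v. f v * of_real (2 * pi / d n * std_normal_density ((x - v) / d n)))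
       = \<bar>d n\<bar> *\<^sub>R (CLBINT z. f (x + d n * z) * of_real (2 * pi / d n * std_normal_density ((x - (x + d n * z)) / d n)))"
      using d[of n] by (intro lborel_integral_real_affine) auto
    moreover have "... = (CLBINT z. (2 * pi) * (std_normal_density z *\<^sub>R f (x + d n * z)))"
      unfolding integral_scaleR_right[symmetric]
      using d[of n] by (intro Bochner_Integration.integral_cong refl)
        (simp add: scaleR_conv_of_real std_normal_density_def)
    moreover have "... = 2 * pi * (CLBINT z. std_normal_density z *\<^sub>R f (x + d n * z))"
      by (subst integral_mult_right_zero[symmetric]) simp
    ultimately show ?thesis by (simp only:)
  qed
  have "(\<lambda>n. CLBINT z. std_normal_density z *\<^sub>R f (x + d n * z)) \<longlonglongrightarrow> (CLBINT z. std_normal_density z *\<^sub>R f x)"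
  proof (rule integral_dominated_convergence[where w = "\<lambda>z. std_normal_density z * B"])
    show "AE z in lborel. (\<lambda>n. std_normal_density z *\<^sub>R f (x + d n * z)) \<longlonglongrightarrow> std_normal_density z *\<^sub>R f x"
    proof (intro AE_I2 tendsto_intros)
      fix z
      have "(\<lambda>n. x + d n * z) \<longlonglongrightarrow> x + 0 * z" by (intro tendsto_intros d0)
      then show "(\<lambda>n. f (x + d n * z)) \<longlonglongrightarrow> f x"
        using continuous_on_tendsto_compose[OF cont, of "\<lambda>n. x + d n * z" x] by simp
    qed
    show "AE z in lborel. norm (std_normal_density z *\<^sub>R f (x + d n * z)) \<le> std_normal_density z * B" for n
      by (intro AE_I2) (simp add: mult_left_mono bound)
  qed auto
  moreover have "(CLBINT z. std_normal_density z *\<^sub>R f x) = f x"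
    by (subst integral_scaleR_left) (use integral_normal_density[of 1 0] in auto)
  ultimately have "A \<longlonglongrightarrow> 2 * pi * f x"
    unfolding A2 by (intro tendsto_intros) simp
  with A1 have "2 * pi * f x = (CLBINT t. F t * iexp (t * x))"
    using LIMSEQ_unique by blast
  then show ?thesis by (simp add: field_simps)
qed

section \<open>Improper integrals of exponentials and powers\<close>

lemma integral_FTC_at_top:
  fixes f F :: "real \<Rightarrow> complex"
  assumes F: "\<And>x. a \<le> x \<Longrightarrow> (F has_vector_derivative f x) (at x)"
    and cont: "continuous_on {a..} f" and int: "set_integrable lborel {a..} f"
    and lim: "(F \<longlongrightarrow> L) at_top"
  shows "(LINT x:{a..}|lborel. f x) = L - F a"
proof -
  have "((\<lambda>y. \<integral>x. indicator {..y} x *\<^sub>R (indicator {a..} x *\<^sub>R f x) \<partial>lborel)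
      \<longlongrightarrow> (\<integral>x. indicator {a..} x *\<^sub>R f x \<partial>lborel)) at_top"
    using int by (intro tendsto_integral_at_top) (auto simp: set_integrable_def)
  moreover have "eventually (\<lambda>y. (\<integral>x. indicator {..y} x *\<^sub>R (indicator {a..} x *\<^sub>R f x) \<partial>lborel) = F y - F a) at_top"
    using eventually_ge_at_top[of a]
  proof eventually_elim
    case (elim y)
    have "(\<integral>x. indicator {..y} x *\<^sub>R (indicator {a..} x *\<^sub>R f x) \<partial>lborel) = (\<integral>x. indicator {a..y} x *\<^sub>R f x \<partial>lborel)"
      by (intro Bochner_Integration.integral_cong) (auto simp: indicator_def)
    also have "... = F y - F a"
      using elim by (intro integral_FTC_atLeastAtMost)
        (auto intro: has_vector_derivative_at_within F continuous_on_subset[OF cont])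
    finally show ?case .
  qed
  ultimately have "((\<lambda>y. F y - F a) \<longlongrightarrow> (\<integral>x. indicator {a..} x *\<^sub>R f x \<partial>lborel)) at_top"
    by (rule Lim_transform_eventually)
  moreover have "((\<lambda>y. F y - F a) \<longlongrightarrow> L - F a) at_top"
    by (intro tendsto_intros lim)
  ultimately show ?thesis
    unfolding set_lebesgue_integral_def by (rule tendsto_unique[OF trivial_limit_at_top_linorder])
qed

lemma set_integrable_exp_at_top:
  fixes z :: complex
  assumes "Re z > 0"
  shows "set_integrable lborel {c..} (\<lambda>v. exp (- (z * of_real v)))"
proof -
  have "((\<lambda>x::real. exp (- Re z * x)) has_integral exp (- Re z * c) / Re z) {c..}"
    using assms by (rule has_integral_exp_minus_to_infinity)
  then have "(\<lambda>x::real. exp (- Re z * x)) absolutely_integrable_on {c..}"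
    by (intro nonnegative_absolutely_integrable_1) (auto simp: integrable_on_def)
  then have "integrable lborel (\<lambda>x::real. indicator {c..} x *\<^sub>R exp (- Re z * x))"
    unfolding set_integrable_def by (subst (asm) integrable_completion) auto
  then show ?thesis
    unfolding set_integrable_def
    by (rule Bochner_Integration.integrable_bound) (auto simp: indicator_def)
qed

lemma integral_exp_at_top:
  fixes z :: complex
  assumes "Re z > 0"
  shows "(LINT v:{c..}|lborel. exp (- (z * of_real v))) = exp (- (z * of_real c)) / z"
proof -
  have "z \<noteq> 0" using assms by auto
  have "(LINT v:{c..}|lborel. exp (- (z * of_real v))) = 0 - (- exp (- (z * of_real c)) / z)"
  proof (rule integral_FTC_at_top[where F = "\<lambda>v. - exp (- (z * of_real v)) / z"])
    fix x
    have "((\<lambda>w. - exp (- (z * w)) / z) has_field_derivative exp (- (z * of_real x))) (at (of_real x))"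
      using \<open>z \<noteq> 0\<close> by (auto intro!: derivative_eq_intros)
    then show "((\<lambda>v. - exp (- (z * of_real v)) / z) has_vector_derivative exp (- (z * of_real x))) (at x)"
      by (rule has_vector_derivative_real_field)
  next
    have "((\<lambda>v. exp (- (Re z * v))) \<longlongrightarrow> 0) at_top"
      using assms by real_asymp
    then have "((\<lambda>v. exp (- (z * of_real v))) \<longlongrightarrow> 0) at_top"
      by (intro tendsto_norm_zero_cancel[of "\<lambda>v. exp (- (z * of_real v))"]) simp
    from tendsto_divide[OF tendsto_minus[OF this] tendsto_const[of z]]
    show "((\<lambda>v. - exp (- (z * of_real v)) / z) \<longlongrightarrow> 0) at_top"
      using \<open>z \<noteq> 0\<close> by simp
  qed (auto intro!: continuous_intros set_integrable_exp_at_top assms)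
  then show ?thesis by simp
qed

lemma set_integrable_powr_at_top:
  fixes e :: real
  assumes "e < -1" "a > 0"
  shows "set_integrable lborel {a..} (\<lambda>u. u powr e)"
proof -
  have "(\<lambda>x::real. x powr e) absolutely_integrable_on {a..}"
    using has_integral_powr_to_inf[OF assms]
    by (intro nonnegative_absolutely_integrable_1) (auto simp: integrable_on_def)
  then show ?thesis
    unfolding set_integrable_def by (subst (asm) integrable_completion) auto
qed

text \<open>One of \<open>1 + t\<close> and \<open>1 - t\<close> equals
  \<open>1 + \<bar>t\<bar>\<close> and is at least 1, so two affine images of the truncated power
  dominate the function.\<close>

lemma integrable_one_plus_abs_powr:
  fixes e :: real
  assumes "e > 0"
  shows "integrable lborel (\<lambda>t. (1 + \<bar>t\<bar>) powr (- 1 - e))"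
proof -
  let ?f = "\<lambda>t. indicator {1..} t *\<^sub>R t powr (- 1 - e) :: real"
  have f: "integrable lborel ?f"
    using set_integrable_powr_at_top[of "-1-e" 1] assms by (simp add: set_integrable_def)
  have "integrable lborel (\<lambda>t. ?f (1 + 1 * t) + ?f (1 + (-1) * t))"
    by (intro Bochner_Integration.integrable_add lborel_integrable_real_affine[OF f]) auto
  then show ?thesis
    by (rule Bochner_Integration.integrable_bound) (auto simp: indicator_def)
qed

text \<open>The growth bound is too weak for the horizontal sides of a rectangle. The factor
  \<open>exp (d * s^2)\<close> has modulus \<open>exp (d * (x^2 - t^2))\<close>: for each
  \<open>d > 0\<close> it kills those sides, and on the two vertical lines it tends to 1 boundedly
  as \<open>d\<close> tends to 0.\<close>

lemma contour_shift:
  fixes \<Phi> :: "complex \<Rightarrow> complex"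
  assumes hol: "\<Phi> holomorphic_on U" and U: "convex U" "\<And>s. a \<le> Re s \<Longrightarrow> Re s \<le> b \<Longrightarrow> s \<in> U"
    and ab: "a < b" and B: "B \<ge> 0"
    and growth: "\<And>s. a \<le> Re s \<Longrightarrow> Re s \<le> b \<Longrightarrow> 1 \<le> \<bar>Im s\<bar> \<Longrightarrow> norm (\<Phi> s) \<le> B * exp (C * \<bar>Im s\<bar>)"
    and inta: "integrable lborel (\<lambda>t. \<Phi> (Complex a t))" and intb: "integrable lborel (\<lambda>t. \<Phi> (Complex b t))"
  shows "(CLBINT t. \<Phi> (Complex a t)) = (CLBINT t. \<Phi> (Complex b t))"
proof -
  \<comment> \<open>\<open>M\<close> bounds the squared real part in the strip, so the Gaussian
    factor at height \<open>T\<close> is at most \<open>exp (d * (M - T^2))\<close>.\<close>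
  define M where "M = max (a\<^sup>2) (b\<^sup>2)"
  have sq_le_M: "x\<^sup>2 \<le> M" if "a \<le> x" "x \<le> b" for x
  proof (cases "x \<ge> 0")
    case True
    then have "x\<^sup>2 \<le> b\<^sup>2" using that by (intro power_mono) auto
    then show ?thesis by (simp add: M_def)
  next
    case False
    then have "(- x)\<^sup>2 \<le> (- a)\<^sup>2" using that by (intro power_mono) auto
    then show ?thesis by (simp add: M_def)
  qed
  define P where "P d s = \<Phi> s * exp (of_real d * s\<^sup>2)" for d :: real and s
  have norm_gauss: "norm (exp (of_real d * s\<^sup>2)) = exp (d * ((Re s)\<^sup>2 - (Im s)\<^sup>2))" for d s
    by (simp add: Re_power2)
  have intP: "integrable lborel (\<lambda>t. P d (Complex x t))"
    if "integrable lborel (\<lambda>t. \<Phi> (Complex x t))" "d \<ge> 0" for d x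
  proof (rule Bochner_Integration.integrable_bound)
    show "integrable lborel (\<lambda>t. exp (d * x\<^sup>2) * norm (\<Phi> (Complex x t)))" using that by simp
    have [measurable]: "(\<lambda>t. \<Phi> (Complex x t)) \<in> borel_measurable lborel" using that by auto
    have [measurable]: "(\<lambda>t. exp (of_real d * (Complex x t)\<^sup>2)) \<in> borel_measurable lborel"
      unfolding Complex_eq by measurable
    show "(\<lambda>t. P d (Complex x t)) \<in> borel_measurable lborel"
      unfolding P_def by measurable
    show "AE t in lborel. norm (P d (Complex x t)) \<le> norm (exp (d * x\<^sup>2) * norm (\<Phi> (Complex x t)))"
      unfolding P_def norm_mult norm_gauss using that
      by (intro AE_I2) (auto simp: mult.commute intro!: mult_left_mono)
  qed
  have shift: "(CLBINT t. P d (Complex a t)) = (CLBINT t. P d (Complex b t))" if d: "d > 0" for d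
  proof -
    have holP: "P d holomorphic_on U" unfolding P_def by (intro holomorphic_intros hol)
    have contP: "continuous_on S (P d)" if "S \<subseteq> U" for S
      using holomorphic_on_imp_continuous_on[OF holomorphic_on_subset[OF holP that]] .
    define I where "I x T = integral {-T..T} (\<lambda>t. P d (Complex x t))" for x T
    have limI: "((\<lambda>T. I x T) \<longlongrightarrow> (CLBINT t. P d (Complex x t))) at_top"
      if x: "integrable lborel (\<lambda>t. \<Phi> (Complex x t))" for x
    proof -
      have int: "integrable lborel (\<lambda>t. P d (Complex x t))" using intP[OF x] d by simp
      then have [measurable]: "(\<lambda>t. P d (Complex x t)) \<in> borel_measurable borel" by auto
      have "((\<lambda>T. CLBINT t. indicator {-T..T} t *\<^sub>R P d (Complex x t)) \<longlongrightarrow> (CLBINT t. P d (Complex x t))) at_top"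
      proof (rule integral_dominated_convergence_at_top[where w = "\<lambda>t. norm (P d (Complex x t))"])
        show "AE t in lborel. ((\<lambda>T. indicator {-T..T} t *\<^sub>R P d (Complex x t)) \<longlongrightarrow> P d (Complex x t)) at_top"
        proof (intro AE_I2)
          fix t
          show "((\<lambda>T. indicator {-T..T} t *\<^sub>R P d (Complex x t)) \<longlongrightarrow> P d (Complex x t)) at_top"
            by (rule tendsto_eventually, rule eventually_mono[OF eventually_ge_at_top[of "\<bar>t\<bar>"]]) (auto simp: indicator_def)
        qed
      qed (use int in \<open>auto simp: indicator_def\<close>)
      moreover have "(CLBINT t. indicator {-T..T} t *\<^sub>R P d (Complex x t)) = I x T" for T
      proof -
        have "set_integrable lborel {-T..T} (\<lambda>t. P d (Complex x t))"
          unfolding set_integrable_def using int by (intro integrable_mult_indicator) auto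
        then show ?thesis
          unfolding I_def using set_borel_integral_eq_integral(2) unfolding set_lebesgue_integral_def by blast
      qed
      ultimately show ?thesis by simp
    qed
    have bnd: "norm (I b T - I a T) \<le> 2 * (b - a) * (B * exp (C * T + d * (M - T\<^sup>2)))" if T: "T \<ge> 1" for T
    proof -
      let ?p1 = "Complex a (-T)" and ?p2 = "Complex b (-T)" and ?p3 = "Complex b T" and ?p4 = "Complex a T"
      have seg: "closed_segment x y \<subseteq> {s. a \<le> Re s \<and> Re s \<le> b}" if "a \<le> Re x" "Re x \<le> b" "a \<le> Re y" "Re y \<le> b" for x y
      proof -
        have "convex {s. a \<le> Re s \<and> Re s \<le> b}"
          by (simp add: Collect_conj_eq convex_Int convex_halfspace_Re_ge convex_halfspace_Re_le)
        then show ?thesis using that by (intro closed_segment_subset) auto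
      qed
      have segU: "closed_segment x y \<subseteq> U" if "a \<le> Re x" "Re x \<le> b" "a \<le> Re y" "Re y \<le> b" for x y
        using seg[OF that] U(2) by blast
      have ci: "P d contour_integrable_on linepath x y" if "a \<le> Re x" "Re x \<le> b" "a \<le> Re y" "Re y \<le> b" for x y
        by (intro contour_integrable_continuous_linepath contP segU that)
      have img: "path_image (linepath ?p1 ?p2 +++ linepath ?p2 ?p3 +++ linepath ?p3 ?p4 +++ linepath ?p4 ?p1) \<subseteq> U"
        using ab by (intro subset_path_image_join; unfold path_image_linepath; intro segU) simp_all
      have "(P d has_contour_integral 0) (linepath ?p1 ?p2 +++ linepath ?p2 ?p3 +++ linepath ?p3 ?p4 +++ linepath ?p4 ?p1)"
        by (rule Cauchy_theorem_convex_simple[OF holP U(1) _ img]) auto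
      moreover have "(P d has_contour_integral (contour_integral (linepath ?p1 ?p2) (P d)
          + (contour_integral (linepath ?p2 ?p3) (P d)
          + (contour_integral (linepath ?p3 ?p4) (P d) + contour_integral (linepath ?p4 ?p1) (P d)))))
          (linepath ?p1 ?p2 +++ linepath ?p2 ?p3 +++ linepath ?p3 ?p4 +++ linepath ?p4 ?p1)"
        using ab by (intro has_contour_integral_join has_contour_integral_integral ci) auto
      ultimately have sum0: "contour_integral (linepath ?p1 ?p2) (P d) + contour_integral (linepath ?p2 ?p3) (P d)
          + contour_integral (linepath ?p3 ?p4) (P d) + contour_integral (linepath ?p4 ?p1) (P d) = 0"
        using contour_integral_unique by (metis add.assoc)
      have vert: "contour_integral (linepath (Complex x (-T)) (Complex x T)) (P d) = \<i> * I x T" for x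
        unfolding I_def using T by (intro contour_integral_linepath_same_Re) auto
      have rev: "contour_integral (linepath ?p4 ?p1) (P d) = - (\<i> * I a T)"
        unfolding vert[symmetric] using ab by (intro contour_integral_reverse_linepath contP segU) auto
      let ?B = "B * exp (C * T + d * (M - T\<^sup>2))"
      have pw: "norm (P d s) \<le> ?B" if "a \<le> Re s" "Re s \<le> b" "\<bar>Im s\<bar> = T" for s
      proof -
        have "norm (P d s) \<le> B * exp (C * T) * exp (d * ((Re s)\<^sup>2 - T\<^sup>2))"
          unfolding P_def norm_mult norm_gauss using growth[OF that(1,2)] that(3) T
          by (metis mult_right_mono exp_ge_zero power2_abs)
        also have "... \<le> B * exp (C * T) * exp (d * (M - T\<^sup>2))"
          using d sq_le_M[OF that(1,2)] B by (intro mult_left_mono) auto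
        finally show ?thesis by (simp add: exp_add)
      qed
      have hor: "norm (contour_integral (linepath x y) (P d)) \<le> ?B * (b - a)"
        if "a \<le> Re x" "Re x \<le> b" "a \<le> Re y" "Re y \<le> b" "Im x = u" "Im y = u" "\<bar>u\<bar> = T" "norm (y - x) = b - a" for x y u
      proof -
        have "norm (contour_integral (linepath x y) (P d)) \<le> ?B * norm (y - x)"
        proof (rule contour_integral_bound_linepath)
          fix s assume s: "s \<in> closed_segment x y"
          obtain v where "s = (1 - v) *\<^sub>R x + v *\<^sub>R y" using s by (auto simp: in_segment)
          then have "Im s = u" using that(5,6) by (simp add: left_diff_distrib)
          then show "norm (P d s) \<le> ?B"
            using seg[OF that(1-4)] s that(7) by (intro pw) auto
        qed (use that ci B in auto)
        then show ?thesis using that by simp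
      qed
      have nb: "norm (?p2 - ?p1) = b - a" "norm (?p4 - ?p3) = b - a"
        using ab by (simp_all add: cmod_def)
      have "norm (contour_integral (linepath ?p1 ?p2) (P d)) \<le> ?B * (b - a)"
        "norm (contour_integral (linepath ?p3 ?p4) (P d)) \<le> ?B * (b - a)"
        using hor[of ?p1 ?p2 "-T"] hor[of ?p3 ?p4 T] nb ab T by simp_all
      moreover have "\<i> * (I b T - I a T) = - (contour_integral (linepath ?p1 ?p2) (P d) + contour_integral (linepath ?p3 ?p4) (P d))"
        using sum0 vert[of b] rev by (simp add: algebra_simps add_eq_0_iff)
      then have "norm (\<i> * (I b T - I a T)) \<le> norm (contour_integral (linepath ?p1 ?p2) (P d)) + norm (contour_integral (linepath ?p3 ?p4) (P d))"
        by (metis norm_minus_cancel norm_triangle_ineq)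
      moreover have "norm (\<i> * (I b T - I a T)) = norm (I b T - I a T)"
        by (simp only: norm_mult norm_ii mult_1)
      ultimately have "norm (I b T - I a T) \<le> ?B * (b - a) + ?B * (b - a)"
        by linarith
      then show ?thesis by (simp add: algebra_simps)
    qed
    have "((\<lambda>T. 2 * (b - a) * (B * exp (C * T + d * (M - T\<^sup>2)))) \<longlongrightarrow> 0) at_top"
      using d by real_asymp
    then have "((\<lambda>T. I b T - I a T) \<longlongrightarrow> 0) at_top"
      by (rule Lim_null_comparison[rotated]) (rule eventually_mono[OF eventually_ge_at_top[of 1]], rule bnd)
    moreover have "((\<lambda>T. I b T - I a T) \<longlongrightarrow> (CLBINT t. P d (Complex b t)) - (CLBINT t. P d (Complex a t))) at_top"
      by (intro tendsto_intros limI inta intb)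
    ultimately show ?thesis
      using tendsto_unique[OF trivial_limit_at_top_linorder] by fastforce
  qed
  define d where "d n = 1 / real (Suc n)" for n
  have d: "d n > 0" "d n \<le> 1" for n by (auto simp: d_def field_simps)
  have d0: "d \<longlonglongrightarrow> 0" unfolding d_def using LIMSEQ_Suc[OF lim_const_over_n[of "1::real"]] by simp
  have lim: "(\<lambda>n. CLBINT t. P (d n) (Complex x t)) \<longlonglongrightarrow> (CLBINT t. \<Phi> (Complex x t))"
    if x: "integrable lborel (\<lambda>t. \<Phi> (Complex x t))" for x
  proof (rule integral_dominated_convergence[where w = "\<lambda>t. exp (x\<^sup>2) * norm (\<Phi> (Complex x t))"])
    show "AE t in lborel. (\<lambda>n. P (d n) (Complex x t)) \<longlonglongrightarrow> \<Phi> (Complex x t)"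
    proof (intro AE_I2)
      fix t
      have "(\<lambda>n. P (d n) (Complex x t)) \<longlonglongrightarrow> \<Phi> (Complex x t) * exp (of_real 0 * (Complex x t)\<^sup>2)"
        unfolding P_def by (intro tendsto_intros d0)
      then show "(\<lambda>n. P (d n) (Complex x t)) \<longlonglongrightarrow> \<Phi> (Complex x t)" by simp
    qed
    show "AE t in lborel. norm (P (d n) (Complex x t)) \<le> exp (x\<^sup>2) * norm (\<Phi> (Complex x t))" for n
    proof (intro AE_I2)
      fix t
      have "d n * (x\<^sup>2 - t\<^sup>2) \<le> d n * x\<^sup>2" using d[of n] by (intro mult_left_mono) auto
      also have "... \<le> 1 * x\<^sup>2" using d[of n] by (intro mult_right_mono) auto
      finally show "norm (P (d n) (Complex x t)) \<le> exp (x\<^sup>2) * norm (\<Phi> (Complex x t))"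
        unfolding P_def norm_mult norm_gauss by (simp add: mult.commute mult_left_mono)
    qed
  qed (use x intP[OF x] d in \<open>auto simp: less_imp_le intro: borel_measurable_integrable\<close>)
  from lim[OF inta] lim[OF intb] show ?thesis
    using shift[OF d(1)] LIMSEQ_unique by simp
qed

section \<open>Greedy selection\<close>

text \<open>Markov's inequality off \<open>B\<close>: if \<open>f\<close> exceeded
  \<open>g * c\<close> on all of the complement, its mean would be at least
  \<open>(1 - b) * g * c\<close>, which exceeds \<open>c\<close>.\<close>

lemma exists_good_point:
  fixes M :: "'a measure" and f :: "'a \<Rightarrow> ennreal"
  assumes M: "prob_space M" and [measurable]: "f \<in> borel_measurable M" "B \<in> sets M"
    and B: "emeasure M B \<le> ennreal b" and f: "(\<integral>\<^sup>+x. f x \<partial>M) \<le> c"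
    and b: "0 \<le> b" "1 < (1 - b) * g" "0 \<le> g" and c: "c < \<infinity>"
  shows "\<exists>x\<in>space M - B. f x \<le> ennreal g * c"
proof (rule ccontr)
  assume "\<not> ?thesis"
  then have big: "ennreal g * c < f x" if "x \<in> space M" "x \<notin> B" for x
    using that by (auto simp: not_le)
  interpret prob_space M by fact
  have b1: "b < 1" using b mult_nonpos_nonneg[of "1 - b" g] by linarith
  have g: "g > 0" using b b1 by (smt (verit) zero_less_mult_pos)
  have good: "ennreal (1 - b) \<le> emeasure M (space M - B)"
  proof -
    have "prob B \<le> b" using B b by (simp add: emeasure_eq_measure)
    then show ?thesis by (simp add: emeasure_eq_measure prob_compl)
  qed
  have "ennreal ((1 - b) * g) * c \<le> ennreal g * c * emeasure M (space M - B)"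
    using mult_left_mono[OF good, of "ennreal g * c"] b1 g by (simp add: ennreal_mult ac_simps)
  also have "... = (\<integral>\<^sup>+x. ennreal g * c * indicator (space M - B) x \<partial>M)"
    by (simp add: nn_integral_cmult_indicator)
  also have "... \<le> (\<integral>\<^sup>+x. f x \<partial>M)"
    by (intro nn_integral_mono) (auto simp: indicator_def less_imp_le big)
  finally have le: "ennreal ((1 - b) * g) * c \<le> c" using f by simp
  show False
  proof (cases "c = 0")
    case False
    have "1 * c < ennreal ((1 - b) * g) * c"
      using ennreal_lessI[of "(1 - b) * g" 1] b False c
      by (intro ennreal_mult_strict_right_mono) (auto simp: zero_less_iff_neq_zero)
    with le show False by simp
  next
    \<comment> \<open>With \<open>c = 0\<close> the strict inequality is lost. Here \<open>f\<close>
      vanishes almost everywhere but is positive off \<open>B\<close>, so \<open>B\<close> has full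
      measure, against \<open>b < 1\<close>.\<close>
    case True
    have "AE x in M. f x = 0" using f True by (simp add: nn_integral_0_iff_AE)
    then have "AE x in M. x \<in> B"
      using AE_space by eventually_elim (use big True in fastforce)
    then have "emeasure M B = 1" by (simp add: emeasure_eq_1_AE)
    with B ennreal_lessI[of 1 b] b1 show False by simp
  qed
qed

text \<open>Method of conditional expectations: \<open>\<phi> n x\<close> has exponential moment at most 1 under \<open>M n\<close>, so
  the integral over the parameter space of the exponential of the partial sums cannot grow on average.\<close>
lemma greedy_selection:
  fixes M :: "nat \<Rightarrow> real measure" and \<phi> :: "nat \<Rightarrow> real \<Rightarrow> 'b \<Rightarrow> real" and \<mu> :: "'b measure"
    and B :: "nat \<Rightarrow> (nat \<Rightarrow> real) \<Rightarrow> real set" and \<gamma> :: "nat \<Rightarrow> real"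
  assumes M: "\<And>n. prob_space (M n)" and \<mu>: "finite_measure \<mu>"
    and \<phi>[measurable]: "\<And>n. (\<lambda>(x, s). \<phi> n x s) \<in> borel_measurable (M n \<Otimes>\<^sub>M \<mu>)"
    and mgf: "\<And>n s. s \<in> space \<mu> \<Longrightarrow> (\<integral>\<^sup>+x. ennreal (exp (\<phi> n x s)) \<partial>M n) \<le> 1"
    and B: "\<And>n q. (\<And>i. i < n \<Longrightarrow> q i \<in> space (M i)) \<Longrightarrow> B n q \<in> sets (M n) \<and> emeasure (M n) (B n q) \<le> ennreal (\<gamma> n / 4)"
    and B_cong: "\<And>n q q'. (\<And>i. i < n \<Longrightarrow> q i = q' i) \<Longrightarrow> B n q = B n q'"
    and \<gamma>: "\<And>n. 0 < \<gamma> n" "\<And>n. \<gamma> n \<le> 1" "summable \<gamma>"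
  shows "\<exists>q. (\<forall>n. q n \<in> space (M n) \<and> q n \<notin> B n q) \<and>
    (\<forall>n. (\<integral>\<^sup>+s. ennreal (exp (\<Sum>i<n. \<phi> i (q i) s)) \<partial>\<mu>) \<le> ennreal (exp (suminf \<gamma>)) * emeasure \<mu> (space \<mu>))"
proof -
  interpret \<mu>: finite_measure \<mu> by fact
  define \<Psi> where "\<Psi> q n = (\<integral>\<^sup>+s. ennreal (exp (\<Sum>i<n. \<phi> i (q i) s)) \<partial>\<mu>)" for q n
  \<comment> \<open>\<open>P q n r\<close> looks at \<open>q\<close> only below \<open>n\<close>, as
    dependent choice requires; \<open>\<gamma> n\<close> is the relative loss allowed at stage
    \<open>n\<close>.\<close>
  define P where "P q n r \<longleftrightarrow> r \<in> space (M n) \<and> r \<notin> B n q \<and>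
    (\<integral>\<^sup>+s. ennreal (exp (\<Sum>i<n. \<phi> i (q i) s)) * ennreal (exp (\<phi> n r s)) \<partial>\<mu>) \<le> ennreal (1 + \<gamma> n) * \<Psi> q n" for q n r
  have \<Psi>_Suc: "(\<integral>\<^sup>+s. ennreal (exp (\<Sum>i<n. \<phi> i (q i) s)) * ennreal (exp (\<phi> n (q n) s)) \<partial>\<mu>) = \<Psi> q (Suc n)" for q n
    unfolding \<Psi>_def by (simp add: exp_add ennreal_mult)
  have \<Psi>0: "\<Psi> q 0 = emeasure \<mu> (space \<mu>)" for q unfolding \<Psi>_def by simp
  have bound: "\<Psi> q n \<le> ennreal (exp (\<Sum>i<n. \<gamma> i)) * emeasure \<mu> (space \<mu>)"
    if "\<And>k. k < n \<Longrightarrow> P q k (q k)" for q n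
    using that
  proof (induction n)
    case (Suc n)
    have "\<Psi> q (Suc n) \<le> ennreal (1 + \<gamma> n) * \<Psi> q n"
      using Suc.prems[of n] unfolding P_def \<Psi>_Suc by simp
    also have "... \<le> ennreal (exp (\<gamma> n)) * (ennreal (exp (\<Sum>i<n. \<gamma> i)) * emeasure \<mu> (space \<mu>))"
      using Suc.prems by (intro mult_mono Suc.IH ennreal_leI) auto
    also have "... = ennreal (exp (\<Sum>i<Suc n. \<gamma> i)) * emeasure \<mu> (space \<mu>)"
      by (simp add: exp_add ennreal_mult mult_ac)
    finally show ?case .
  qed (simp add: \<Psi>0)
  have "\<exists>q. \<forall>n. P q n (q n)"
  proof (rule dependent_wellorder_choice)
    fix r :: real and f g :: "nat \<Rightarrow> real" and x :: nat
    assume "\<And>y. y < x \<Longrightarrow> f y = g y"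
    then show "P f x r = P g x r"
      unfolding P_def \<Psi>_def using B_cong[of x f g] by simp
  next
    fix n :: nat and q :: "nat \<Rightarrow> real"
    assume prev: "\<And>k. k < n \<Longrightarrow> P q k (q k)"
    have sp: "q i \<in> space (M i)" if "i < n" for i using prev[OF that] by (simp add: P_def)
    have meas[measurable]: "(\<lambda>s. \<phi> i (q i) s) \<in> borel_measurable \<mu>" if "i < n" for i
      using measurable_Pair2[OF \<phi> sp[OF that]] by simp
    define E where "E s = ennreal (exp (\<Sum>i<n. \<phi> i (q i) s))" for s
    have [measurable]: "E \<in> borel_measurable \<mu>" unfolding E_def by measurable
    interpret Mn: prob_space "M n" by (rule M)
    interpret pair_sigma_finite "M n" \<mu> ..
    \<comment> \<open>Averaging over the candidate \<open>x\<close> first, for fixed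
      \<open>s\<close>, lets \<open>mgf\<close> bound the new factor by 1: the mean of the next
      potential does not exceed the present one.\<close>
    have "(\<integral>\<^sup>+x. \<integral>\<^sup>+s. E s * ennreal (exp (\<phi> n x s)) \<partial>\<mu> \<partial>M n) = (\<integral>\<^sup>+s. \<integral>\<^sup>+x. E s * ennreal (exp (\<phi> n x s)) \<partial>M n \<partial>\<mu>)"
      by (rule Fubini'[symmetric]) measurable
    also have "... = (\<integral>\<^sup>+s. E s * (\<integral>\<^sup>+x. ennreal (exp (\<phi> n x s)) \<partial>M n) \<partial>\<mu>)"
      by (intro nn_integral_cong nn_integral_cmult) measurable
    also have "... \<le> (\<integral>\<^sup>+s. E s * 1 \<partial>\<mu>)"
      by (intro nn_integral_mono mult_left_mono mgf) auto
    finally have avg: "(\<integral>\<^sup>+x. \<integral>\<^sup>+s. E s * ennreal (exp (\<phi> n x s)) \<partial>\<mu> \<partial>M n) \<le> \<Psi> q n"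
      by (simp add: \<Psi>_def E_def)
    have fin: "\<Psi> q n < \<infinity>"
      using bound[OF prev] \<mu>.emeasure_finite ennreal_mult_less_top
      by (metis (no_types, lifting) ennreal_less_top infinity_ennreal_def le_less_trans less_top)
    have "\<exists>x\<in>space (M n) - B n q. (\<integral>\<^sup>+s. E s * ennreal (exp (\<phi> n x s)) \<partial>\<mu>) \<le> ennreal (1 + \<gamma> n) * \<Psi> q n"
    proof (rule exists_good_point[OF M])
      \<comment> \<open>The product is \<open>1 + 3 / 4 * \<gamma> n - (\<gamma> n)^2 / 4\<close>,
        so for \<open>0 < \<gamma> n \<le> 1\<close> the allowed loss outweighs the excluded
        measure.\<close>
      have "\<gamma> n * \<gamma> n \<le> 1 * \<gamma> n" using \<gamma>(1,2)[of n] by (intro mult_right_mono) auto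
      then show "1 < (1 - \<gamma> n / 4) * (1 + \<gamma> n)" using \<gamma>(1)[of n] by (simp add: algebra_simps)
    qed (use B[of n q] sp avg fin \<gamma>(1)[of n] in auto)
    then show "\<exists>r. P q n r" unfolding P_def E_def by auto
  qed
  then obtain q where q: "\<And>n. P q n (q n)" by blast
  have "\<Psi> q n \<le> ennreal (exp (suminf \<gamma>)) * emeasure \<mu> (space \<mu>)" for n
  proof -
    have "\<Psi> q n \<le> ennreal (exp (\<Sum>i<n. \<gamma> i)) * emeasure \<mu> (space \<mu>)" using q by (intro bound)
    also have "... \<le> ennreal (exp (suminf \<gamma>)) * emeasure \<mu> (space \<mu>)"
      using \<gamma> by (intro mult_right_mono ennreal_leI) (auto intro!: sum_le_suminf simp: less_imp_le simp del: sum_less_suminf)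
    finally show ?thesis .
  qed
  then show ?thesis using q unfolding P_def \<Psi>_def by blast
qed

section \<open>The logarithmic integral\<close>

text \<open>The integrand of \<open>li_beurling\<close> with its removable singularity at 1 filled
  by the limit; the bare quotient has value 0 there and is not continuous.\<close>

definition dens :: "real \<Rightarrow> real" where
  "dens u = (if u = 1 then 1 else (1 - 1 / u) / ln u)"

lemma dens_le_1: assumes "u \<ge> 1" shows "dens u \<le> 1"
proof (cases "u = 1")
  case False
  have "ln (1 / u) \<le> 1 / u - 1" using assms by (intro ln_le_minus_one) auto
  then show ?thesis using False assms by (simp add: dens_def ln_div divide_le_eq)
qed (simp add: dens_def)

lemma dens_ge: assumes "u \<ge> 1" shows "1 / u \<le> dens u"
proof (cases "u = 1")
  case False
  have "ln u \<le> u - 1" using assms by (intro ln_le_minus_one) auto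
  then show ?thesis using False assms by (simp add: dens_def field_simps)
qed (simp add: dens_def)

lemma dens_pos: "u \<ge> 1 \<Longrightarrow> dens u > 0"
  using dens_ge[of u] by (smt (verit) divide_pos_pos)

lemma continuous_on_dens: "continuous_on {1..} dens"
proof -
  have "isCont dens u" if "u > 0" for u
  proof (cases "u = 1")
    case True
    have "((\<lambda>u::real. (1 - 1 / u) / ln u) \<longlongrightarrow> 1) (at 1)" by real_asymp
    then have "(dens \<longlongrightarrow> 1) (at 1)"
      by (rule Lim_transform_eventually) (auto simp: dens_def eventually_at_filter)
    then show ?thesis using True by (simp add: isCont_def dens_def)
  next
    case False
    have "isCont (\<lambda>u. (1 - 1 / u) / ln u) u" using False that by (auto intro!: continuous_intros)
    moreover have "eventually (\<lambda>x. x \<noteq> 1) (nhds u)" using False by (rule t1_space_nhds)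
    ultimately show ?thesis
      by (subst isCont_cong[of _ "\<lambda>u. (1 - 1 / u) / ln u"]) (auto elim!: eventually_mono simp: dens_def)
  qed
  then show ?thesis by (intro continuous_at_imp_continuous_on) auto
qed

lemma measurable_dens[measurable]: "dens \<in> borel_measurable borel"
  unfolding dens_def by measurable

lemma integrable_dens: assumes "1 \<le> a" shows "dens integrable_on {a..b}"
  using assms by (intro integrable_continuous_interval continuous_on_subset[OF continuous_on_dens]) auto

lemma li_beurling_dens: "li_beurling x = integral {1..x} dens"
  unfolding li_beurling_def by (rule integral_spike[of "{1}"]) (auto simp: dens_def)

lemma li_beurling_diff:
  assumes "1 \<le> a" "a \<le> b"
  shows "li_beurling b - li_beurling a = integral {a..b} dens"
  using Henstock_Kurzweil_Integration.integral_combine[of 1 a b dens] integrable_dens[of 1 b] assms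
  by (simp add: li_beurling_dens)

text \<open>Integrates \<open>1 / u \<le> dens u \<le> 1\<close>. The rational lower bound gives
  strict monotonicity, the logarithmic one shows that li is unbounded.\<close>

lemma li_beurling_diff_bounds:
  assumes "1 \<le> a" "a \<le> b"
  shows "(b - a) / b \<le> li_beurling b - li_beurling a" "li_beurling b - li_beurling a \<le> b - a"
    "ln b - ln a \<le> li_beurling b - li_beurling a"
proof -
  have "((\<lambda>u. 1 / u) has_integral (ln b - ln a)) {a..b}"
    using assms by (intro fundamental_theorem_of_calculus)
      (auto intro!: derivative_eq_intros simp flip: has_real_derivative_iff_has_vector_derivative)
  from has_integral_le[OF this integrable_integral[OF integrable_dens[OF assms(1)]]]
  show *: "ln b - ln a \<le> li_beurling b - li_beurling a"
    using assms by (simp add: li_beurling_diff dens_ge)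
  have "ln (a / b) \<le> a / b - 1" using assms by (intro ln_le_minus_one) auto
  then show "(b - a) / b \<le> li_beurling b - li_beurling a"
    using * assms by (simp add: ln_div diff_divide_distrib)
  show "li_beurling b - li_beurling a \<le> b - a"
    using has_integral_le[OF integrable_integral[OF integrable_dens[OF assms(1)]] has_integral_const_real[of 1 a b]] assms
    by (simp add: li_beurling_diff dens_le_1)
qed

lemma li_beurling_strict_mono: "1 \<le> a \<Longrightarrow> a < b \<Longrightarrow> li_beurling a < li_beurling b"
  using li_beurling_diff_bounds(1)[of a b] by (smt (verit) divide_pos_pos)

lemma ex_li_beurling_eq:
  assumes "y \<ge> 0"
  shows "\<exists>x\<ge>1. li_beurling x = y"
proof -
  have 1: "li_beurling 1 = 0" by (simp add: li_beurling_def)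
  have "continuous_on {1..exp y} li_beurling"
    unfolding li_beurling_dens by (intro indefinite_integral_continuous_1 integrable_dens) simp
  moreover have "li_beurling (exp y) \<ge> y"
    using li_beurling_diff_bounds(3)[of 1 "exp y"] assms by (simp add: 1)
  ultimately show ?thesis
    using IVT'[of li_beurling 1 y "exp y"] assms by (auto simp: 1)
qed

text \<open>The bound \<open>real n + 1 \<le> xs n\<close> comes from
  \<open>li_beurling x \<le> x - 1\<close>; it later yields
  \<open>real n + 2 \<le> q n\<close>.\<close>

lemma ex_li_grid:
  "\<exists>xs :: nat \<Rightarrow> real. xs 0 = 1 \<and> strict_mono xs \<and> (\<forall>n. li_beurling (xs n) = real n \<and> real n + 1 \<le> xs n)"
proof -
  obtain xs where xs: "\<And>n. xs n \<ge> 1 \<and> li_beurling (xs n) = real n"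
    using ex_li_beurling_eq[of "real _"] by (metis of_nat_0_le_iff)
  have 1: "li_beurling 1 = 0" by (simp add: li_beurling_def)
  have "xs 0 = 1" using xs[of 0] li_beurling_strict_mono[of 1 "xs 0"] 1 by fastforce
  moreover have "strict_mono xs"
  proof (rule strict_monoI, rule ccontr)
    fix m n :: nat assume "m < n" "\<not> xs m < xs n"
    then show False using xs[of m] xs[of n] li_beurling_strict_mono[of "xs n" "xs m"]
      by (cases "xs m = xs n") auto
  qed
  moreover have "real n + 1 \<le> xs n" for n
    using li_beurling_diff_bounds(2)[of 1 "xs n"] xs[of n] by (simp add: 1)
  ultimately show ?thesis using xs by blast
qed

text \<open>The density of li is a mean of powers of \<open>u\<close>, so its Mellin transform
  reduces to that of a power.\<close>

lemma integral_inverse_powr: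
  assumes "u \<ge> 1"
  shows "(LINT y:{0..1}|lborel. complex_of_real u powr (- of_real y)) = of_real (dens u)"
proof (cases "u = 1")
  case True
  then show ?thesis by (simp add: dens_def set_lebesgue_integral_def scaleR_conv_of_real)
next
  case False
  with assms have assms: "u > 1" by simp
  have u: "ln u > 0" using assms by simp
  have e: "complex_of_real u powr (- of_real y) = exp (- (of_real (ln u) * of_real y))" for y :: real
    using assms by (simp add: powr_def Ln_of_real mult.commute)
  have "(LINT y:{0..1}|lborel. complex_of_real u powr (- of_real y))
     = (- exp (- (of_real (ln u) * of_real 1)) / of_real (ln u)) - (- exp (- (of_real (ln u) * of_real 0)) / of_real (ln u))"
    unfolding set_lebesgue_integral_def e
  proof (rule integral_FTC_atLeastAtMost)
    fix x :: real
    have "((\<lambda>w. - exp (- (complex_of_real (ln u) * w)) / of_real (ln u)) has_field_derivative exp (- (of_real (ln u) * of_real x))) (at (of_real x))"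
      using u by (auto intro!: derivative_eq_intros)
    then show "((\<lambda>v. - exp (- (complex_of_real (ln u) * of_real v)) / of_real (ln u)) has_vector_derivative exp (- (of_real (ln u) * of_real x))) (at x within {0..1})"
      by (rule has_vector_derivative_at_within[OF has_vector_derivative_real_field])
  next
    show "continuous_on {0..1} (\<lambda>x. exp (- (complex_of_real (ln u) * of_real x)))"
      by (intro continuous_intros)
  qed simp
  also have "... = of_real (dens u)"
    using assms u by (simp add: dens_def exp_minus exp_of_real field_simps)
  finally show ?thesis .
qed

lemma norm_of_real_powr: "u > 0 \<Longrightarrow> norm (complex_of_real u powr z) = u powr Re z"
  by (simp add: norm_powr_real_powr)

lemma integral_powr_at_top:
  assumes "Re z > 1"
  shows "set_integrable lborel {1..} (\<lambda>u. complex_of_real u powr (-z))"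
    "(LINT u:{1..}|lborel. complex_of_real u powr (-z)) = 1 / (z - 1)"
proof -
  have z: "z \<noteq> 1" using assms by auto
  have cont: "continuous_on {1..} (\<lambda>u. complex_of_real u powr (-z))"
    by (auto intro!: continuous_intros simp: complex_nonpos_Reals_iff)
  show int: "set_integrable lborel {1..} (\<lambda>u. complex_of_real u powr (-z))"
  proof -
    have "integrable lborel (\<lambda>u. indicator {1..} u *\<^sub>R (u powr (- Re z)))"
      using set_integrable_powr_at_top[of "- Re z" 1] assms by (simp add: set_integrable_def)
    moreover have "(\<lambda>u. indicator {1..} u *\<^sub>R complex_of_real u powr (-z)) \<in> borel_measurable lborel"
      using borel_measurable_continuous_on_indicator[OF _ cont] by simp
    ultimately show ?thesis
      unfolding set_integrable_def
      by (rule Bochner_Integration.integrable_bound) (auto simp: indicator_def norm_of_real_powr)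
  qed
  have "(LINT u:{1..}|lborel. complex_of_real u powr (-z)) = 0 - (complex_of_real 1 powr (1 - z) / (1 - z))"
  proof (rule integral_FTC_at_top[OF _ cont int, where F = "\<lambda>u. complex_of_real u powr (1 - z) / (1 - z)"])
    fix x :: real assume x: "1 \<le> x"
    have "((\<lambda>w. w powr (1 - z)) has_field_derivative (1 - z) * complex_of_real x powr (1 - z - 1)) (at (of_real x))"
      using x by (intro has_field_derivative_powr) (simp add: complex_nonpos_Reals_iff)
    from DERIV_cdivide[OF this, of "1 - z"]
    have "((\<lambda>w. w powr (1 - z) / (1 - z)) has_field_derivative complex_of_real x powr (-z)) (at (of_real x))"
      using z by simp
    then show "((\<lambda>u. complex_of_real u powr (1 - z) / (1 - z)) has_vector_derivative complex_of_real x powr (-z)) (at x)"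
      by (rule has_vector_derivative_real_field)
  next
    have "((\<lambda>u. u powr (1 - Re z)) \<longlongrightarrow> 0) at_top"
      using assms by (intro tendsto_neg_powr filterlim_ident) simp
    from tendsto_divide[OF this tendsto_const[of "norm (1 - z)"]]
    have "((\<lambda>u. u powr (1 - Re z) / norm (1 - z)) \<longlongrightarrow> 0) at_top"
      using z by simp
    then show "((\<lambda>u. complex_of_real u powr (1 - z) / (1 - z)) \<longlongrightarrow> 0) at_top"
      by (rule Lim_null_comparison[rotated], intro eventually_mono[OF eventually_gt_at_top[of 0]])
        (auto simp: norm_divide norm_of_real_powr)
  qed
  also have "... = 1 / (z - 1)" using z by (simp add: field_simps)
  finally show "(LINT u:{1..}|lborel. complex_of_real u powr (-z)) = 1 / (z - 1)" .
qed

lemma integral_inverse_Ln: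
  assumes "Re s > 1"
  shows "(LINT y:{0..1}|lborel. 1 / (s + of_real y - 1)) = Ln s - Ln (s - 1)"
proof -
  have "(LINT y:{0..1}|lborel. 1 / (s + of_real y - 1)) = Ln (s - 1 + of_real 1) - Ln (s - 1 + of_real 0)"
    unfolding set_lebesgue_integral_def
  proof (rule integral_FTC_atLeastAtMost)
    fix x :: real assume "0 \<le> x"
    then have "s - 1 + of_real x \<notin> \<real>\<^sub>\<le>\<^sub>0" "s - 1 + of_real x \<noteq> 0"
      using assms by (auto simp: complex_nonpos_Reals_iff complex_eq_iff)
    then have "((\<lambda>w. Ln (s - 1 + w)) has_field_derivative 1 / (s + of_real x - 1)) (at (of_real x))"
      by (auto intro!: derivative_eq_intros simp: field_simps)
    then show "((\<lambda>y. Ln (s - 1 + of_real y)) has_vector_derivative 1 / (s + of_real x - 1)) (at x within {0..1})"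
      by (rule has_vector_derivative_at_within[OF has_vector_derivative_real_field])
  next
    have "s + of_real y - 1 \<noteq> 0" if "y \<ge> 0" for y :: real
    proof
      assume "s + of_real y - 1 = 0"
      then have "Re (s + of_real y - 1) = 0" by simp
      then show False using assms that by simp
    qed
    then show "continuous_on {0..1} (\<lambda>y. 1 / (s + of_real y - 1))" by (auto intro!: continuous_intros)
  qed simp
  then show ?thesis by simp
qed

text \<open>After \<open>integral_inverse_powr\<close> and an exchange of integrals,
  \<open>1 / (s + y - 1)\<close> remains to be integrated over \<open>y\<close> in
  \<open>{0..1}\<close>. Stating the result as a difference of principal logarithms avoids any
  branch of the quotient.\<close>

lemma integral_dens_powr:
  assumes "Re s > 1"
  shows "set_integrable lborel {1..} (\<lambda>u. of_real (dens u) * complex_of_real u powr (-s))"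
    "(LINT u:{1..}|lborel. of_real (dens u) * complex_of_real u powr (-s)) = Ln s - Ln (s - 1)"
proof -
  let ?f = "\<lambda>(u, y). (indicator {1..} u * indicator {0..1} y) *\<^sub>R complex_of_real u powr (- (s + of_real y))"
  let ?g = "\<lambda>u. indicator {1..} u *\<^sub>R u powr (- Re s)"
  have g: "integrable lborel ?g"
    using set_integrable_powr_at_top[of "- Re s" 1] assms by (simp add: set_integrable_def)
  have int: "integrable (lborel \<Otimes>\<^sub>M lborel) ?f"
  proof (rule integrable_pair_lborel_bound[where g = ?g and h = "indicator {0..1}"])
    show "integrable lborel (indicator {0..1::real} :: real \<Rightarrow> real)" by simp
    show "norm (?f (u, y)) \<le> ?g u * indicator {0..1} y" for u y
      by (auto simp: indicator_def norm_of_real_powr intro!: powr_mono)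
    show "?f \<in> borel_measurable (lborel \<Otimes>\<^sub>M lborel)"
      unfolding powr_def by measurable
  qed (rule g)
  have inner: "(CLBINT y. ?f (u, y)) = indicator {1..} u *\<^sub>R (of_real (dens u) * complex_of_real u powr (-s))"
    for u
  proof (cases "u \<ge> 1")
    case True
    have "(CLBINT y. ?f (u, y)) = (CLBINT y. complex_of_real u powr (-s) * (indicator {0..1} y *\<^sub>R complex_of_real u powr (- of_real y)))"
      using True by (intro Bochner_Integration.integral_cong refl) (simp add: powr_add[symmetric] indicator_def)
    also have "... = complex_of_real u powr (-s) * of_real (dens u)"
      using integral_inverse_powr[OF True] by (subst integral_mult_right_zero) (simp add: set_lebesgue_integral_def)
    finally show ?thesis using True by simp
  qed simp
  have "(CLBINT u. CLBINT y. ?f (u, y)) = (CLBINT u. indicator {1..} u *\<^sub>R (of_real (dens u) * complex_of_real u powr (-s)))"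
    unfolding inner ..
  moreover have "(CLBINT y. CLBINT u. ?f (u, y)) = (CLBINT y. indicator {0..1} y *\<^sub>R (1 / (s + of_real y - 1)))"
  proof (intro Bochner_Integration.integral_cong refl)
    fix y :: real
    show "(CLBINT u. ?f (u, y)) = indicator {0..1} y *\<^sub>R (1 / (s + of_real y - 1))"
    proof (cases "y \<in> {0..1}")
      case True
      then have "Re (s + of_real y) > 1" using assms by simp
      from integral_powr_at_top(2)[OF this] show ?thesis
        using True by (simp add: set_lebesgue_integral_def)
    qed simp
  qed
  moreover have "(CLBINT y. CLBINT u. ?f (u, y)) = (CLBINT u. CLBINT y. ?f (u, y))"
    using lborel_pair.Fubini_integral[of "\<lambda>u y. ?f (u, y)"] int by simp
  ultimately show "(LINT u:{1..}|lborel. of_real (dens u) * complex_of_real u powr (-s)) = Ln s - Ln (s - 1)"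
    using integral_inverse_Ln[OF assms] by (simp add: set_lebesgue_integral_def)
  show "set_integrable lborel {1..} (\<lambda>u. of_real (dens u) * complex_of_real u powr (-s))"
    using lborel_pair.integrable_fst'[OF int] unfolding inner set_integrable_def .
qed

section \<open>Euler products over multisets\<close>

text \<open>Induction on \<open>N\<close>: a multiset over \<open>{..<Suc N}\<close> is one over
  \<open>{..<N}\<close> plus \<open>k\<close> copies of \<open>N\<close>, and the sum over
  \<open>k\<close> is geometric. Absolute summability is carried along because it justifies the
  double sum in the induction step.\<close>

lemma has_sum_euler_factor:
  fixes f :: "nat \<Rightarrow> complex"
  assumes "\<And>n. norm (f n) < 1"
  shows "(\<lambda>M. norm (prod_mset (image_mset f M))) summable_on {M. set_mset M \<subseteq> {..<N}}
    \<and> ((\<lambda>M. prod_mset (image_mset f M)) has_sum (\<Prod>n<N. 1 / (1 - f n))) {M. set_mset M \<subseteq> {..<N}}"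
proof (induction N)
  case 0
  have "{M :: nat multiset. set_mset M \<subseteq> {..<0}} = {{#}}" by auto
  then show ?case by (simp add: has_sum_finite_iff)
next
  case (Suc N)
  let ?A = "\<lambda>N. {M :: nat multiset. set_mset M \<subseteq> {..<N}}"
  define h where "h = (\<lambda>(M, k). M + replicate_mset k N)"
  have bij: "bij_betw h (?A N \<times> UNIV) (?A (Suc N))"
  proof (rule bij_betwI[where g = "\<lambda>M. (filter_mset (\<lambda>n. n \<noteq> N) M, count M N)"])
    fix x assume "x \<in> ?A N \<times> (UNIV :: nat set)"
    then have "count (fst x) N = 0" "\<forall>n\<in>#fst x. n \<noteq> N" by (auto simp: count_eq_zero_iff)
    then show "(filter_mset (\<lambda>n. n \<noteq> N) (h x), count (h x) N) = x"
      by (cases x) (auto simp: h_def filter_mset_eq_conv intro!: multiset_eqI)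
  next
    fix M assume "M \<in> ?A (Suc N)"
    then show "h (filter_mset (\<lambda>n. n \<noteq> N) M, count M N) = M"
      by (auto simp: h_def intro!: multiset_eqI)
  qed (auto simp: h_def less_Suc_eq split: if_splits)
  have term_eq: "prod_mset (image_mset f (h (M, k))) = prod_mset (image_mset f M) * f N ^ k" for M k
    by (simp add: h_def)
  have geo: "((\<lambda>k. c * f N ^ k) has_sum c * (1 / (1 - f N))) UNIV" for c
    by (intro has_sum_cmult_right norm_summable_imp_has_sum geometric_sums)
      (use assms[of N] in \<open>auto simp: norm_power summable_geometric\<close>)
  have geo': "((\<lambda>k. norm c * norm (f N) ^ k) has_sum norm c * (1 / (1 - norm (f N)))) UNIV" for c :: complex
    by (intro has_sum_cmult_right norm_summable_imp_has_sum geometric_sums)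
      (use assms[of N] in \<open>auto simp: norm_power summable_geometric\<close>)
  have "(\<lambda>(M, k). norm (prod_mset (image_mset f (h (M, k))))) summable_on ?A N \<times> UNIV"
  proof (rule summable_on_SigmaI)
    fix M
    show "((\<lambda>k. case (M, k) of (M, k) \<Rightarrow> norm (prod_mset (image_mset f (h (M, k))))) has_sum
       norm (prod_mset (image_mset f M)) * (1 / (1 - norm (f N)))) UNIV"
      using geo' by (simp add: term_eq norm_mult norm_power)
  next
    show "(\<lambda>M. norm (prod_mset (image_mset f M)) * (1 / (1 - norm (f N)))) summable_on ?A N"
      by (rule summable_on_cmult_left) (use Suc.IH in simp)
  qed auto
  then have abs: "(\<lambda>x. norm (prod_mset (image_mset f (h x)))) summable_on ?A N \<times> UNIV"
    by (simp add: case_prod_unfold)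
  have "((\<lambda>x. prod_mset (image_mset f (h x))) has_sum (\<Prod>n<N. 1 / (1 - f n)) * (1 / (1 - f N))) (?A N \<times> UNIV)"
  proof (rule has_sum_SigmaI)
    show "((\<lambda>M. prod_mset (image_mset f M) * (1 / (1 - f N))) has_sum (\<Prod>n<N. 1 / (1 - f n)) * (1 / (1 - f N))) (?A N)"
      by (intro has_sum_cmult_left) (use Suc.IH in simp)
    show "(\<lambda>x. prod_mset (image_mset f (h x))) summable_on ?A N \<times> UNIV"
      using abs by (rule abs_summable_summable)
  qed (use geo in \<open>simp add: term_eq\<close>)
  moreover have "(\<lambda>M. norm (prod_mset (image_mset f M))) summable_on ?A (Suc N)"
    using abs summable_on_reindex_bij_betw[OF bij, of "\<lambda>M. norm (prod_mset (image_mset f M))"] by simp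
  ultimately show ?case
    using has_sum_reindex_bij_betw[OF bij, of "\<lambda>M. prod_mset (image_mset f M)"] by simp
qed

lemma norm_prod_mset: "norm (prod_mset (image_mset f M) :: complex) = prod_mset (image_mset (\<lambda>n. norm (f n)) M)"
  by (induction M) (auto simp: norm_mult)

lemma has_sum_approx:
  assumes "(f has_sum S) A" "e > 0"
  shows "\<exists>X. finite X \<and> X \<subseteq> A \<and> (\<forall>Y. finite Y \<longrightarrow> X \<subseteq> Y \<longrightarrow> Y \<subseteq> A \<longrightarrow> dist (sum f Y) S < e)"
  using assms unfolding has_sum_def tendsto_iff eventually_finite_subsets_at_top by metis

text \<open>Links an unordered sum over all multisets to the limit of finite Euler products.\<close>

lemma has_sum_exhaustion:
  fixes f :: "'a \<Rightarrow> complex"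
  assumes A: "incseq A" "(\<Union>N. A N) = UNIV" and f: "f summable_on UNIV"
    and S: "\<And>N. (f has_sum S N) (A N)"
  shows "S \<longlonglongrightarrow> infsum f UNIV"
proof (rule metric_LIMSEQ_I)
  fix e :: real assume "e > 0"
  then have e: "e / 2 > 0" by simp
  obtain X where X: "finite X" "\<And>Y. finite Y \<Longrightarrow> X \<subseteq> Y \<Longrightarrow> dist (sum f Y) (infsum f UNIV) < e / 2"
    using has_sum_approx[OF has_sum_infsum[OF f] e] by auto
  have "\<exists>N. X \<subseteq> A N"
    using X(1)
  proof induction
    case (insert x X)
    then obtain N where N: "X \<subseteq> A N" by blast
    obtain K where "x \<in> A K" using A(2) by blast
    then have "insert x X \<subseteq> A (max N K)"
      using N incseqD[OF A(1), of N "max N K"] incseqD[OF A(1), of K "max N K"] by auto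
    then show ?case by blast
  qed simp
  then obtain N where N: "X \<subseteq> A N" by blast
  have "dist (S n) (infsum f UNIV) < e" if "n \<ge> N" for n
  proof -
    obtain X' where X': "finite X'" "X' \<subseteq> A n" "\<And>Y. finite Y \<Longrightarrow> X' \<subseteq> Y \<Longrightarrow> Y \<subseteq> A n \<Longrightarrow> dist (sum f Y) (S n) < e / 2"
      using has_sum_approx[OF S[of n] e] by auto
    have "X \<subseteq> A n" using N incseqD[OF A(1) that] by auto
    then have "dist (sum f (X \<union> X')) (S n) < e / 2" "dist (sum f (X \<union> X')) (infsum f UNIV) < e / 2"
      using X X' by auto
    then show ?thesis by (metis dist_triangle_half_r)
  qed
  then show "\<exists>N. \<forall>n\<ge>N. dist (S n) (infsum f UNIV) < e" by blast
qed

lemma finite_multisets_bounded: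
  assumes "finite F" shows "\<exists>N. F \<subseteq> {M :: nat multiset. set_mset M \<subseteq> {..<N}}"
proof -
  have "finite (\<Union>M\<in>F. set_mset M)" using assms by auto
  then obtain N where "\<forall>n\<in>(\<Union>M\<in>F. set_mset M). n < N" using finite_nat_set_iff_bounded by blast
  then show ?thesis by (intro exI[of _ N]) auto
qed

text \<open>The sum runs over index multisets and not over products, so no unique factorization is
  involved. The bound 1/2 gives both \<open>1 / (1 - x) \<le> exp (2 * x)\<close> and
  \<open>norm (Ln (1 - z)) \<le> 2 * norm z\<close>.\<close>

lemma euler_product:
  fixes f :: "nat \<Rightarrow> complex"
  assumes half: "\<And>n. norm (f n) \<le> 1 / 2" and summ: "summable (\<lambda>n. norm (f n))"
  shows "(\<lambda>M. norm (prod_mset (image_mset f M))) summable_on UNIV"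
    and "summable (\<lambda>n. - Ln (1 - f n))"
    and "infsum (\<lambda>M. prod_mset (image_mset f M)) UNIV = exp (\<Sum>n. - Ln (1 - f n))"
proof -
  have lt1: "norm (f n) < 1" for n using half[of n] by simp
  define B where "B = exp (\<Sum>n. 2 * norm (f n))"
  have pointwise: "1 / (1 - norm (f n)) \<le> exp (2 * norm (f n))" for n
  proof -
    let ?x = "norm (f n)"
    have "?x * ?x \<le> ?x * (1 / 2)" using half by (intro mult_left_mono) auto
    then have "1 \<le> (1 + 2 * ?x) * (1 - ?x)" by (simp add: algebra_simps)
    also have "... \<le> exp (2 * ?x) * (1 - ?x)" using lt1[of n] by (intro mult_right_mono) auto
    finally show ?thesis using lt1[of n] by (simp add: divide_le_eq)
  qed
  show abs: "(\<lambda>M. norm (prod_mset (image_mset f M))) summable_on UNIV"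
  proof (rule nonneg_bdd_above_summable_on)
    show "bdd_above (sum (\<lambda>M. norm (prod_mset (image_mset f M))) ` {F. F \<subseteq> UNIV \<and> finite F})"
    proof (rule bdd_aboveI2[where M = B])
      fix F :: "nat multiset set" assume "F \<in> {F. F \<subseteq> UNIV \<and> finite F}"
      then have F: "finite F" by simp
      then obtain N where N: "F \<subseteq> {M. set_mset M \<subseteq> {..<N}}" using finite_multisets_bounded by blast
      \<comment> \<open>The finite Euler product is applied to the norms, viewed as complex numbers,
        to bound every finite sum of norms.\<close>
      define g where "g n = complex_of_real (norm (f n))" for n
      have g: "norm (g n) < 1" for n using lt1 by (simp add: g_def)
      have ng: "norm (prod_mset (image_mset g M)) = norm (prod_mset (image_mset f M))" for M
        by (simp add: norm_prod_mset g_def)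
      have pg: "prod_mset (image_mset g M) = of_real (norm (prod_mset (image_mset f M)))" for M
        by (induction M) (auto simp: g_def norm_mult)
      have "((\<lambda>M. complex_of_real (norm (prod_mset (image_mset f M)))) has_sum (\<Prod>n<N. 1 / (1 - g n))) {M. set_mset M \<subseteq> {..<N}}"
        using has_sum_euler_factor[of g N, OF g] by (simp add: pg)
      moreover have "(\<Prod>n<N. 1 / (1 - g n)) = of_real (\<Prod>n<N. 1 / (1 - norm (f n)))"
        by (simp add: g_def)
      ultimately have "((\<lambda>M. norm (prod_mset (image_mset f M))) has_sum (\<Prod>n<N. 1 / (1 - norm (f n)))) {M. set_mset M \<subseteq> {..<N}}"
        by (simp only: has_sum_of_real_iff)
      then have "(\<Sum>M\<in>F. norm (prod_mset (image_mset f M))) \<le> (\<Prod>n<N. 1 / (1 - norm (f n)))"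
        using F N by (intro has_sum_mono_neutral[OF has_sum_finite]) auto
      also have "... \<le> (\<Prod>n<N. exp (2 * norm (f n)))"
        using lt1 by (intro prod_mono) (auto simp: pointwise less_imp_le intro: pointwise)
      also have "... = exp (\<Sum>n<N. 2 * norm (f n))" by (simp add: exp_sum)
      also have "... \<le> B" unfolding B_def using summ by (auto intro!: sum_le_suminf summable_mult)
      finally show "(\<Sum>M\<in>F. norm (prod_mset (image_mset f M))) \<le> B" .
    qed
  qed auto
  have nb: "norm (- Ln (1 - f n)) \<le> 2 * norm (f n)" for n
  proof -
    have "norm (Ln (1 + - f n) - - f n) \<le> (norm (- f n))\<^sup>2 / (1 - norm (- f n))"
      using lt1 by (intro Ln_approx_linear) simp
    also have "... \<le> norm (f n)"
    proof -
      have "norm (f n) * norm (f n) \<le> norm (f n) * (1 / 2)" using half by (intro mult_left_mono) auto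
      then have "norm (f n) * norm (f n) \<le> norm (f n) * (1 - norm (f n))" by (simp add: algebra_simps)
      then show ?thesis using lt1[of n] by (simp add: divide_le_eq power2_eq_square)
    qed
    finally have "norm (Ln (1 - f n) + f n) \<le> norm (f n)" by simp
    then show ?thesis using norm_triangle_ineq4[of "Ln (1 - f n) + f n" "f n"] by simp
  qed
  show ln: "summable (\<lambda>n. - Ln (1 - f n))"
    by (rule summable_comparison_test'[OF summable_mult[OF summ, of 2] nb])
  have "(\<lambda>N. \<Prod>n<N. 1 / (1 - f n)) \<longlonglongrightarrow> infsum (\<lambda>M. prod_mset (image_mset f M)) UNIV"
  proof (rule has_sum_exhaustion)
    show "incseq (\<lambda>N. {M :: nat multiset. set_mset M \<subseteq> {..<N}})" by (auto simp: incseq_def)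
    show "(\<Union>N. {M :: nat multiset. set_mset M \<subseteq> {..<N}}) = UNIV"
      using finite_multisets_bounded[of "{_}"] by auto
    show "(\<lambda>M. prod_mset (image_mset f M)) summable_on UNIV" using abs by (rule abs_summable_summable)
  qed (use has_sum_euler_factor lt1 in blast)
  moreover have "(\<Prod>n<N. 1 / (1 - f n)) = exp (\<Sum>n<N. - Ln (1 - f n))" for N
  proof -
    have "1 - f n \<noteq> 0" for n using lt1[of n] by auto
    then show ?thesis by (simp add: exp_sum exp_minus divide_inverse del: sum_negf)
  qed
  moreover have "(\<lambda>N. exp (\<Sum>n<N. - Ln (1 - f n))) \<longlonglongrightarrow> exp (\<Sum>n. - Ln (1 - f n))"
    by (intro tendsto_exp summable_LIMSEQ ln)
  ultimately show "infsum (\<lambda>M. prod_mset (image_mset f M)) UNIV = exp (\<Sum>n. - Ln (1 - f n))"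
    using LIMSEQ_unique by simp
qed

section \<open>Near coincidences\<close>

text \<open>The product belonging to \<open>M\<close> if each q_i is replaced by its a priori lower
  bound i + 2. Thresholds built from it do not depend on the primes still to be chosen.\<close>

definition nat_size :: "nat multiset \<Rightarrow> real" where
  "nat_size M = prod_mset (image_mset (\<lambda>i. real i + 2) M)"

lemma nat_size_ge_1: "nat_size M \<ge> 1"
proof (induction M)
  case (add i M)
  have "1 * 1 \<le> (real i + 2) * nat_size M" using add by (intro mult_mono) auto
  then show ?case by (simp add: nat_size_def)
qed (simp add: nat_size_def)

lemma nat_size_pos: "nat_size M > 0"
  using nat_size_ge_1[of M] by simp

lemma nat_size_add_mset: "nat_size (add_mset i M) = (real i + 2) * nat_size M"
  by (simp add: nat_size_def)

lemma summable_inverse_squares: "summable (\<lambda>n. 1 / (real n + 2)\<^sup>2)"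
  using summable_iff_shift[of "\<lambda>n. 1 / (real n)\<^sup>2" 2] inverse_power_summable[of 2, where 'a = real]
  by (simp add: field_simps)

text \<open>\<open>euler_product\<close> for the factors \<open>1 / (n + 2)^2\<close>; the square
  makes the series converge and the factors at most 1/4.\<close>

lemma summable_nat_size: "(\<lambda>M. 1 / (nat_size M)\<^sup>2) summable_on UNIV"
proof -
  let ?f = "\<lambda>n. complex_of_real (1 / (real n + 2)\<^sup>2)"
  have nf: "norm (?f n) = 1 / (real n + 2)\<^sup>2" for n
    unfolding norm_of_real by simp
  have "norm (prod_mset (image_mset ?f M)) = 1 / (nat_size M)\<^sup>2" for M
    unfolding norm_prod_mset nf by (induction M) (auto simp: nat_size_def power_mult_distrib)
  moreover have "norm (?f n) \<le> 1 / 2" for n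
    unfolding nf using power_mono[of 2 "real n + 2" 2] by (simp add: field_simps)
  moreover have "summable (\<lambda>n. norm (?f n))"
    unfolding nf by (rule summable_inverse_squares)
  ultimately show ?thesis using euler_product(1)[of ?f] by simp
qed

text \<open>\<open>add_mset n\<close> is a bijection onto the multisets containing \<open>n\<close>.
  The factor \<open>1 / (n + 2)^2\<close> it produces makes the measures of the bad sets summable
  over \<open>n\<close>.\<close>

lemma has_sum_nat_size_mem:
  "((\<lambda>M. 1 / (nat_size M)\<^sup>2) has_sum (1 / (real n + 2)\<^sup>2 * (\<Sum>\<^sub>\<infinity>M. 1 / (nat_size M)\<^sup>2))) {M. n \<in># M}"
proof -
  have bij: "bij_betw (add_mset n) UNIV {M. n \<in># M}"
    by (rule bij_betwI[where g = "\<lambda>M. M - {#n#}"]) auto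
  have "((\<lambda>M. 1 / (real n + 2)\<^sup>2 * (1 / (nat_size M)\<^sup>2)) has_sum (1 / (real n + 2)\<^sup>2 * (\<Sum>\<^sub>\<infinity>M. 1 / (nat_size M)\<^sup>2))) UNIV"
    by (intro has_sum_cmult_right has_sum_infsum summable_nat_size)
  then have "((\<lambda>M. 1 / (nat_size (add_mset n M))\<^sup>2) has_sum (1 / (real n + 2)\<^sup>2 * (\<Sum>\<^sub>\<infinity>M. 1 / (nat_size M)\<^sup>2))) UNIV"
    by (simp add: nat_size_add_mset power_mult_distrib)
  then show ?thesis using has_sum_reindex_bij_betw[OF bij, of "\<lambda>M. 1 / (nat_size M)\<^sup>2"] by simp
qed

lemma countable_multisets: "countable (A :: nat multiset set)"
proof -
  have "A \<subseteq> range mset" by (metis UNIV_I ex_mset image_iff subsetI)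
  then show ?thesis by (rule countable_subset) simp
qed

text \<open>Countable subadditivity with an unordered sum of bounds, suited to pairs of multisets as
  indices: the union is dominated by the sum of indicators, and the two integrals are
  exchanged.\<close>

lemma emeasure_Union_le:
  assumes I: "countable I" and X: "\<And>i. i \<in> I \<Longrightarrow> X i \<in> sets M"
    and le: "\<And>i. i \<in> I \<Longrightarrow> emeasure M (X i) \<le> ennreal (b i)"
    and b: "(b has_sum s) I" "\<And>i. i \<in> I \<Longrightarrow> 0 \<le> b i"
  shows "emeasure M (\<Union>i\<in>I. X i) \<le> ennreal s"
proof -
  have [measurable]: "(\<Union>i\<in>I. X i) \<in> sets M" using I X by (intro sets.countable_UN') auto
  have "emeasure M (\<Union>i\<in>I. X i) = (\<integral>\<^sup>+x. indicator (\<Union>i\<in>I. X i) x \<partial>M)"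
    by simp
  also have "... \<le> (\<integral>\<^sup>+x. \<integral>\<^sup>+i. indicator (X i) x \<partial>count_space I \<partial>M)"
  proof (intro nn_integral_mono)
    fix x
    show "indicator (\<Union>i\<in>I. X i) x \<le> (\<integral>\<^sup>+i. indicator (X i) x \<partial>count_space I)"
    proof (cases "x \<in> (\<Union>i\<in>I. X i)")
      case True
      then obtain i where i: "i \<in> I" "x \<in> X i" by blast
      have "(\<integral>\<^sup>+j. indicator {i} j \<partial>count_space I) \<le> (\<integral>\<^sup>+i. indicator (X i) x \<partial>count_space I)"
        using i by (intro nn_integral_mono) (auto simp: indicator_def)
      then show ?thesis using i True by simp
    qed simp
  qed
  also have "... = (\<integral>\<^sup>+i. \<integral>\<^sup>+x. indicator (X i) x \<partial>M \<partial>count_space I)"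
    using I X by (intro nn_integral_count_space_nn_integral) auto
  also have "... = (\<integral>\<^sup>+i. emeasure M (X i) \<partial>count_space I)"
    using X by (intro nn_integral_cong) simp
  also have "... \<le> (\<integral>\<^sup>+i. ennreal (b i) \<partial>count_space I)"
    using le by (intro nn_integral_mono) simp
  also have "... = ennreal s"
  proof -
    have "Infinite_Sum.abs_summable_on b I"
      using b by (intro summable_on_cong[THEN iffD1, OF _ has_sum_imp_summable[OF b(1)]]) simp
    then have 1: "Infinite_Set_Sum.abs_summable_on b I" using abs_summable_equivalent[of b I] by blast
    then have "(\<integral>\<^sup>+i. ennreal (b i) \<partial>count_space I) = ennreal (infsetsum b I)"
      using 1 b by (intro nn_integral_conv_infsetsum)
    also have "infsetsum b I = s"
      using infsetsum_infsum[OF 1] infsumI[OF b(1)] by simp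
    finally show ?thesis .
  qed
  finally show ?thesis .
qed

text \<open>Only the density is cut off; the sigma-algebra stays that of all reals, so all these
  measures share one space.\<close>

definition li_measure :: "real \<Rightarrow> real \<Rightarrow> real measure" where
  "li_measure a b = density lborel (\<lambda>u. ennreal (indicator {a<..b} u * dens u))"

lemma sets_li_measure[simp, measurable_cong]: "sets (li_measure a b) = sets borel"
  by (simp add: li_measure_def)

lemma space_li_measure[simp]: "space (li_measure a b) = UNIV"
  by (simp add: li_measure_def)

lemma emeasure_li_measure_le:
  assumes [measurable]: "S \<in> sets borel" and "1 \<le> a" and S: "\<And>x. x \<in> S \<Longrightarrow> a < x \<Longrightarrow> x \<le> b \<Longrightarrow> x \<in> {l..r}" and "l \<le> r"
  shows "emeasure (li_measure a b) S \<le> ennreal (r - l)"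
proof -
  have "emeasure (li_measure a b) S = (\<integral>\<^sup>+u. ennreal (indicator {a<..b} u * dens u) * indicator S u \<partial>lborel)"
    unfolding li_measure_def by (intro emeasure_density) auto
  also have "... \<le> (\<integral>\<^sup>+u. indicator {l..r} u \<partial>lborel)"
    using assms dens_le_1 by (intro nn_integral_mono) (auto simp: indicator_def)
  finally show ?thesis using assms by simp
qed

lemma emeasure_li_measure_compl:
  "emeasure (li_measure a b) (- {a<..b}) = 0"
proof -
  have "emeasure (li_measure a b) (- {a<..b}) = (\<integral>\<^sup>+u. ennreal (indicator {a<..b} u * dens u) * indicator (- {a<..b}) u \<partial>lborel)"
    unfolding li_measure_def by (intro emeasure_density) auto
  also have "(\<lambda>u. ennreal (indicator {a<..b} u * dens u) * indicator (- {a<..b}) u) = (\<lambda>u. 0)"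
    by (auto simp: indicator_def fun_eq_iff)
  finally show ?thesis by simp
qed

text \<open>The set is short because \<open>A x\<^sup>k\<close> has derivative at least 1 in \<open>x\<close>.\<close>
lemma emeasure_near_coincidence:
  fixes A B d :: real
  assumes A: "A \<ge> 1" and k: "k \<ge> 1" and a: "1 \<le> a" and d: "d > 0"
  shows "emeasure (li_measure a b) {x. \<bar>A * x ^ k - B\<bar> < d} \<le> ennreal (4 * d)"
proof (cases "\<exists>x0. a < x0 \<and> \<bar>A * x0 ^ k - B\<bar> < d")
  case True
  then obtain x0 where x0: "a < x0" "\<bar>A * x0 ^ k - B\<bar> < d" by blast
  \<comment> \<open>\<open>A * x ^ k\<close> expands distances on \<open>x \<ge> 1\<close>, and any
    two of its values in question differ by less than \<open>2 * d\<close>; hence all points lie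
    within \<open>2 * d\<close> of \<open>x0\<close>.\<close>
  have lip: "y - x \<le> A * y ^ k - A * x ^ k" if "1 \<le> x" "x \<le> y" for x y
  proof -
    obtain m where m: "k = Suc m" using k by (cases k) auto
    have "y - x \<le> y ^ m * (y - x)" using that one_le_power[of y m] mult_right_mono[of 1 "y ^ m" "y - x"] by simp
    also have "... \<le> y ^ k - x ^ k"
      using that power_mono[of x y m] mult_right_mono[of "x ^ m" "y ^ m" x] by (simp add: m algebra_simps)
    also have "... \<le> A * (y ^ k - x ^ k)"
      using that A power_mono[of x y k] mult_right_mono[of 1 A "y ^ k - x ^ k"] by simp
    finally show ?thesis by (simp add: algebra_simps)
  qed
  have "emeasure (li_measure a b) {x. \<bar>A * x ^ k - B\<bar> < d} \<le> ennreal (x0 + 2 * d - (x0 - 2 * d))"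
  proof (rule emeasure_li_measure_le)
    fix x assume "x \<in> {x. \<bar>A * x ^ k - B\<bar> < d}" "a < x"
    then show "x \<in> {x0 - 2 * d..x0 + 2 * d}"
      using lip[of x x0] lip[of x0 x] x0 a by (cases "x \<le> x0") auto
  qed (use a d in auto)
  then show ?thesis by simp
next
  case False
  have "emeasure (li_measure a b) {x. \<bar>A * x ^ k - B\<bar> < d} \<le> ennreal (0 - 0)"
    by (rule emeasure_li_measure_le) (use False a in auto)
  then show ?thesis by simp
qed

section \<open>Near coincidences between products of primes\<close>

definition beurling_prod :: "(nat \<Rightarrow> real) \<Rightarrow> nat multiset \<Rightarrow> real" where
  "beurling_prod q M = prod_mset (image_mset q M)"

lemma beurling_prod_cong: "(\<And>i. i \<in># M \<Longrightarrow> q i = q' i) \<Longrightarrow> beurling_prod q M = beurling_prod q' M"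
  unfolding beurling_prod_def by (metis image_mset_cong)

lemma beurling_prod_union: "beurling_prod q (M + M') = beurling_prod q M * beurling_prod q M'"
  by (simp add: beurling_prod_def)

lemma beurling_prod_ge_1:
  assumes "\<And>i. i \<in># M \<Longrightarrow> q i \<ge> 1" shows "beurling_prod q M \<ge> 1"
  using assms
proof (induction M)
  case (add i M)
  have qi: "1 \<le> q i" and bq: "1 \<le> beurling_prod q M" using add by auto
  have "1 * 1 \<le> q i * beurling_prod q M" using mult_mono[OF qi bq] qi by simp
  then show ?case by (simp add: beurling_prod_def)
qed (simp add: beurling_prod_def)

text \<open>The choices of the \<open>n\<close>-th prime producing a near coincidence between products of
  the first \<open>n + 1\<close> primes; the separation threshold depends only on the index multisets.\<close>
definition bad_set :: "real \<Rightarrow> nat \<Rightarrow> (nat \<Rightarrow> real) \<Rightarrow> real set" where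
  "bad_set c n q = (if \<forall>i<n. q i \<ge> 1 then
     (\<Union>(M, M')\<in>{(M, M'). n \<in># M \<and> set_mset M \<subseteq> {..n} \<and> set_mset M' \<subseteq> {..<n}}.
       {x. \<bar>beurling_prod (q(n := x)) M - beurling_prod q M'\<bar> < c / (nat_size M * nat_size M')\<^sup>2}) else {})"

lemma bad_set_cong:
  assumes "\<And>i. i < n \<Longrightarrow> q i = q' i"
  shows "bad_set c n q = bad_set c n q'"
proof -
  have *: "beurling_prod (q(n := x)) M = beurling_prod (q'(n := x)) M" if "set_mset M \<subseteq> {..n}" for M x
    using that assms by (intro beurling_prod_cong) (auto simp: le_less)
  have **: "beurling_prod q M = beurling_prod q' M" if "set_mset M \<subseteq> {..<n}" for M
    using that assms by (intro beurling_prod_cong) auto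
  show ?thesis
    unfolding bad_set_def using assms by (intro if_cong SUP_cong) (auto simp: * **)
qed

text \<open>As a function of the \<open>n\<close>-th prime the product is a monomial, the shape
  treated by \<open>emeasure_near_coincidence\<close>.\<close>

lemma beurling_prod_upd:
  "beurling_prod (q(n := x)) M = beurling_prod q (filter_mset (\<lambda>i. i \<noteq> n) M) * x ^ count M n"
  by (induction M) (auto simp: beurling_prod_def)

text \<open>Union bound over all pairs: one pair costs
  \<open>4 * c / (nat_size M * nat_size M')^2\<close>, and the sum is enlarged to all
  \<open>M\<close> containing \<open>n\<close> and all \<open>M'\<close>. The guard in
  \<open>bad_set\<close> makes the leading coefficient at least 1; it lets the bound hold for every
  \<open>q\<close>, as \<open>greedy_selection\<close> demands for measures whose space is the whole
  line.\<close>

lemma bad_set_bound: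
  assumes a: "1 \<le> a" and c: "c > 0"
  shows "bad_set c n q \<in> sets borel"
    "emeasure (li_measure a b) (bad_set c n q) \<le> ennreal (4 * c * (\<Sum>\<^sub>\<infinity>M. 1 / (nat_size M)\<^sup>2)\<^sup>2 / (real n + 2)\<^sup>2)"
proof -
  define Z where "Z = (\<Sum>\<^sub>\<infinity>M. 1 / (nat_size M)\<^sup>2)"
  define K where "K = {(M, M'). n \<in># M \<and> set_mset M \<subseteq> {..n} \<and> set_mset M' \<subseteq> {..<n}}"
  define X where "X = (\<lambda>(M, M'). {x. \<bar>beurling_prod (q(n := x)) M - beurling_prod q M'\<bar> < c / (nat_size M * nat_size M')\<^sup>2})"
  define \<beta> where "\<beta> = (\<lambda>(M, M'). 4 * c * (1 / (nat_size M)\<^sup>2 * (1 / (nat_size M')\<^sup>2)))"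
  have X: "X k \<in> sets borel" for k
    unfolding X_def beurling_prod_upd by (cases k) simp
  have ctbl: "countable K"
    by (rule countable_subset[of _ "UNIV \<times> UNIV"]) (auto simp del: UNIV_Times_UNIV intro!: countable_SIGMA countable_multisets)
  have Z: "Z \<ge> 0" unfolding Z_def by (intro infsum_nonneg) simp
  show "bad_set c n q \<in> sets borel"
  proof (cases "\<forall>i<n. q i \<ge> 1")
    case True
    have "(\<Union>k\<in>K. X k) \<in> sets borel" using ctbl X by (intro sets.countable_UN') auto
    moreover have "bad_set c n q = (\<Union>k\<in>K. X k)" using True unfolding bad_set_def K_def X_def by simp
    ultimately show ?thesis by simp
  qed (simp only: bad_set_def if_False sets.empty_sets)
  show "emeasure (li_measure a b) (bad_set c n q) \<le> ennreal (4 * c * (\<Sum>\<^sub>\<infinity>M. 1 / (nat_size M)\<^sup>2)\<^sup>2 / (real n + 2)\<^sup>2)"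
  proof (cases "\<forall>i<n. q i \<ge> 1")
    case True
    have all: "(\<beta> has_sum (4 * c * (1 / (real n + 2)\<^sup>2 * Z * Z))) ({M. n \<in># M} \<times> UNIV)"
    proof -
      have 1: "((\<lambda>M'. \<beta> (M, M')) has_sum (4 * c * (1 / (nat_size M)\<^sup>2 * Z))) UNIV" for M
        unfolding \<beta>_def Z_def prod.case by (intro has_sum_cmult_right has_sum_infsum summable_nat_size)
      have 2: "((\<lambda>M. 4 * c * (1 / (nat_size M)\<^sup>2 * Z)) has_sum (4 * c * (1 / (real n + 2)\<^sup>2 * Z * Z))) {M. n \<in># M}"
        using has_sum_nat_size_mem[of n] unfolding Z_def[symmetric]
        by (intro has_sum_cmult_right has_sum_cmult_left)
      show ?thesis
      proof (rule has_sum_SigmaI[OF 1 2])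
        show "\<beta> summable_on {M. n \<in># M} \<times> UNIV"
          by (rule summable_on_SigmaI[OF 1 has_sum_imp_summable[OF 2]]) (use c in \<open>simp add: \<beta>_def\<close>)
      qed
    qed
    have sub: "K \<subseteq> {M. n \<in># M} \<times> UNIV" by (auto simp: K_def)
    have nn: "\<beta> k \<ge> 0" for k using c by (cases k) (simp add: \<beta>_def)
    have summK: "\<beta> summable_on K"
      using summable_on_subset_banach[OF has_sum_imp_summable[OF all] sub] .
    have "bad_set c n q = (\<Union>k\<in>K. X k)" using True unfolding bad_set_def K_def X_def by simp
    also have "emeasure (li_measure a b) ... \<le> ennreal (infsum \<beta> K)"
    proof (rule emeasure_Union_le[OF ctbl _ _ has_sum_infsum[OF summK] nn])
      fix k assume "k \<in> K"
      then obtain M M' where k: "k = (M, M')" "n \<in># M" "set_mset M \<subseteq> {..n}" by (auto simp: K_def)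
      have "beurling_prod q (filter_mset (\<lambda>i. i \<noteq> n) M) \<ge> 1"
      proof (rule beurling_prod_ge_1)
        fix i assume "i \<in># filter_mset (\<lambda>i. i \<noteq> n) M"
        then have "i \<in> {..n}" "i \<noteq> n" using k(3) by auto
        then show "1 \<le> q i" using True by simp
      qed
      then have "emeasure (li_measure a b) (X k) \<le> ennreal (4 * (c / (nat_size M * nat_size M')\<^sup>2))"
        unfolding X_def k(1) prod.case beurling_prod_upd using k c nat_size_pos[of M] nat_size_pos[of M']
        by (intro emeasure_near_coincidence a) (simp_all add: Suc_le_eq)
      also have "4 * (c / (nat_size M * nat_size M')\<^sup>2) = \<beta> k"
        by (simp add: \<beta>_def k(1) power_mult_distrib)
      finally show "emeasure (li_measure a b) (X k) \<le> ennreal (\<beta> k)" .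
    qed (use X in auto)
    also have "infsum \<beta> K \<le> 4 * c * (1 / (real n + 2)\<^sup>2 * Z * Z)"
      using has_sum_mono_neutral[OF has_sum_infsum[OF summK] all] sub nn by auto
    also have "4 * c * (1 / (real n + 2)\<^sup>2 * Z * Z) = 4 * c * Z\<^sup>2 / (real n + 2)\<^sup>2"
      by (simp add: power2_eq_square)
    finally show ?thesis unfolding Z_def by (simp add: ennreal_leI)
  qed (simp only: bad_set_def if_False emeasure_empty zero_le)
qed

text \<open>By disjointness the largest index \<open>n\<close> of the two multisets occurs in
  exactly one of them, and the choice of the \<open>n\<close>-th prime excluded this pair.\<close>

lemma beurling_prod_separation:
  assumes q: "\<And>n. q n \<ge> 1" and good: "\<And>n. q n \<notin> bad_set c n q"
    and disj: "M \<inter># M' = {#}" and ne: "M \<noteq> M'"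
  shows "c / (nat_size M * nat_size M')\<^sup>2 \<le> \<bar>beurling_prod q M - beurling_prod q M'\<bar>"
proof -
  have main: "c / (nat_size M * nat_size M')\<^sup>2 \<le> \<bar>beurling_prod q M - beurling_prod q M'\<bar>"
    if "n \<in># M" "set_mset M \<subseteq> {..n}" "set_mset M' \<subseteq> {..<n}" for M M' n
  proof (rule ccontr)
    assume "\<not> ?thesis"
    then have "q n \<in> bad_set c n q"
      unfolding bad_set_def using q that by (simp add: not_le) blast
    then show False using good by simp
  qed
  define n where "n = Max (set_mset (M + M'))"
  have nempty: "set_mset (M + M') \<noteq> {}" using ne by auto
  have n_in: "n \<in># M + M'" unfolding n_def using nempty by (intro Max_in) auto
  have le: "i \<le> n" if "i \<in># M + M'" for i unfolding n_def using that by (intro Max_ge) auto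
  have notboth: "\<not> (n \<in># M \<and> n \<in># M')"
    using disj by (metis disjunct_not_in)
  show ?thesis
  proof (cases "n \<in># M")
    case True
    then show ?thesis using le notboth by (intro main[of n]) (auto simp: less_le)
  next
    case False
    then have "c / (nat_size M' * nat_size M)\<^sup>2 \<le> \<bar>beurling_prod q M' - beurling_prod q M\<bar>"
      using le notboth n_in by (intro main[of n]) (auto simp: less_le)
    then show ?thesis by (simp add: mult.commute abs_minus_commute)
  qed
qed

section \<open>Means over the grid intervals\<close>

text \<open>Mean value inequality: \<open>r powr z\<close> has derivative of modulus
  \<open>norm z * r powr (Re z - 1)\<close>, and \<open>\<phi>\<close> is a primitive of a majorant
  of the second factor.\<close>

lemma norm_powr_diff_le_primitive:
  fixes z :: complex and x y :: real
  assumes "0 < x" "x \<le> y"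
    and \<phi>: "\<And>r. x \<le> r \<Longrightarrow> r \<le> y \<Longrightarrow> (\<phi> has_real_derivative \<phi>' r) (at r)"
    and le: "\<And>r. x < r \<Longrightarrow> r < y \<Longrightarrow> r powr (Re z - 1) \<le> \<phi>' r"
  shows "norm (of_real y powr z - of_real x powr z) \<le> norm z * (\<phi> y - \<phi> x)"
proof (cases "x = y")
  case False
  then have "x < y" using assms by simp
  then have "norm (of_real y powr z - of_real x powr z) \<le> norm z * \<phi> y - norm z * \<phi> x"
  proof (rule differentiable_bound_general[where f' = "\<lambda>r. z * of_real r powr (z - 1)" and \<phi>' = "\<lambda>r. norm z * \<phi>' r"])
    show "continuous_on {x..y} (\<lambda>r. of_real r powr z)"
      using assms by (auto intro!: continuous_intros simp: complex_nonpos_Reals_iff)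
    show "continuous_on {x..y} (\<lambda>r. norm z * \<phi> r)"
      using DERIV_isCont[OF \<phi>] by (intro continuous_on_mult_left continuous_at_imp_continuous_on ballI) auto
  next
    fix r assume r: "x < r" "r < y"
    have "((\<lambda>w. w powr z) has_field_derivative z * of_real r powr (z - 1)) (at (of_real r))"
      using r assms by (intro has_field_derivative_powr) (simp add: complex_nonpos_Reals_iff)
    then show "((\<lambda>r. of_real r powr z) has_vector_derivative z * of_real r powr (z - 1)) (at r)"
      by (rule has_vector_derivative_real_field)
    have "((\<lambda>r. norm z * \<phi> r) has_real_derivative norm z * \<phi>' r) (at r)"
      using r by (intro DERIV_cmult \<phi>) auto
    then show "((\<lambda>r. norm z * \<phi> r) has_vector_derivative norm z * \<phi>' r) (at r)"
      by (simp add: has_real_derivative_iff_has_vector_derivative)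
    show "norm (z * of_real r powr (z - 1)) \<le> norm z * \<phi>' r"
      using r assms le[OF r] by (simp add: norm_mult norm_of_real_powr mult_left_mono)
  qed
  then show ?thesis by (simp add: right_diff_distrib)
qed simp

text \<open>On \<open>Re s \<ge> 1 / 2\<close> the majorant is \<open>r powr (-3/2)\<close>, with
  primitive \<open>- 2 * r powr (-1/2)\<close>. A bound by a difference of endpoint values
  telescopes along the grid.\<close>

lemma norm_powr_diff_le:
  fixes s :: complex and a b x y :: real
  assumes s: "Re s \<ge> 1 / 2" and a: "1 \<le> a" and xy: "a \<le> x" "x \<le> y" "y \<le> b"
  shows "norm (complex_of_real x powr (-s) - complex_of_real y powr (-s)) \<le> 2 * norm s * (a powr (-1/2) - b powr (-1/2))"
proof -
  have "norm (of_real y powr (-s) - of_real x powr (-s)) \<le> norm (-s) * (- 2 * y powr (-1/2) - - 2 * x powr (-1/2))"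
  proof (rule norm_powr_diff_le_primitive)
    show "((\<lambda>r. - 2 * r powr (-1/2)) has_real_derivative r powr (-3/2)) (at r)" if "x \<le> r" for r
      using that a xy by (auto intro!: derivative_eq_intros simp: powr_diff field_simps)
  qed (use a xy s in \<open>auto intro!: powr_mono\<close>)
  then have "norm (of_real x powr (-s) - of_real y powr (-s)) \<le> 2 * norm s * (x powr (-1/2) - y powr (-1/2))"
    by (simp add: norm_minus_commute algebra_simps)
  also have "... \<le> 2 * norm s * (a powr (-1/2) - b powr (-1/2))"
    using a xy by (intro mult_left_mono diff_mono powr_mono2') auto
  finally show ?thesis .
qed

locale li_grid =
  fixes xs :: "nat \<Rightarrow> real"
  assumes xs_0: "xs 0 = 1" and xs_mono: "strict_mono xs"
    and li_xs: "li_beurling (xs n) = real n" and xs_ge: "real n + 1 \<le> xs n"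
begin

lemma xs_less: "xs n < xs (Suc n)"
  using xs_mono by (simp add: strict_mono_Suc_iff)

lemma xs_ge_1: "1 \<le> xs n"
  using xs_ge[of n] by linarith

abbreviation mu :: "nat \<Rightarrow> real measure" where
  "mu n \<equiv> li_measure (xs n) (xs (Suc n))"

lemma set_integrable_dens: "1 \<le> a \<Longrightarrow> set_integrable lborel {a<..b} dens"
  by (rule set_integrable_subset[OF borel_integrable_atLeastAtMost', of a b])
    (auto intro: continuous_on_subset[OF continuous_on_dens])

lemma integral_Ioc_eq:
  fixes f :: "real \<Rightarrow> complex"
  assumes "continuous_on {a..b} f"
  shows "(LINT u:{a<..b}|lborel. f u) = integral {a..b} f" "set_integrable lborel {a<..b} f"
proof -
  have int: "set_integrable lborel {a..b} f" by (rule borel_integrable_atLeastAtMost'[OF assms])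
  show int2: "set_integrable lborel {a<..b} f"
    by (rule set_integrable_subset[OF int]) auto
  have "(LINT u:{a<..b}|lborel. f u) = integral {a<..b} f"
    by (rule set_borel_integral_eq_integral(2)[OF int2])
  also have "... = integral {a..b} f"
    by (rule integral_subset_negligible) (auto intro!: negligible_subset[OF negligible_finite[of "{a}"]])
  finally show "(LINT u:{a<..b}|lborel. f u) = integral {a..b} f" .
qed

text \<open>The mass is the increment of li between consecutive grid points, which is 1 by the
  choice of the grid.\<close>

lemma prob_space_mu: "prob_space (mu n)"
proof (rule prob_spaceI)
  have "emeasure (mu n) (space (mu n)) = (\<integral>\<^sup>+u. ennreal (indicator {xs n<..xs (Suc n)} u * dens u) \<partial>lborel)"
    unfolding li_measure_def by (subst emeasure_density) auto
  also have "... = ennreal (LINT u:{xs n<..xs (Suc n)}|lborel. dens u)"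
    unfolding set_lebesgue_integral_def real_scaleR_def
    using set_integrable_dens[OF xs_ge_1, of n "xs (Suc n)"] xs_ge_1[of n] dens_pos
    by (intro nn_integral_eq_integral AE_I2) (auto simp: set_integrable_def indicator_def less_imp_le)
  also have "(LINT u:{xs n<..xs (Suc n)}|lborel. dens u) = integral {xs n<..xs (Suc n)} dens"
    by (rule set_borel_integral_eq_integral(2)[OF set_integrable_dens[OF xs_ge_1]])
  also have "... = integral {xs n..xs (Suc n)} dens"
    by (rule integral_subset_negligible) (auto intro!: negligible_subset[OF negligible_finite[of "{xs n}"]])
  also have "... = 1"
    using li_beurling_diff[OF xs_ge_1, of n "xs (Suc n)"] xs_less[of n] li_xs[of n] li_xs[of "Suc n"] by simp
  finally show "emeasure (mu n) (space (mu n)) = 1" by simp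
qed

lemma AE_mu: "AE u in mu n. u \<in> {xs n<..xs (Suc n)}"
  using emeasure_li_measure_compl[of "xs n" "xs (Suc n)"]
  by (intro AE_I[of _ _ "- {xs n<..xs (Suc n)}"]) auto

definition T :: "nat \<Rightarrow> complex \<Rightarrow> complex" where
  "T n s = (CLINT u|mu n. complex_of_real u powr (-s))"

lemma measurable_of_real_powr[measurable]: "(\<lambda>u. complex_of_real u powr z) \<in> borel_measurable borel"
  unfolding powr_def by measurable

lemma T_eq: "T n s = (LINT u:{xs n<..xs (Suc n)}|lborel. of_real (dens u) * complex_of_real u powr (-s))"
proof -
  have nn: "AE u in lborel. 0 \<le> indicator {xs n<..xs (Suc n)} u * dens u"
    using xs_ge_1[of n] dens_pos by (intro AE_I2) (auto simp: indicator_def less_imp_le)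
  show ?thesis
    unfolding T_def li_measure_def set_lebesgue_integral_def
    by (subst integral_density[OF _ _ nn]) (auto simp: scaleR_conv_of_real intro!: Bochner_Integration.integral_cong)
qed

lemma continuous_dens_powr: "continuous_on {xs n..xs (Suc n)} (\<lambda>u. of_real (dens u) * complex_of_real u powr (-s))"
  using xs_ge_1[of n]
  by (intro continuous_intros continuous_on_subset[OF continuous_on_dens])
    (auto simp: complex_nonpos_Reals_iff)

lemma T_holomorphic: "T n holomorphic_on UNIV"
proof -
  have "T n = (\<lambda>s. integral (cbox (xs n) (xs (Suc n))) (\<lambda>u. of_real (dens u) * complex_of_real u powr (-s)))"
    by (simp add: fun_eq_iff T_eq integral_Ioc_eq(1)[OF continuous_dens_powr])
  moreover have "... holomorphic_on UNIV"
  proof (rule leibniz_rule_holomorphic[where fx = "\<lambda>s u. - (of_real (dens u) * complex_of_real u powr (-s) * of_real (ln u))"])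
    fix s :: complex and u assume "u \<in> cbox (xs n) (xs (Suc n))"
    then have u: "u > 0" using xs_ge_1[of n] by auto
    then have "complex_of_real u powr (-s) = exp (- s * of_real (ln u))" for s
      by (simp add: powr_def Ln_of_real)
    then show "((\<lambda>s. of_real (dens u) * complex_of_real u powr (-s)) has_field_derivative
        - (of_real (dens u) * complex_of_real u powr (-s) * of_real (ln u))) (at s within UNIV)"
      by (auto intro!: derivative_eq_intros)
  next
    fix s
    show "(\<lambda>u. of_real (dens u) * complex_of_real u powr (-s)) integrable_on cbox (xs n) (xs (Suc n))"
      unfolding cbox_interval by (rule integrable_continuous_interval[OF continuous_dens_powr])
  next
    have d: "continuous_on (UNIV \<times> cbox (xs n) (xs (Suc n))) (\<lambda>x. dens (snd x))"
      using xs_ge_1[of n] by (intro continuous_on_compose2[OF continuous_on_dens] continuous_intros) auto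
    show "continuous_on (UNIV \<times> cbox (xs n) (xs (Suc n))) (\<lambda>(s, u). - (of_real (dens u) * complex_of_real u powr (-s) * of_real (ln u)))"
      unfolding case_prod_unfold using xs_ge_1[of n]
      by (intro continuous_intros d) (auto simp: complex_nonpos_Reals_iff)
  qed auto
  ultimately show ?thesis by simp
qed

lemma T_integrable: "Re s \<ge> 0 \<Longrightarrow> integrable (mu n) (\<lambda>u. complex_of_real u powr (-s))"
proof -
  assume s: "Re s \<ge> 0"
  interpret prob_space "mu n" by (rule prob_space_mu)
  show ?thesis
  proof (rule integrable_const_bound[where B = 1])
    show "AE u in mu n. norm (complex_of_real u powr (-s)) \<le> 1"
      using AE_mu
    proof eventually_elim
      case (elim u)
      then have "u \<ge> 1" using xs_ge_1[of n] by simp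
      then show ?case using s powr_mono[of "- Re s" 0 u] by (simp add: norm_of_real_powr)
    qed
  qed measurable
qed

lemma norm_integral_mu_le:
  fixes f :: "real \<Rightarrow> complex"
  assumes f: "integrable (mu n) f" and B: "\<And>u. xs n < u \<Longrightarrow> u \<le> xs (Suc n) \<Longrightarrow> norm (f u) \<le> B"
  shows "norm (CLINT u|mu n. f u) \<le> B"
proof -
  interpret prob_space "mu n" by (rule prob_space_mu)
  have "norm (CLINT u|mu n. f u) \<le> (LINT u|mu n. norm (f u))" by simp
  also have "... \<le> (LINT u|mu n. B)"
  proof (rule integral_mono_AE)
    show "AE u in mu n. norm (f u) \<le> B" using AE_mu by eventually_elim (use B in simp)
  qed (use f in auto)
  finally show ?thesis by (simp add: prob_space[simplified])
qed

lemma diff_T_eq: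
  assumes "Re s \<ge> 0"
  shows "complex_of_real x powr (-s) - T n s = (CLINT u|mu n. complex_of_real x powr (-s) - complex_of_real u powr (-s))"
proof -
  interpret prob_space "mu n" by (rule prob_space_mu)
  show ?thesis unfolding T_def
    by (subst Bochner_Integration.integral_diff) (auto intro: T_integrable assms simp: prob_space[simplified])
qed

lemma norm_diff_T_le:
  assumes s: "Re s \<ge> 1 / 2" and x: "xs n < x" "x \<le> xs (Suc n)"
  shows "norm (complex_of_real x powr (-s) - T n s) \<le> 2 * norm s * (xs n powr (-1/2) - xs (Suc n) powr (-1/2))"
proof -
  interpret prob_space "mu n" by (rule prob_space_mu)
  show ?thesis
    unfolding diff_T_eq[of s, OF order_trans[OF _ s], simplified]
  proof (rule norm_integral_mu_le)
    fix u assume u: "xs n < u" "u \<le> xs (Suc n)"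
    show "norm (complex_of_real x powr (-s) - complex_of_real u powr (-s)) \<le> 2 * norm s * (xs n powr (-1/2) - xs (Suc n) powr (-1/2))"
    proof (cases "x \<le> u")
      case True
      then show ?thesis using norm_powr_diff_le[OF s xs_ge_1, of n x u "xs (Suc n)"] u x by simp
    next
      case False
      then show ?thesis using norm_powr_diff_le[OF s xs_ge_1, of n u x "xs (Suc n)"] u x by (simp add: norm_minus_commute)
    qed
  qed (use s T_integrable in simp)
qed

text \<open>Unlike \<open>norm_diff_T_le\<close> this does not telescope, but it is free of
  \<open>norm s\<close>: Hoeffding's lemma needs a range uniform in the height.\<close>

lemma norm_diff_T_le':
  assumes s: "Re s \<ge> 0" and x: "xs n < x" "x \<le> xs (Suc n)"
  shows "norm (complex_of_real x powr (-s) - T n s) \<le> 2 * xs n powr (- Re s)"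
proof -
  interpret prob_space "mu n" by (rule prob_space_mu)
  have "norm (complex_of_real u powr (-s)) \<le> xs n powr (- Re s)" if "xs n < u" for u
    using that s xs_ge_1[of n] by (simp add: norm_of_real_powr powr_mono2')
  then have "norm (complex_of_real x powr (-s) - complex_of_real u powr (-s)) \<le> 2 * xs n powr (- Re s)" if "xs n < u" for u
    using norm_triangle_ineq4[of "complex_of_real x powr (-s)" "complex_of_real u powr (-s)"] x that
    by (smt (verit, best))
  moreover have "integrable (mu n) (\<lambda>u. complex_of_real x powr (-s) - complex_of_real u powr (-s))"
    by (intro Bochner_Integration.integrable_diff integrable_const T_integrable s)
  ultimately show ?thesis
    unfolding diff_T_eq[OF s] by (intro norm_integral_mu_le) auto
qed

lemma filterlim_xs: "filterlim xs at_top sequentially"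
proof (rule filterlim_at_top_mono[OF filterlim_real_sequentially])
  have "real n \<le> xs n" for n using xs_ge[of n] by simp
  then show "\<forall>\<^sub>F n in sequentially. real n \<le> xs n" by simp
qed

text \<open>The grid intervals tile the half-line beyond \<open>xs 0 = 1\<close>, so the partial
  sums exhaust the integral in \<open>integral_dens_powr\<close>.\<close>

lemma T_sums:
  assumes "Re s > 1"
  shows "(\<lambda>n. T n s) sums (Ln s - Ln (s - 1))"
proof -
  let ?f = "\<lambda>u. of_real (dens u) * complex_of_real u powr (-s)"
  note int = integral_dens_powr(1)[OF assms]
  have part: "(\<Sum>n<N. T n s) = (LINT u:{1<..xs N}|lborel. ?f u)" for N
  proof (induction N)
    case 0
    then show ?case by (simp add: xs_0 set_lebesgue_integral_def)
  next
    case (Suc N)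
    have "(LINT u:{1<..xs N} \<union> {xs N<..xs (Suc N)}|lborel. ?f u) = (LINT u:{1<..xs N}|lborel. ?f u) + (LINT u:{xs N<..xs (Suc N)}|lborel. ?f u)"
      using xs_ge_1[of N] by (intro set_integral_Un set_integrable_subset[OF int]) auto
    moreover have "{1<..xs N} \<union> {xs N<..xs (Suc N)} = {1<..xs (Suc N)}"
      using xs_ge_1[of N] xs_less[of N] by auto
    ultimately show ?case using Suc by (simp add: T_eq)
  qed
  have "((\<lambda>y. \<integral>u. indicator {..y} u *\<^sub>R (indicator {1..} u *\<^sub>R ?f u) \<partial>lborel) \<longlongrightarrow> (\<integral>u. indicator {1..} u *\<^sub>R ?f u \<partial>lborel)) at_top"
    using int by (intro tendsto_integral_at_top) (auto simp: set_integrable_def)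
  then have "(\<lambda>N. \<integral>u. indicator {..xs N} u *\<^sub>R (indicator {1..} u *\<^sub>R ?f u) \<partial>lborel) \<longlonglongrightarrow> (\<integral>u. indicator {1..} u *\<^sub>R ?f u \<partial>lborel)"
    using filterlim_xs by (rule filterlim_compose)
  moreover have "(\<integral>u. indicator {..xs N} u *\<^sub>R (indicator {1..} u *\<^sub>R ?f u) \<partial>lborel) = (\<Sum>n<N. T n s)" for N
    unfolding part set_lebesgue_integral_def
    by (rule integral_cong_AE) (use AE_lborel_singleton[of "1::real"] in \<open>auto simp: indicator_def\<close>)
  ultimately show ?thesis
    unfolding sums_def using integral_dens_powr(2)[OF assms] by (simp add: set_lebesgue_integral_def)
qed

end

section \<open>Continuation of the zeta function\<close>

text \<open>The shift by one interval forces \<open>q n \<ge> n + 2\<close>, which keeps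
  \<open>norm (q n powr (-s))\<close> away from 1 for \<open>Re s \<ge> 1 / 2\<close>. The price is
  the unmatched term \<open>T 0\<close> in \<open>G\<close>.\<close>

locale beurling_choice = li_grid +
  fixes q :: "nat \<Rightarrow> real"
  assumes q_gt: "xs (Suc n) < q n" and q_le: "q n \<le> xs (Suc (Suc n))"
begin

lemma q_ge: "real n + 2 \<le> q n"
  using q_gt[of n] xs_ge[of "Suc n"] by simp

lemma q_pos: "0 < q n"
  using q_ge[of n] by linarith

lemma strict_mono_q: "strict_mono q"
  unfolding strict_mono_Suc_iff using q_gt q_le le_less_trans by blast

definition X :: "nat \<Rightarrow> complex \<Rightarrow> complex" where
  "X n s = complex_of_real (q n) powr (-s) - T (Suc n) s"

text \<open>The part of the Euler factor's logarithm coming from prime powers with exponent at least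
  2.\<close>

definition R :: "nat \<Rightarrow> complex \<Rightarrow> complex" where
  "R n s = - Ln (1 - complex_of_real (q n) powr (-s)) - complex_of_real (q n) powr (-s)"

definition G :: "complex \<Rightarrow> complex" where
  "G s = (\<Sum>n. X n s + R n s) - T 0 s"

definition step_size :: "nat \<Rightarrow> real" where
  "step_size n = xs (Suc n) powr (-1/2) - xs (Suc (Suc n)) powr (-1/2)"

lemma step_size_nonneg: "step_size n \<ge> 0"
  unfolding step_size_def using xs_less[of "Suc n"] xs_ge_1[of "Suc n"] by (auto intro!: powr_mono2')

text \<open>The sum telescopes to \<open>xs 1 powr (-1/2) \<le> 1\<close>; this 1 is behind the
  coefficient 2 of \<open>norm s\<close> in \<open>G_bound\<close>.\<close>

lemma summable_step_size: "summable step_size" and suminf_step_size: "suminf step_size \<le> 1"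
proof -
  have tele: "(\<Sum>n<N. step_size n) = xs 1 powr (-1/2) - xs (Suc N) powr (-1/2)" for N
    by (induction N) (auto simp: step_size_def)
  have "(\<lambda>N. xs (Suc N) powr (-1/2)) \<longlonglongrightarrow> 0"
    by (rule tendsto_neg_powr) (auto intro: filterlim_compose[OF filterlim_xs filterlim_Suc])
  then have "step_size sums (xs 1 powr (-1/2) - 0)"
    unfolding sums_def tele by (intro tendsto_intros)
  moreover have "xs 1 powr (-1/2) \<le> 1" using powr_mono2'[of "-(1/2)" 1 "xs 1"] xs_ge_1[of 1] by simp
  ultimately show "summable step_size" "suminf step_size \<le> 1" by (auto simp: sums_iff)
qed

lemma norm_X_le: "Re s \<ge> 1 / 2 \<Longrightarrow> norm (X n s) \<le> 2 * norm s * step_size n"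
  unfolding X_def step_size_def by (intro norm_diff_T_le q_gt q_le)

lemma norm_q_powr_le: "0 \<le> \<sigma> \<Longrightarrow> \<sigma> \<le> Re s \<Longrightarrow> norm (complex_of_real (q n) powr (-s)) \<le> (real n + 2) powr (- \<sigma>)"
proof -
  assume s: "0 \<le> \<sigma>" "\<sigma> \<le> Re s"
  have "norm (complex_of_real (q n) powr (-s)) = q n powr (- Re s)"
    using q_pos[of n] by (simp add: norm_of_real_powr)
  also have "... \<le> q n powr (- \<sigma>)" using s q_ge[of n] by (intro powr_mono) auto
  also have "... \<le> (real n + 2) powr (- \<sigma>)" using s q_ge[of n] by (intro powr_mono2') auto
  finally show ?thesis .
qed

text \<open>The left side bounds all \<open>norm (q n powr (-s))\<close> with
  \<open>Re s \<ge> 1 / 2\<close>. The value 3/4 is a convenient number below 1;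
  \<open>1 / (1 - 3 / 4)\<close> is the 4 of \<open>norm_R_le\<close>.\<close>

lemma powr_neg_half_bound: "(2 :: real) powr (- (1/2)) \<le> 3 / 4"
proof -
  have "4 / 3 \<le> sqrt (2 :: real)" by (rule real_le_rsqrt) (simp add: power2_eq_square)
  then have "1 / sqrt 2 \<le> 1 / (4 / 3 :: real)" by (intro divide_left_mono) auto
  also have "1 / sqrt 2 = (2 :: real) powr (- (1/2))"
    unfolding powr_minus_divide using powr_half_sqrt[of 2] by simp
  finally show ?thesis by simp
qed

lemma norm_q_powr_le_3_4:
  assumes "Re s \<ge> 1 / 2" shows "norm (complex_of_real (q n) powr (-s)) \<le> 3 / 4"
proof -
  have "norm (complex_of_real (q n) powr (-s)) \<le> (real n + 2) powr (- (1/2))"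
    using assms by (intro norm_q_powr_le) auto
  also have "... \<le> 2 powr (- (1/2))" by (intro powr_mono2') auto
  finally show ?thesis using powr_neg_half_bound by linarith
qed

lemma norm_R_le:
  assumes "1 / 2 \<le> \<sigma>" "\<sigma> \<le> Re s"
  shows "norm (R n s) \<le> 4 * (real n + 2) powr (- 2 * \<sigma>)"
proof -
  let ?z = "complex_of_real (q n) powr (-s)"
  have z: "norm ?z \<le> 3 / 4" using assms by (intro norm_q_powr_le_3_4) simp
  have "norm (Ln (1 + - ?z) - - ?z) \<le> (norm (- ?z))\<^sup>2 / (1 - norm (- ?z))"
    using z by (intro Ln_approx_linear) simp
  also have "... \<le> 4 * (norm ?z)\<^sup>2"
    using z mult_right_mono[of 1 "4 * (1 - norm ?z)" "(norm ?z)\<^sup>2"] by (simp add: divide_le_eq algebra_simps)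
  also have "(norm ?z)\<^sup>2 \<le> ((real n + 2) powr (- \<sigma>))\<^sup>2"
    using assms by (intro power_mono norm_q_powr_le) auto
  also have "((real n + 2) powr (- \<sigma>))\<^sup>2 = (real n + 2) powr (- 2 * \<sigma>)"
    by (simp add: power2_eq_square powr_add[symmetric])
  finally have "norm (Ln (1 - ?z) + ?z) \<le> 4 * (real n + 2) powr (- 2 * \<sigma>)" by simp
  moreover have "R n s = - (Ln (1 - ?z) + ?z)" by (simp add: R_def)
  ultimately show ?thesis by (simp only: norm_minus_cancel)
qed

lemma summable_shifted_powr: "\<sigma> > 1 \<Longrightarrow> summable (\<lambda>n. (real n + 2) powr (- \<sigma>))"
  using summable_iff_shift[of "\<lambda>n. real n powr (- \<sigma>)" 2] by (simp add: summable_real_powr_iff add.commute)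

lemma XR_holomorphic: "(\<lambda>s. X n s + R n s) holomorphic_on {s. Re s > 1 / 2}"
proof -
  have q: "(\<lambda>s. complex_of_real (q n) powr (-s)) holomorphic_on A" for A
    using q_pos[of n] by (intro holomorphic_intros) (auto simp: complex_nonpos_Reals_iff)
  have "1 - complex_of_real (q n) powr (-s) \<notin> \<real>\<^sub>\<le>\<^sub>0" if "Re s > 1 / 2" for s
  proof -
    have "Re (complex_of_real (q n) powr (-s)) \<le> 3 / 4"
      using norm_q_powr_le_3_4[of s n] that by (intro order_trans[OF complex_Re_le_cmod]) simp
    then show ?thesis by (simp add: complex_nonpos_Reals_iff)
  qed
  then show ?thesis
    unfolding X_def R_def
    by (intro holomorphic_on_add holomorphic_on_diff holomorphic_on_minus holomorphic_on_Ln' q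
        holomorphic_on_subset[OF T_holomorphic] holomorphic_on_const) auto
qed

lemma XR_bound:
  assumes "1 / 2 < \<sigma>" "\<sigma> \<le> Re s"
  shows "norm (X n s + R n s) \<le> 2 * norm s * step_size n + 4 * (real n + 2) powr (- 2 * \<sigma>)"
  using norm_X_le[of s n] norm_R_le[of \<sigma> s n] assms
  by (intro order_trans[OF norm_triangle_ineq] add_mono) auto

lemma summable_XR_bound: "1 / 2 < \<sigma> \<Longrightarrow> summable (\<lambda>n. 2 * c * step_size n + 4 * (real n + 2) powr (- 2 * \<sigma>))"
  using summable_shifted_powr[of "2 * \<sigma>"] by (intro summable_add summable_mult summable_step_size) simp_all

lemma summable_XR:
  assumes "Re s > 1 / 2" shows "summable (\<lambda>n. norm (X n s + R n s))"
  by (rule summable_comparison_test'[OF summable_XR_bound[OF assms, of "norm s"]])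
    (use XR_bound[OF assms, of s] in simp)

lemma summable_X:
  assumes "Re s \<ge> 1 / 2" shows "summable (\<lambda>n. X n s)"
  by (rule summable_comparison_test'[OF summable_mult[OF summable_step_size, of "2 * norm s"]])
    (use norm_X_le[OF assms] in simp)

lemma summable_R:
  assumes "Re s > 1 / 2" shows "summable (\<lambda>n. R n s)"
  by (rule summable_comparison_test'[OF summable_mult[OF summable_shifted_powr[of "2 * Re s"], of 4]])
    (use norm_R_le[of "Re s" s] assms in auto)

lemma G_holomorphic: "G holomorphic_on {s. Re s > 1 / 2}"
proof -
  let ?S = "{s :: complex. Re s > 1 / 2}"
  have S: "open ?S" by (rule open_halfspace_Re_gt)
  obtain g where g: "\<forall>s\<in>?S. (\<lambda>n. X n s + R n s) sums g s \<and> g field_differentiable (at s)"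
  proof (rule series_differentiable_comparison_complex[OF S, of "\<lambda>n s. X n s + R n s"])
    fix n s assume "s \<in> ?S"
    then show "(\<lambda>s. X n s + R n s) field_differentiable (at s)"
      using holomorphic_on_imp_differentiable_at[OF XR_holomorphic S] by simp
  next
    fix s :: complex assume s: "s \<in> ?S"
    \<comment> \<open>Midpoint between 1/2 and \<open>Re s\<close>. The radius \<open>d\<close>
      keeps a ball around \<open>s\<close> to the right of \<open>\<sigma>\<close> and keeps
      \<open>norm y \<le> norm s + 1\<close> on it, so \<open>XR_bound\<close> gives a uniform
      majorant.\<close>
    define \<sigma> where "\<sigma> = (Re s + 1 / 2) / 2"
    have \<sigma>: "1 / 2 < \<sigma>" "\<sigma> < Re s" using s by (auto simp: \<sigma>_def field_simps)
    define d where "d = min 1 (Re s - \<sigma>)"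
    let ?h = "\<lambda>n. complex_of_real (2 * (norm s + 1) * step_size n + 4 * (real n + 2) powr (- 2 * \<sigma>))"
    have h0: "0 \<le> 2 * (norm s + 1) * step_size n + 4 * (real n + 2) powr (- 2 * \<sigma>)" for n
      using step_size_nonneg by simp
    have bnd: "norm (X n y + R n y) \<le> norm (?h n)" if y: "y \<in> ball s d \<inter> ?S" for n y
    proof -
      have "norm (y - s) < d" using y by (simp add: dist_norm norm_minus_commute)
      moreover have "\<bar>Re (y - s)\<bar> \<le> norm (y - s)" by (rule abs_Re_le_cmod)
      ultimately have "\<sigma> \<le> Re y" by (simp add: d_def abs_if split: if_splits)
      then have "norm (X n y + R n y) \<le> 2 * norm y * step_size n + 4 * (real n + 2) powr (- 2 * \<sigma>)"
        using \<sigma> by (intro XR_bound) auto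
      also have "norm y \<le> norm s + 1"
        using \<open>norm (y - s) < d\<close> norm_triangle_sub[of y s] by (simp add: d_def)
      then have "2 * norm y * step_size n + 4 * (real n + 2) powr (- 2 * \<sigma>) \<le> 2 * (norm s + 1) * step_size n + 4 * (real n + 2) powr (- 2 * \<sigma>)"
        using step_size_nonneg by (intro add_mono mult_right_mono) auto
      finally show ?thesis using h0 by (simp only: norm_of_real abs_of_nonneg)
    qed
    have dpos: "d > 0" using \<sigma> by (simp add: d_def)
    have summ: "summable ?h" using summable_XR_bound[OF \<sigma>(1), of "norm s + 1"] by (simp only: summable_of_real)
    have rng: "range ?h \<subseteq> \<real>\<^sub>\<ge>\<^sub>0" using h0 by (auto simp only: image_subset_iff nonneg_Reals_of_real_iff)
    have ev: "\<forall>\<^sub>F n in sequentially. \<forall>y\<in>ball s d \<inter> ?S. norm (X n y + R n y) \<le> norm (?h n)"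
      by (intro always_eventually allI ballI bnd)
    show "\<exists>d (h :: nat \<Rightarrow> complex). 0 < d \<and> summable h \<and> range h \<subseteq> \<real>\<^sub>\<ge>\<^sub>0 \<and> (\<forall>\<^sub>F n in sequentially. \<forall>y\<in>ball s d \<inter> ?S. norm (X n y + R n y) \<le> norm (h n))"
      by (rule exI[of _ d], rule exI[of _ ?h]) (intro conjI dpos summ rng ev)
  qed
  have "g holomorphic_on ?S" using g by (auto simp: holomorphic_on_def intro: field_differentiable_at_within)
  then have "(\<lambda>s. g s - T 0 s) holomorphic_on ?S"
    by (intro holomorphic_on_diff holomorphic_on_subset[OF T_holomorphic]) auto
  then show ?thesis
    by (rule holomorphic_transform) (use g in \<open>auto simp: G_def sums_iff\<close>)
qed

lemma norm_T_le_1: "Re s \<ge> 0 \<Longrightarrow> norm (T n s) \<le> 1"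
  unfolding T_def
proof (rule norm_integral_mu_le)
  fix u assume "Re s \<ge> 0" "xs n < u"
  then show "norm (complex_of_real u powr (-s)) \<le> 1"
    using xs_ge_1[of n] powr_mono[of "- Re s" 0 u] by (simp add: norm_of_real_powr)
qed (rule T_integrable)

lemma suminf_R_bound:
  assumes "1 / 2 < \<sigma>" "\<sigma> \<le> Re s"
  shows "norm (\<Sum>n. R n s) \<le> (\<Sum>n. 4 * (real n + 2) powr (- 2 * \<sigma>))"
  using norm_R_le[of \<sigma> s] assms summable_shifted_powr[of "2 * \<sigma>"]
  by (intro norm_suminf_le summable_mult) auto

lemma G_split:
  assumes "Re s > 1 / 2"
  shows "G s = (\<Sum>n. X n s) + (\<Sum>n. R n s) - T 0 s"
  unfolding G_def using suminf_add[OF summable_X summable_R, of s s] assms by simp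

text \<open>Holds for every choice of primes in the intervals. Linear growth of \<open>G\<close>
  means at most exponential growth of \<open>exp (G s)\<close>, just what
  \<open>contour_shift\<close> tolerates.\<close>

lemma G_bound:
  assumes "1 / 2 < \<sigma>"
  obtains C where "C \<ge> 0" "\<And>s. \<sigma> \<le> Re s \<Longrightarrow> norm (G s) \<le> C + 2 * norm s"
proof
  define C where "C = (\<Sum>n. 4 * (real n + 2) powr (- 2 * \<sigma>)) + 1"
  show "C \<ge> 0" unfolding C_def using summable_shifted_powr[of "2 * \<sigma>"] assms
    by (intro add_nonneg_nonneg suminf_nonneg summable_mult) auto
  fix s assume s: "\<sigma> \<le> Re s"
  have "norm (\<Sum>n. X n s) \<le> (\<Sum>n. 2 * norm s * step_size n)"
    using norm_X_le[of s] s assms by (intro norm_suminf_le summable_mult summable_step_size) auto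
  also have "... = 2 * norm s * suminf step_size" by (rule suminf_mult[OF summable_step_size])
  also have "... \<le> 2 * norm s * 1" using suminf_step_size by (intro mult_left_mono) auto
  finally have 1: "norm (\<Sum>n. X n s) \<le> 2 * norm s" by simp
  have "norm (G s) \<le> norm (\<Sum>n. X n s) + norm (\<Sum>n. R n s) + norm (T 0 s)"
    using G_split[of s] s assms norm_triangle_ineq4 norm_triangle_ineq
    by (smt (verit, best))
  then show "norm (G s) \<le> C + 2 * norm s"
    using 1 suminf_R_bound[OF assms s] norm_T_le_1[of s 0] s assms by (simp add: C_def)
qed

text \<open>Adding \<open>T (Suc n) s\<close> back to \<open>X n s + R n s\<close> restores the
  logarithm of the Euler factor, and these means sum to
  \<open>Ln s - Ln (s - 1) - T 0 s\<close>.\<close>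

lemma Euler_exponent:
  assumes s: "Re s > 1"
  shows "exp (\<Sum>n. - Ln (1 - complex_of_real (q n) powr (-s))) = s / (s - 1) * exp (G s)"
proof -
  have s0: "s \<noteq> 0" "s - 1 \<noteq> 0" using s by auto
  have T: "(\<lambda>n. T (Suc n) s) sums (Ln s - Ln (s - 1) - T 0 s)"
    using T_sums[OF s] sums_Suc_iff[of "\<lambda>n. T n s" "Ln s - Ln (s - 1) - T 0 s"] by simp
  have "(\<lambda>n. (X n s + R n s) + T (Suc n) s) sums ((\<Sum>n. X n s + R n s) + (Ln s - Ln (s - 1) - T 0 s))"
    using s by (intro sums_add T summable_sums summable_norm_cancel[OF summable_XR]) simp
  moreover have "(X n s + R n s) + T (Suc n) s = - Ln (1 - complex_of_real (q n) powr (-s))" for n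
    by (simp add: X_def R_def)
  ultimately have "(\<Sum>n. - Ln (1 - complex_of_real (q n) powr (-s))) = (Ln s - Ln (s - 1)) + G s"
    by (simp add: sums_iff G_def algebra_simps)
  then show ?thesis using s0 by (simp add: exp_add exp_diff)
qed

end

section \<open>The random choice made deterministic\<close>

definition line :: "nat \<Rightarrow> real" where "line m = 1 / 2 + 1 / (real m + 3)"
definition decay :: "nat \<Rightarrow> real" where "decay m = 1 / (real m + 3)"
definition weight :: "nat \<Rightarrow> real \<Rightarrow> real" where
  "weight m t = (1 + \<bar>t\<bar>) powr (- 1 - decay m)"

lemma line_gt_half: "line m > 1 / 2" by (simp add: line_def)
lemma decay_pos: "decay m > 0" by (simp add: decay_def)
lemma weight_pos: "weight m t > 0" by (simp add: weight_def)
lemma measurable_weight[measurable]: "weight m \<in> borel_measurable borel"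
  unfolding weight_def by measurable
lemma integrable_weight: "integrable lborel (weight m)"
  unfolding weight_def by (rule integrable_one_plus_abs_powr[OF decay_pos])

definition total_weight :: "nat \<Rightarrow> real" where "total_weight m = (LBINT t. weight m t)"

lemma total_weight_pos: "total_weight m > 0"
proof -
  have "total_weight m \<noteq> 0"
  proof
    assume "total_weight m = 0"
    then have "AE t in lborel. weight m t = 0"
      unfolding total_weight_def
      by (subst (asm) integral_nonneg_eq_0_iff_AE[OF integrable_weight]) (auto intro: less_imp_le weight_pos)
    moreover have "weight m t \<noteq> 0" for t using weight_pos[of m t] by simp
    ultimately show False by (simp add: eventually_False ae_filter_eq_bot_iff)
  qed
  moreover have "total_weight m \<ge> 0"
    unfolding total_weight_def by (intro Bochner_Integration.integral_nonneg) (simp add: less_imp_le weight_pos)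
  ultimately show ?thesis by simp
qed

text \<open>A single finite measure charges all the lines \<open>Re s = line m\<close>, so that one potential controls
  every exponent \<open>1 / 2 + \<epsilon>\<close> at once.\<close>
definition line_density :: "nat \<times> real \<Rightarrow> real" where
  "line_density = (\<lambda>(m, t). (1 / 2) ^ m / total_weight m * weight m t)"

definition line_measure :: "(nat \<times> real) measure" where
  "line_measure = density (count_space UNIV \<Otimes>\<^sub>M lborel) (\<lambda>p. ennreal (line_density p))"

lemma measurable_line_pair:
  fixes f :: "nat \<times> real \<Rightarrow> 'c :: topological_space"
  assumes "\<And>m. (\<lambda>t. f (m, t)) \<in> borel_measurable borel"
  shows "f \<in> borel_measurable (count_space UNIV \<Otimes>\<^sub>M lborel)"
  using assms by (intro measurable_pair_measure_countable1) (auto simp: measurable_lborel1)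

lemma measurable_line_density[measurable]: "line_density \<in> borel_measurable (count_space UNIV \<Otimes>\<^sub>M lborel)"
  by (rule measurable_line_pair) (unfold line_density_def prod.case, measurable)

lemma line_density_nonneg: "line_density p \<ge> 0"
  unfolding line_density_def using total_weight_pos weight_pos
  by (cases p) (auto intro!: mult_nonneg_nonneg divide_nonneg_nonneg less_imp_le)

lemma nn_integral_line_measure:
  assumes [measurable]: "f \<in> borel_measurable (count_space UNIV \<Otimes>\<^sub>M lborel)"
  shows "(\<integral>\<^sup>+p. f p \<partial>line_measure) = (\<Sum>m. \<integral>\<^sup>+t. ennreal (line_density (m, t)) * f (m, t) \<partial>lborel)"
proof -
  have "(\<integral>\<^sup>+p. f p \<partial>line_measure) = (\<integral>\<^sup>+p. ennreal (line_density p) * f p \<partial>(count_space UNIV \<Otimes>\<^sub>M lborel))"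
    unfolding line_measure_def by (rule nn_integral_density) auto
  also have "... = (\<integral>\<^sup>+m. \<integral>\<^sup>+t. ennreal (line_density (m, t)) * f (m, t) \<partial>lborel \<partial>count_space UNIV)"
    by (intro lborel.nn_integral_fst[symmetric]) measurable
  finally show ?thesis by (simp add: nn_integral_count_space_nat)
qed

lemma space_line_measure[simp]: "space line_measure = UNIV"
  by (simp add: line_measure_def space_pair_measure)

lemma sets_line_measure[measurable_cong]: "sets line_measure = sets (count_space UNIV \<Otimes>\<^sub>M lborel)"
  by (simp add: line_measure_def)

lemma finite_line_measure: "finite_measure line_measure"
proof (rule finite_measureI)
  have "emeasure line_measure (space line_measure) = (\<integral>\<^sup>+p. 1 \<partial>line_measure)" by simp
  also have "... = (\<Sum>m. \<integral>\<^sup>+t. ennreal (line_density (m, t)) * 1 \<partial>lborel)"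
    by (rule nn_integral_line_measure) simp
  also have "(\<lambda>m. \<integral>\<^sup>+t. ennreal (line_density (m, t)) * 1 \<partial>lborel) = (\<lambda>m. ennreal ((1 / 2) ^ m))"
  proof
    fix m
    have "(\<integral>\<^sup>+t. ennreal (line_density (m, t)) * 1 \<partial>lborel) = ennreal (LBINT t. line_density (m, t))"
      unfolding mult_1_right using integrable_weight[of m] line_density_nonneg
      by (intro nn_integral_eq_integral) (auto simp: line_density_def)
    also have "(LBINT t. line_density (m, t)) = (1 / 2) ^ m / total_weight m * total_weight m"
      unfolding line_density_def total_weight_def prod.case by (rule integral_mult_right_zero)
    finally show "(\<integral>\<^sup>+t. ennreal (line_density (m, t)) * 1 \<partial>lborel) = ennreal ((1 / 2) ^ m)"
      using total_weight_pos[of m] by simp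
  qed
  also have "(\<Sum>m. ennreal ((1 / 2) ^ m)) = ennreal (\<Sum>m. (1 / 2) ^ m)"
    by (intro suminf_ennreal2 summable_geometric) auto
  finally show "emeasure line_measure (space line_measure) \<noteq> \<infinity>" by simp
qed

context li_grid
begin

text \<open>The Hoeffding exponent \<open>b^2 / 2\<close> for the range
  \<open>b = 2 * xs (Suc n) powr (- line m)\<close>, with \<open>xs (Suc n)\<close> lowered to
  \<open>n + 2\<close>. It is summable over \<open>n\<close> because
  \<open>line m > 1 / 2\<close>.\<close>

definition var_bound :: "nat \<Rightarrow> nat \<Rightarrow> real" where
  "var_bound m n = 2 * (real n + 2) powr (- 2 * line m)"

text \<open>The compensator brings the exponential moment down to at most 1. Being summable, it
  costs only a bounded factor in the limit.\<close>

definition increment :: "nat \<Rightarrow> real \<Rightarrow> nat \<times> real \<Rightarrow> real" where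
  "increment n x = (\<lambda>(m, t). Re (complex_of_real x powr (- Complex (line m) t) - T (Suc n) (Complex (line m) t)) - var_bound m n)"

lemma measurable_T[measurable]: "T n \<in> borel_measurable borel"
  using holomorphic_on_imp_continuous_on[OF T_holomorphic] by (rule borel_measurable_continuous_onI)

lemma measurable_increment: "(\<lambda>(x, p). increment n x p) \<in> borel_measurable (mu (Suc n) \<Otimes>\<^sub>M line_measure)"
proof -
  have s: "(\<lambda>p. Complex (line (fst p)) (snd p)) \<in> borel_measurable (count_space UNIV \<Otimes>\<^sub>M lborel)"
    by (rule measurable_line_pair) (simp add: Complex_eq)
  then have [measurable]: "(\<lambda>p. Complex (line (fst p)) (snd p)) \<in> borel_measurable line_measure"
    by (simp cong: measurable_cong_sets add: sets_line_measure)
  have "(\<lambda>p :: nat \<times> real. var_bound (fst p) n) \<in> borel_measurable (count_space UNIV \<Otimes>\<^sub>M lborel)"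
    by (rule measurable_line_pair) simp
  then have [measurable]: "(\<lambda>p :: nat \<times> real. var_bound (fst p) n) \<in> borel_measurable line_measure"
    by (simp cong: measurable_cong_sets add: sets_line_measure)
  have "(\<lambda>(x, p). Re (complex_of_real x powr (- Complex (line (fst p)) (snd p)) - T (Suc n) (Complex (line (fst p)) (snd p))) - var_bound (fst p) n)
    \<in> borel_measurable (mu (Suc n) \<Otimes>\<^sub>M line_measure)"
    unfolding powr_def by measurable
  then show ?thesis unfolding increment_def by (simp add: case_prod_unfold)
qed

text \<open>\<open>T (Suc n) s\<close> is the mean of the random power, so the real part of the
  difference is centred, and \<open>norm_diff_T_le'\<close> confines it to
  \<open>{-b..b}\<close>.\<close>

lemma exp_increment_le: "(\<integral>\<^sup>+x. ennreal (exp (increment n x p)) \<partial>mu (Suc n)) \<le> 1"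
proof -
  obtain m t where p: "p = (m, t)" by (cases p)
  define s where "s = Complex (line m) t"
  have s: "Re s \<ge> 0" "Re s = line m" by (auto simp: s_def line_def)
  define f where "f x = Re (complex_of_real x powr (- s) - T (Suc n) s)" for x :: real
  define b where "b = 2 * xs (Suc n) powr (- line m)"
  interpret prob_space "mu (Suc n)" by (rule prob_space_mu)
  interpret interval_bounded_random_variable "mu (Suc n)" f "-b" b
  proof
    show "f \<in> borel_measurable (mu (Suc n))" unfolding f_def by measurable
    show "AE x in mu (Suc n). f x \<in> {-b..b}"
      using AE_mu
    proof eventually_elim
      case (elim x)
      then have "norm (complex_of_real x powr (-s) - T (Suc n) s) \<le> b"
        unfolding b_def s(2)[symmetric] by (intro norm_diff_T_le' s) auto
      then have "\<bar>f x\<bar> \<le> b" unfolding f_def using abs_Re_le_cmod order_trans by blast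
      then show ?case by (auto simp: abs_le_iff)
    qed
  qed
  have "expectation f = Re (CLINT x|mu (Suc n). complex_of_real x powr (- s) - T (Suc n) s)"
    unfolding f_def by (intro integral_Re Bochner_Integration.integrable_diff T_integrable s) auto
  also have "(CLINT x|mu (Suc n). complex_of_real x powr (- s) - T (Suc n) s) = 0"
    by (subst Bochner_Integration.integral_diff) (auto intro: T_integrable s simp: T_def[symmetric] prob_space[simplified])
  finally have "expectation f = 0" by simp
  \<comment> \<open>At parameter 1 the exponent is the squared length \<open>(2 * b)^2\<close> of
    the range divided by 8, that is \<open>b^2 / 2\<close>.\<close>
  from Hoeffdings_lemma_nn_integral_0[OF _ this, of 1]
  have H: "(\<integral>\<^sup>+x. ennreal (exp (f x)) \<partial>mu (Suc n)) \<le> ennreal (exp (b\<^sup>2 / 2))"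
    by (simp add: power2_eq_square)
  have b: "b\<^sup>2 / 2 \<le> var_bound m n"
  proof -
    have "xs (Suc n) powr (- line m) \<le> (real n + 2) powr (- line m)"
      using xs_ge[of "Suc n"] line_gt_half[of m] by (intro powr_mono2') auto
    then have "(xs (Suc n) powr (- line m))\<^sup>2 \<le> ((real n + 2) powr (- line m))\<^sup>2" by (intro power_mono) auto
    also have "... = (real n + 2) powr (- 2 * line m)" by (simp add: power2_eq_square powr_add[symmetric])
    finally show ?thesis by (simp add: b_def var_bound_def power_mult_distrib)
  qed
  have "(\<integral>\<^sup>+x. ennreal (exp (increment n x p)) \<partial>mu (Suc n)) = (\<integral>\<^sup>+x. ennreal (exp (- var_bound m n)) * ennreal (exp (f x)) \<partial>mu (Suc n))"
    by (intro nn_integral_cong) (simp add: increment_def p f_def s_def ennreal_mult[symmetric] exp_add[symmetric])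
  also have "... = ennreal (exp (- var_bound m n)) * (\<integral>\<^sup>+x. ennreal (exp (f x)) \<partial>mu (Suc n))"
    by (rule nn_integral_cmult) auto
  also have "... \<le> ennreal (exp (- var_bound m n)) * ennreal (exp (b\<^sup>2 / 2))"
    by (intro mult_left_mono H) auto
  also have "... = ennreal (exp (b\<^sup>2 / 2 - var_bound m n))" by (simp add: ennreal_mult[symmetric] exp_add[symmetric])
  also have "... \<le> 1" using b by simp
  finally show ?thesis .
qed

text \<open>The 16 turns the bound of \<open>bad_set_bound\<close> into
  \<open>1 / (4 * (n + 2)^2)\<close>, which is \<open>\<gamma> n / 4\<close> for the losses chosen
  in \<open>ex_choice\<close>.\<close>

definition sep_const :: real where
  "sep_const = 1 / (16 * (\<Sum>\<^sub>\<infinity>M. 1 / (nat_size M)\<^sup>2)\<^sup>2)"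

lemma infsum_nat_size_ge: "(\<Sum>\<^sub>\<infinity>M. 1 / (nat_size M)\<^sup>2) \<ge> 1"
proof -
  have "(\<Sum>\<^sub>\<infinity>M\<in>{{#}}. 1 / (nat_size M)\<^sup>2) \<le> (\<Sum>\<^sub>\<infinity>M. 1 / (nat_size M)\<^sup>2)"
    by (intro infsum_mono_neutral summable_nat_size) auto
  then show ?thesis by (simp add: nat_size_def)
qed

lemma sep_const_pos: "sep_const > 0"
  using infsum_nat_size_ge by (auto simp: sep_const_def)

lemma ex_choice:
  "\<exists>q. (\<forall>n. xs (Suc n) < q n \<and> q n \<le> xs (Suc (Suc n)) \<and> q n \<notin> bad_set sep_const n q) \<and>
    (\<exists>C. \<forall>n. (\<integral>\<^sup>+p. ennreal (exp (\<Sum>i<n. increment i (q i) p)) \<partial>line_measure) \<le> ennreal C)"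
proof -
  interpret L: finite_measure line_measure by (rule finite_line_measure)
  \<comment> \<open>Leaving the grid interval also counts as bad. This adds no measure and makes the
    selection lemma deliver the interval conditions.\<close>
  define B where "B n q = - {xs (Suc n)<..xs (Suc (Suc n))} \<union> bad_set sep_const n q" for n q
  define \<gamma> where "\<gamma> n = 1 / (real n + 2)\<^sup>2" for n
  have "\<exists>q. (\<forall>n. q n \<in> space (mu (Suc n)) \<and> q n \<notin> B n q) \<and>
    (\<forall>n. (\<integral>\<^sup>+p. ennreal (exp (\<Sum>i<n. increment i (q i) p)) \<partial>line_measure) \<le> ennreal (exp (suminf \<gamma>)) * emeasure line_measure (space line_measure))"
  proof (rule greedy_selection)
    fix n q
    have "emeasure (mu (Suc n)) (B n q) \<le> emeasure (mu (Suc n)) (- {xs (Suc n)<..xs (Suc (Suc n))}) + emeasure (mu (Suc n)) (bad_set sep_const n q)"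
      unfolding B_def by (rule emeasure_subadditive) (auto intro: bad_set_bound(1) xs_ge_1 sep_const_pos)
    also have "... \<le> 0 + ennreal (4 * sep_const * (\<Sum>\<^sub>\<infinity>M. 1 / (nat_size M)\<^sup>2)\<^sup>2 / (real n + 2)\<^sup>2)"
      unfolding emeasure_li_measure_compl by (intro add_mono bad_set_bound xs_ge_1 sep_const_pos order_refl)
    also have "4 * sep_const * (\<Sum>\<^sub>\<infinity>M. 1 / (nat_size M)\<^sup>2)\<^sup>2 / (real n + 2)\<^sup>2 = \<gamma> n / 4"
      using infsum_nat_size_ge by (simp add: sep_const_def \<gamma>_def)
    finally show "B n q \<in> sets (mu (Suc n)) \<and> emeasure (mu (Suc n)) (B n q) \<le> ennreal (\<gamma> n / 4)"
      using bad_set_bound(1)[OF xs_ge_1 sep_const_pos] by (simp add: B_def)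
  next
    fix n :: nat and q q' :: "nat \<Rightarrow> real"
    assume "\<And>i. i < n \<Longrightarrow> q i = q' i"
    then show "B n q = B n q'" unfolding B_def by (simp add: bad_set_cong[of n q q'])
  next
    show "\<gamma> n \<le> 1" for n using power_mono[of 1 "real n + 2" 2] by (simp add: \<gamma>_def divide_le_eq)
    show "summable \<gamma>" unfolding \<gamma>_def by (rule summable_inverse_squares)
  qed (auto intro: prob_space_mu finite_line_measure measurable_increment exp_increment_le simp: \<gamma>_def)
  then obtain q where q: "\<And>n. q n \<notin> B n q" and
    "\<And>n. (\<integral>\<^sup>+p. ennreal (exp (\<Sum>i<n. increment i (q i) p)) \<partial>line_measure) \<le> ennreal (exp (suminf \<gamma>)) * emeasure line_measure (space line_measure)"
    by blast
  then have "\<And>n. (\<integral>\<^sup>+p. ennreal (exp (\<Sum>i<n. increment i (q i) p)) \<partial>line_measure) \<le> ennreal (exp (suminf \<gamma>) * measure line_measure (space line_measure))"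
    by (simp add: L.emeasure_eq_measure ennreal_mult)
  then show ?thesis using q unfolding B_def by (intro exI[of _ q]) auto
qed

end

section \<open>Smoothed counting function\<close>

text \<open>In the variable \<open>u = e\<^sup>v\<close> this is \<open>max (u - c) 0 / u ^ 4\<close>; the factor \<open>u ^ (-4)\<close> corresponds to
  Perron's formula on the line \<open>Re s = 3\<close>.\<close>
definition ramp :: "real \<Rightarrow> real \<Rightarrow> real" where
  "ramp c v = max (exp v - c) 0 * exp (- 4 * v)"

lemma ramp_nonneg: "0 \<le> ramp c v"
  by (simp add: ramp_def)

lemma ramp_le_exp: "c \<ge> 1 \<Longrightarrow> ramp c v \<le> indicator {ln c..} v * exp (- 3 * v)"
proof (cases "v \<ge> ln c")
  case True
  assume "c \<ge> 1"
  then have "ramp c v \<le> exp v * exp (- 4 * v)"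
    unfolding ramp_def by (intro mult_right_mono) auto
  then show ?thesis using True by (simp add: exp_add[symmetric])
next
  case False
  assume "c \<ge> 1"
  then have "exp v < exp (ln c)" using False by (simp only: exp_less_cancel_iff)
  then show ?thesis using False \<open>c \<ge> 1\<close> by (simp add: ramp_def)
qed

lemma powr_minus_eq_exp: "c > 0 \<Longrightarrow> c powr (- a) = exp (- a * ln c)" for c a :: real
  by (simp add: powr_def)

lemma ramp_le_powr: assumes "c \<ge> 1" shows "ramp c v \<le> c powr (- 3)"
proof -
  have "indicator {ln c..} v * exp (- 3 * v) \<le> exp (- 3 * ln c)"
    by (auto simp: indicator_def)
  then show ?thesis using ramp_le_exp[OF assms, of v] assms by (simp add: powr_minus_eq_exp)
qed

lemma continuous_on_ramp: "continuous_on A (ramp c)"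
  unfolding ramp_def by (intro continuous_intros)

lemma measurable_ramp[measurable]: "ramp c \<in> borel_measurable borel"
  unfolding ramp_def by measurable

lemma ramp_integrable:
  assumes "c \<ge> 1"
  shows "integrable lborel (ramp c)" "(LBINT v. ramp c v) \<le> c powr (- 3)"
proof -
  have e: "integrable lborel (\<lambda>v. indicator {ln c..} v * exp (- 3 * v))"
  proof -
    have "set_integrable lborel {ln c..} (\<lambda>v. exp (- (3 * complex_of_real v)))"
      by (rule set_integrable_exp_at_top) simp
    then have "integrable lborel (\<lambda>v. norm (indicator {ln c..} v *\<^sub>R exp (- (3 * complex_of_real v))))"
      unfolding set_integrable_def by (rule integrable_norm)
    then show ?thesis by (simp add: indicator_def)
  qed
  show i: "integrable lborel (ramp c)"
    by (rule Bochner_Integration.integrable_bound[OF e])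
      (use ramp_le_exp[OF assms] ramp_nonneg in \<open>auto simp: abs_mult\<close>)
  have "(LBINT v. ramp c v) \<le> (LBINT v. indicator {ln c..} v * exp (- 3 * v))"
    using e i ramp_le_exp[OF assms] by (intro integral_mono) auto
  also have "(LBINT v. indicator {ln c..} v * exp (- 3 * v)) = c powr (- 3) / 3"
  proof -
    have "complex_of_real (LBINT v. indicator {ln c..} v * exp (- 3 * v)) = (LINT v:{ln c..}|lborel. exp (- (3 * complex_of_real v)))"
      unfolding set_lebesgue_integral_def integral_complex_of_real[symmetric]
      by (intro Bochner_Integration.integral_cong) (auto simp: indicator_def simp flip: exp_of_real)
    also have "... = exp (- (3 * complex_of_real (ln c))) / 3"
      by (rule integral_exp_at_top) simp
    also have "... = of_real (c powr (- 3) / 3)"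
      using assms by (simp add: powr_minus_eq_exp flip: exp_of_real)
    finally show ?thesis by (simp only: of_real_eq_iff)
  qed
  also have "... \<le> c powr (- 3)" by simp
  finally show "(LBINT v. ramp c v) \<le> c powr (- 3)" .
qed

text \<open>Beyond \<open>ln c\<close> the ramp is \<open>exp (- 3 * v) - c * exp (- 4 * v)\<close>;
  the two transforms combine through \<open>1 / s - 1 / (s + 1)\<close>.\<close>

lemma fourier_ramp:
  assumes c: "c \<ge> 1" and s: "s = Complex 3 t"
  shows "(CLBINT v. of_real (ramp c v) * iexp (- (t * v))) = of_real c powr (-s) / (s * (s + 1))"
proof -
  have s0: "s \<noteq> 0" "s + 1 \<noteq> 0" using s by (auto simp: complex_eq_iff)
  have rs: "Re s > 0" "Re (s + 1) > 0" using s by simp_all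
  have pw: "complex_of_real c powr (-z) = exp (- (z * of_real (ln c)))" for z
    using c by (simp add: powr_def Ln_of_real)
  have eq: "of_real (ramp c v) * iexp (- (t * v)) = indicator {ln c..} v *\<^sub>R exp (- (s * of_real v))
      - of_real c * (indicator {ln c..} v *\<^sub>R exp (- ((s + 1) * of_real v)))" for v
  proof (cases "v \<ge> ln c")
    case True
    then have "exp (ln c) \<le> exp v" by (simp only: exp_le_cancel_iff)
    then have "ramp c v = exp (- 3 * v) - c * exp (- 4 * v)"
      using c by (simp add: ramp_def algebra_simps exp_add[symmetric])
    then have "of_real (ramp c v) * iexp (- (t * v)) = exp (of_real (- 3 * v)) * iexp (- (t * v)) - of_real c * (exp (of_real (- 4 * v)) * iexp (- (t * v)))"
      by (simp only: of_real_diff of_real_mult exp_of_real[symmetric]) (simp add: algebra_simps)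
    also have "exp (of_real (- 3 * v)) * iexp (- (t * v)) = exp (- (s * of_real v))"
      unfolding exp_add[symmetric] s by (rule arg_cong[where f = exp]) (simp add: complex_eq_iff)
    also have "exp (of_real (- 4 * v)) * iexp (- (t * v)) = exp (- ((s + 1) * of_real v))"
      unfolding exp_add[symmetric] s by (rule arg_cong[where f = exp]) (simp add: complex_eq_iff)
    finally show ?thesis using True by simp
  next
    case False
    then have "exp v < exp (ln c)" by (simp only: exp_less_cancel_iff not_le)
    then show ?thesis using False c by (simp add: ramp_def)
  qed
  have "(CLBINT v. of_real (ramp c v) * iexp (- (t * v)))
    = (LINT v:{ln c..}|lborel. exp (- (s * of_real v))) - of_real c * (LINT v:{ln c..}|lborel. exp (- ((s + 1) * of_real v)))"
  proof -
    have i: "integrable lborel (\<lambda>v. indicator {ln c..} v *\<^sub>R exp (- (s * of_real v)))"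
      "integrable lborel (\<lambda>v. of_real c * (indicator {ln c..} v *\<^sub>R exp (- ((s + 1) * of_real v))))"
      using set_integrable_exp_at_top[OF rs(1), of "ln c"] set_integrable_exp_at_top[OF rs(2), of "ln c"]
      unfolding set_integrable_def by (auto simp only: integrable_mult_right)
    show ?thesis
      unfolding eq set_lebesgue_integral_def Bochner_Integration.integral_diff[OF i] integral_mult_right_zero ..
  qed
  also have "... = of_real c powr (-s) / s - of_real c * (of_real c powr (- (s + 1)) / (s + 1))"
    unfolding pw using rs by (simp only: integral_exp_at_top)
  also have "of_real c * (of_real c powr (- (s + 1))) = of_real c powr (-s)"
    using c by (simp add: powr_add[symmetric] powr_minus powr_diff field_simps)
  then have "of_real c * (of_real c powr (- (s + 1)) / (s + 1)) = of_real c powr (-s) / (s + 1)" by simp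
  also have "of_real c powr (-s) / s - of_real c powr (-s) / (s + 1) = of_real c powr (-s) / (s * (s + 1))"
    using s0 by (simp add: field_simps)
  finally show ?thesis .
qed

text \<open>The counterpart of \<open>ramp\<close> for \<open>(u\<^sup>2 - 1) / 2\<close>, the primitive of \<open>u\<close>, whose Mellin transform is that of
  the model zeta function \<open>s / (s - 1)\<close>.\<close>
definition quad :: "real \<Rightarrow> real" where
  "quad v = max (exp (2 * v) - 1) 0 / 2 * exp (- 4 * v)"

lemma quad_eq: "quad v = indicator {0..} v * ((exp (- 2 * v) - exp (- 4 * v)) / 2)"
  by (auto simp: quad_def indicator_def algebra_simps exp_add[symmetric] max_def)

lemma quad_bounds: "0 \<le> quad v" "quad v \<le> 1 / 2"
proof -
  show "0 \<le> quad v" by (simp add: quad_def)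
  have "exp (- 2 * v) \<le> 1" if "v \<ge> 0" using that by simp
  then have "exp (- 2 * v) \<le> 1 + exp (- 4 * v)" if "v \<ge> 0" using that by (smt (verit) exp_gt_zero)
  then show "quad v \<le> 1 / 2" by (auto simp: quad_eq indicator_def)
qed

text \<open>The right side is \<open>s / (s - 1)\<close> times the kernel
  \<open>1 / (s * (s + 1))\<close> of \<open>fourier_ramp\<close>.\<close>

lemma fourier_quad:
  assumes s: "s = Complex 3 t"
  shows "integrable lborel (\<lambda>v. complex_of_real (quad v) * iexp (- (t * v)))"
    "(CLBINT v. of_real (quad v) * iexp (- (t * v))) = 1 / ((s - 1) * (s + 1))"
proof -
  have s0: "s - 1 \<noteq> 0" "s + 1 \<noteq> 0" using s by (auto simp: complex_eq_iff)
  have eq: "(\<lambda>v. of_real (quad v) * iexp (- (t * v))) = (\<lambda>v. (indicator {0..} v *\<^sub>R exp (- ((s - 1) * of_real v))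
      - indicator {0..} v *\<^sub>R exp (- ((s + 1) * of_real v))) / 2)"
  proof
    fix v
    show "of_real (quad v) * iexp (- (t * v)) = (indicator {0..} v *\<^sub>R exp (- ((s - 1) * of_real v))
      - indicator {0..} v *\<^sub>R exp (- ((s + 1) * of_real v))) / 2"
    proof (cases "v \<ge> 0")
      case True
      have "of_real (quad v) * iexp (- (t * v)) = (exp (of_real (- 2 * v)) * iexp (- (t * v)) - exp (of_real (- 4 * v)) * iexp (- (t * v))) / 2"
        using True by (simp add: quad_eq left_diff_distrib flip: exp_of_real)
      also have "exp (of_real (- 2 * v)) * iexp (- (t * v)) = exp (- ((s - 1) * of_real v))"
        unfolding exp_add[symmetric] s by (rule arg_cong[where f = exp]) (simp add: complex_eq_iff)
      also have "exp (of_real (- 4 * v)) * iexp (- (t * v)) = exp (- ((s + 1) * of_real v))"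
        unfolding exp_add[symmetric] s by (rule arg_cong[where f = exp]) (simp add: complex_eq_iff)
      finally show ?thesis using True by simp
    qed (simp add: quad_eq)
  qed
  have i: "integrable lborel (\<lambda>v. indicator {0::real..} v *\<^sub>R exp (- ((s - 1) * of_real v)))"
    "integrable lborel (\<lambda>v. indicator {0::real..} v *\<^sub>R exp (- ((s + 1) * of_real v)))"
    using set_integrable_exp_at_top[of "s - 1" 0] set_integrable_exp_at_top[of "s + 1" 0] s
    by (auto simp: set_integrable_def)
  show "integrable lborel (\<lambda>v. complex_of_real (quad v) * iexp (- (t * v)))"
    unfolding eq using i by simp
  have "(CLBINT v. of_real (quad v) * iexp (- (t * v)))
    = ((LINT v:{0..}|lborel. exp (- ((s - 1) * of_real v))) - (LINT v:{0..}|lborel. exp (- ((s + 1) * of_real v)))) / 2"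
    unfolding eq set_lebesgue_integral_def integral_divide_zero
    using Bochner_Integration.integral_diff[OF i] by simp
  also have "... = (1 / (s - 1) - 1 / (s + 1)) / 2"
    using s by (simp add: integral_exp_at_top)
  also have "... = 1 / ((s - 1) * (s + 1))"
    unfolding diff_frac_eq[OF s0] by simp
  finally show "(CLBINT v. of_real (quad v) * iexp (- (t * v))) = 1 / ((s - 1) * (s + 1))" .
qed

text \<open>Applied with \<open>A = Y / h\<close> and \<open>B = norm (s + 1)\<close>: a factor
  \<open>(Y / h) powr e\<close> buys the saving \<open>e\<close> in the growth in \<open>t\<close>
  that makes the shifted integral converge.\<close>

lemma min_le_powr_interpolation:
  fixes A B e :: real
  assumes "A > 0" "B > 0" "0 \<le> e" "e \<le> 1"
  shows "min A B \<le> A powr e * B powr (1 - e)"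
proof -
  have "min A B = min A B powr e * min A B powr (1 - e)"
    using assms by (simp add: powr_add[symmetric])
  also have "... \<le> A powr e * B powr (1 - e)"
    using assms by (intro mult_mono powr_mono2) auto
  finally show ?thesis .
qed

section \<open>Perron's formula for the smoothed count\<close>

lemma one_plus_abs_le:
  fixes t k :: real
  assumes "0 < k" "k \<le> 1" "k \<le> \<bar>x\<bar>"
  shows "k * (1 + \<bar>t\<bar>) \<le> 2 * norm (Complex x t)"
proof -
  have "k \<le> norm (Complex x t)" using abs_Re_le_cmod[of "Complex x t"] assms by simp
  moreover have "k * \<bar>t\<bar> \<le> norm (Complex x t)"
    using abs_Im_le_cmod[of "Complex x t"] mult_right_mono[OF assms(2), of "\<bar>t\<bar>"] by simp
  ultimately show ?thesis by (simp add: algebra_simps)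
qed

text \<open>What the contour argument uses, detached from primes. \<open>\<nu>\<close> may enumerate
  in any order, since only the number of terms up to \<open>x\<close> matters.\<close>

locale zeta_continuation =
  fixes \<nu> :: "nat \<Rightarrow> real" and E :: "complex \<Rightarrow> complex" and a :: real
  assumes \<nu>_ge: "\<nu> k \<ge> 1"
    and summ: "\<sigma> > 1 \<Longrightarrow> summable (\<lambda>k. \<nu> k powr (- \<sigma>))"
    and zeta: "Re s > 1 \<Longrightarrow> (\<Sum>k. complex_of_real (\<nu> k) powr (-s)) = s / (s - 1) * E s"
    and hol: "E holomorphic_on {s. Re s > 1 / 2}"
    and growth: "\<sigma> > 1 / 2 \<Longrightarrow> \<exists>B\<ge>0. \<forall>s. \<sigma> \<le> Re s \<longrightarrow> Re s \<le> 3 \<longrightarrow> norm (E s) \<le> B * exp (2 * \<bar>Im s\<bar>)"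
    and E1: "E 1 = of_real a"
begin

lemma finite_le: "finite {k. \<nu> k \<le> x}"
proof (cases "x > 0")
  case True
  have "(\<lambda>k. \<nu> k powr (- 2)) \<longlonglongrightarrow> 0" by (rule summable_LIMSEQ_zero[OF summ]) simp
  then have "eventually (\<lambda>k. \<nu> k powr (- 2) < x powr (- 2)) sequentially"
    using True by (intro order_tendstoD) auto
  then obtain K where K: "\<And>k. k \<ge> K \<Longrightarrow> \<nu> k powr (- 2) < x powr (- 2)"
    by (auto simp: eventually_sequentially)
  have "{k. \<nu> k \<le> x} \<subseteq> {..<K}"
  proof
    fix k assume "k \<in> {k. \<nu> k \<le> x}"
    then have "x powr (- 2) \<le> \<nu> k powr (- 2)" using \<nu>_ge[of k] by (intro powr_mono2') auto
    then show "k \<in> {..<K}" using K[of k] by (auto simp: not_le[symmetric])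
  qed
  then show ?thesis by (rule finite_subset) simp
next
  case False
  then have "{k. \<nu> k \<le> x} = {}" using \<nu>_ge by (auto simp: not_le) (smt (verit))
  then show ?thesis by simp
qed

text \<open>The integral of the counting function up to \<open>u\<close>. One integration gives
  Perron's kernel quadratic decay, hence absolute convergence; \<open>M1\<close> is the counterpart
  for the model with counting function \<open>u\<close>.\<close>

definition N1 :: "real \<Rightarrow> real" where "N1 u = (\<Sum>k. max (u - \<nu> k) 0)"
definition M1 :: "real \<Rightarrow> real" where "M1 u = max (u\<^sup>2 - 1) 0 / 2"

text \<open>A common finite index set for all arguments up to \<open>U\<close>, so that
  \<open>N1 (x + h)\<close> and \<open>N1 x\<close> can be subtracted termwise.\<close>

lemma N1_eq: assumes "u \<le> U" shows "N1 u = (\<Sum>k | \<nu> k \<le> U. max (u - \<nu> k) 0)"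
  unfolding N1_def using assms by (intro suminf_finite finite_le) auto

lemma N1_diff_ge:
  fixes h :: real
  assumes "h > 0" shows "h * real (card {k. \<nu> k \<le> x}) \<le> N1 (x + h) - N1 x"
proof -
  have "h * real (card {k. \<nu> k \<le> x}) = (\<Sum>k | \<nu> k \<le> x. h)" by simp
  also have "... = (\<Sum>k | \<nu> k \<le> x. max (x + h - \<nu> k) 0 - max (x - \<nu> k) 0)"
    using assms by (intro sum.cong) auto
  also have "... \<le> (\<Sum>k | \<nu> k \<le> x + h. max (x + h - \<nu> k) 0 - max (x - \<nu> k) 0)"
    using assms by (intro sum_mono2 finite_le) auto
  also have "... = N1 (x + h) - N1 x"
    using assms by (simp add: N1_eq[of _ "x + h"] sum_subtractf)
  finally show ?thesis .
qed

text \<open>With \<open>N1_diff_ge\<close> this brackets the nondecreasing count at a point between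
  its means over the adjacent intervals of length \<open>h\<close>.\<close>

lemma N1_diff_le:
  fixes h :: real
  assumes "h > 0" shows "N1 (x + h) - N1 x \<le> h * real (card {k. \<nu> k \<le> x + h})"
proof -
  have "N1 (x + h) - N1 x = (\<Sum>k | \<nu> k \<le> x + h. max (x + h - \<nu> k) 0 - max (x - \<nu> k) 0)"
    using assms by (simp add: N1_eq[of _ "x + h"] sum_subtractf)
  also have "... \<le> (\<Sum>k | \<nu> k \<le> x + h. h)"
    using assms by (intro sum_mono) auto
  finally show ?thesis by (simp add: mult.commute)
qed

text \<open>The Mellin transform of the smoothed error. Subtracting \<open>E 1\<close> cancels the
  pole at 1, and the derivative fills the removable singularity.\<close>

definition H :: "complex \<Rightarrow> complex" where
  "H s = (if s = 1 then deriv E 1 else (E s - E 1) / (s - 1)) / (s + 1)"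

lemma H_eq: "s \<noteq> 1 \<Longrightarrow> H s = (E s - of_real a) / ((s - 1) * (s + 1))"
  by (simp add: H_def E1)

lemma H_holomorphic: "H holomorphic_on {s. Re s > 1 / 2}"
proof -
  have "s + 1 \<noteq> 0" if "Re s > 1 / 2" for s
  proof
    assume "s + 1 = 0" then have "Re (s + 1) = 0" by simp then show False using that by simp
  qed
  then show ?thesis
    unfolding H_def by (intro holomorphic_on_divide pole_lemma_open[OF hol] open_halfspace_Re_gt holomorphic_intros) auto
qed

text \<open>\<open>k\<close> is a lower bound for the distance of the line from the pole; it absorbs
  the size of \<open>s - 1\<close> near the real axis.\<close>

lemma norm_H_le:
  assumes "1 / 2 < \<sigma>" "0 < k" "k \<le> 1" "k \<le> \<bar>\<sigma> - 1\<bar>"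
  shows "norm (H (Complex \<sigma> t)) \<le> 4 / k * (norm (E (Complex \<sigma> t)) + \<bar>a\<bar>) / (1 + \<bar>t\<bar>)\<^sup>2"
proof -
  let ?s = "Complex \<sigma> t"
  have s1: "?s - 1 = Complex (\<sigma> - 1) t" "?s + 1 = Complex (\<sigma> + 1) t" by (auto simp: complex_eq_iff)
  have ne: "?s \<noteq> 1" using assms by (auto simp: complex_eq_iff)
  have "(k * (1 + \<bar>t\<bar>)) * (1 * (1 + \<bar>t\<bar>)) \<le> (2 * norm (?s - 1)) * (2 * norm (?s + 1))"
    unfolding s1 using assms by (intro mult_mono one_plus_abs_le) auto
  then have den: "k / 4 * (1 + \<bar>t\<bar>)\<^sup>2 \<le> norm ((?s - 1) * (?s + 1))"
    by (simp add: norm_mult power2_eq_square)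
  have pos: "k / 4 * (1 + \<bar>t\<bar>)\<^sup>2 > 0" using assms by (intro mult_pos_pos zero_less_power) auto
  have "norm (H ?s) = norm (E ?s - of_real a) / norm ((?s - 1) * (?s + 1))"
    using H_eq[OF ne] by (simp add: norm_divide)
  also have "... \<le> (norm (E ?s) + \<bar>a\<bar>) / (k / 4 * (1 + \<bar>t\<bar>)\<^sup>2)"
    using den pos norm_triangle_ineq4[of "E ?s" "of_real a"] by (intro frac_le) auto
  also have "... = 4 / k * (norm (E ?s) + \<bar>a\<bar>) / (1 + \<bar>t\<bar>)\<^sup>2" by simp
  finally show ?thesis .
qed

text \<open>The smoothed error \<open>N1 - a * M1\<close> at \<open>exp v\<close>, damped by
  \<open>exp (- 4 * v)\<close> so that it is integrable on the whole line.\<close>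

definition f :: "real \<Rightarrow> complex" where
  "f v = of_real ((\<Sum>k. ramp (\<nu> k) v) - a * quad v)"

lemma summable_ramp: "summable (\<lambda>k. ramp (\<nu> k) v)"
  by (rule summable_comparison_test'[OF summ[of 3], of 0]) (use ramp_le_powr[OF \<nu>_ge] ramp_nonneg in auto)

lemma f_eq:
  assumes "x > 0" shows "f (ln x) = of_real ((N1 x - a * M1 x) / x ^ 4)"
proof -
  have e: "exp (- 4 * ln x) = 1 / x ^ 4"
    using assms exp_of_nat_mult[of 4 "ln x"] by (simp add: exp_minus divide_inverse)
  have "(\<Sum>k. ramp (\<nu> k) (ln x)) = N1 x / x ^ 4"
  proof -
    have "(\<Sum>k. ramp (\<nu> k) (ln x)) = (\<Sum>k. max (x - \<nu> k) 0 * (1 / x ^ 4))"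
      unfolding ramp_def e using assms by simp
    also have "... = N1 x * (1 / x ^ 4)"
      unfolding N1_def by (intro suminf_mult2[symmetric] summable_finite[OF finite_le[of x]]) auto
    finally show ?thesis by simp
  qed
  moreover have "quad (ln x) = M1 x / x ^ 4"
  proof -
    have "exp (2 * ln x) = x\<^sup>2" using assms exp_of_nat_mult[of 2 "ln x"] by simp
    then show ?thesis unfolding quad_def M1_def e by simp
  qed
  ultimately show ?thesis by (simp add: f_def diff_divide_distrib)
qed

lemma f_continuous: "continuous_on UNIV f"
proof -
  have "uniform_limit UNIV (\<lambda>n v. \<Sum>k<n. ramp (\<nu> k) v) (\<lambda>v. \<Sum>k. ramp (\<nu> k) v) sequentially"
  proof (rule Weierstrass_m_test)
    show "norm (ramp (\<nu> n) v) \<le> \<nu> n powr (- 3)" for n v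
      using ramp_le_powr[OF \<nu>_ge] ramp_nonneg by simp
  qed (rule summ, simp)
  then have "continuous_on UNIV (\<lambda>v. \<Sum>k. ramp (\<nu> k) v)"
    by (rule uniform_limit_theorem[rotated]) (auto intro!: always_eventually continuous_on_sum continuous_on_ramp)
  moreover have "continuous_on UNIV quad" unfolding quad_def by (intro continuous_intros) auto
  ultimately show ?thesis unfolding f_def by (intro continuous_intros)
qed

lemma f_bounded: "norm (f v) \<le> (\<Sum>k. \<nu> k powr (- 3)) + \<bar>a\<bar>"
proof -
  have "0 \<le> (\<Sum>k. ramp (\<nu> k) v)" by (intro suminf_nonneg summable_ramp ramp_nonneg)
  moreover have "(\<Sum>k. ramp (\<nu> k) v) \<le> (\<Sum>k. \<nu> k powr (- 3))"
    by (intro suminf_le summable_ramp summ ramp_le_powr \<nu>_ge) simp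
  moreover have "\<bar>a * quad v\<bar> \<le> \<bar>a\<bar>"
    using quad_bounds[of v] mult_left_mono[of "quad v" 1 "\<bar>a\<bar>"] by (simp add: abs_mult)
  ultimately show ?thesis unfolding f_def norm_of_real by linarith
qed

text \<open>Termwise integration is allowed because the ramps have integrals at most
  \<open>\<nu> k powr (- 3)\<close>. The \<open>s\<close> in \<open>s / (s - 1)\<close> cancels
  against the kernel, and \<open>quad\<close> contributes exactly the subtraction of
  \<open>E 1\<close>.\<close>

lemma fourier_f:
  "integrable lborel (\<lambda>v. f v * iexp (- (t * v)))"
  "(CLBINT v. f v * iexp (- (t * v))) = H (Complex 3 t)"
proof -
  define s where "s = Complex 3 t"
  let ?g = "\<lambda>k v. complex_of_real (ramp (\<nu> k) v) * iexp (- (t * v))"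
  have ng: "norm (?g k v) = ramp (\<nu> k) v" for k v
    using ramp_nonneg by (simp add: norm_mult)
  have i: "integrable lborel (?g k)" for k
  proof (rule Bochner_Integration.integrable_bound[OF ramp_integrable(1)[OF \<nu>_ge[of k]]])
    show "AE v in lborel. norm (?g k v) \<le> norm (ramp (\<nu> k) v)"
      by (intro AE_I2) (simp only: ng real_norm_def abs_ge_self)
  qed measurable
  have s1: "AE v in lborel. summable (\<lambda>k. norm (?g k v))" unfolding ng by (simp add: summable_ramp)
  have s2: "summable (\<lambda>k. LBINT v. norm (?g k v))"
    unfolding ng
    by (rule summable_comparison_test'[OF summ[of 3], of 0])
      (use ramp_integrable(2)[OF \<nu>_ge] ramp_nonneg in \<open>auto simp: Bochner_Integration.integral_nonneg\<close>)
  have eq: "f v * iexp (- (t * v)) = (\<Sum>k. ?g k v) - of_real a * (of_real (quad v) * iexp (- (t * v)))" for v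
  proof -
    have "(\<Sum>k. ?g k v) = of_real (\<Sum>k. ramp (\<nu> k) v) * iexp (- (t * v))"
      by (subst suminf_mult2[symmetric]) (auto simp: summable_ramp suminf_of_real summable_of_real)
    then show ?thesis by (simp add: f_def algebra_simps)
  qed
  have i1: "integrable lborel (\<lambda>v. \<Sum>k. ?g k v)" by (rule integrable_suminf[OF i s1 s2])
  have i2: "integrable lborel (\<lambda>v. of_real a * (of_real (quad v) * iexp (- (t * v))))"
    using fourier_quad(1)[OF s_def] by simp
  show "integrable lborel (\<lambda>v. f v * iexp (- (t * v)))" unfolding eq using i1 i2 by simp
  have s3: "Re s > 1" "s \<noteq> 0" "s - 1 \<noteq> 0" "s + 1 \<noteq> 0" "s \<noteq> 1" by (auto simp: s_def complex_eq_iff)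
  have "(CLBINT v. f v * iexp (- (t * v))) = (CLBINT v. (\<Sum>k. ?g k v)) - (CLBINT v. of_real a * (of_real (quad v) * iexp (- (t * v))))"
    unfolding eq using i1 i2 by (rule Bochner_Integration.integral_diff)
  also have "(CLBINT v. (\<Sum>k. ?g k v)) = (\<Sum>k. of_real (\<nu> k) powr (-s) / (s * (s + 1)))"
    unfolding integral_suminf[OF i s1 s2] fourier_ramp[OF \<nu>_ge s_def] ..
  also have "... = (\<Sum>k. of_real (\<nu> k) powr (-s)) / (s * (s + 1))"
  proof (rule suminf_divide)
    show "summable (\<lambda>k. complex_of_real (\<nu> k) powr (-s))"
    proof (rule summable_norm_cancel)
      show "summable (\<lambda>k. norm (complex_of_real (\<nu> k) powr (-s)))"
        using summ[OF s3(1)] \<nu>_ge by (simp add: norm_of_real_powr less_le_trans[OF zero_less_one])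
    qed
  qed
  also have "... = s / (s - 1) * E s / (s * (s + 1))" by (simp add: zeta s3)
  also have "(CLBINT v. of_real a * (of_real (quad v) * iexp (- (t * v)))) = of_real a * (1 / ((s - 1) * (s + 1)))"
    unfolding fourier_quad(2)[OF s_def, symmetric] by (rule integral_mult_right_zero)
  also have "s / (s - 1) * E s / (s * (s + 1)) - of_real a * (1 / ((s - 1) * (s + 1))) = H s"
    unfolding H_eq[OF s3(5)] using s3 by (simp add: divide_simps)
  finally show "(CLBINT v. f v * iexp (- (t * v))) = H (Complex 3 t)" by (simp add: s_def)
qed

end

lemma norm_powr_succ_diff_le:
  fixes s :: complex and y Y :: real
  assumes s: "0 \<le> Re s" and y: "1 \<le> y" "y < Y"
  shows "norm (complex_of_real Y powr (s + 1) - complex_of_real y powr (s + 1)) \<le> norm (s + 1) * Y powr Re s * (Y - y)"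
proof -
  have "norm (of_real Y powr (s + 1) - of_real y powr (s + 1)) \<le> norm (s + 1) * (Y powr Re s * Y - Y powr Re s * y)"
    using s y by (intro norm_powr_diff_le_primitive[where \<phi>' = "\<lambda>r. Y powr Re s"])
      (auto intro!: derivative_eq_intros powr_mono2)
  then show ?thesis by (simp add: algebra_simps)
qed

context zeta_continuation
begin

section \<open>Shifting the contour and unsmoothing\<close>

lemma norm_E_line_3: "norm (E (Complex 3 t)) \<le> (\<Sum>k. \<nu> k powr (- 3))"
proof -
  define s where "s = Complex 3 t"
  have s: "Re s = 3" "Re s > 1" "s \<noteq> 0" "s - 1 \<noteq> 0" by (auto simp: s_def complex_eq_iff)
  have nn: "norm (complex_of_real (\<nu> k) powr (-s)) = \<nu> k powr (- 3)" for k
    using \<nu>_ge[of k] by (simp add: norm_of_real_powr s(1))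
  have "norm (\<Sum>k. complex_of_real (\<nu> k) powr (-s)) \<le> (\<Sum>k. \<nu> k powr (- 3))"
    using summable_norm[of "\<lambda>k. complex_of_real (\<nu> k) powr (-s)"] summ[of 3] unfolding nn by simp
  then have 1: "norm (s / (s - 1) * E s) \<le> (\<Sum>k. \<nu> k powr (- 3))" by (simp add: zeta s)
  have "norm (s - 1) \<le> norm s"
    unfolding s_def cmod_def by (intro real_sqrt_le_mono) simp
  then have "1 \<le> norm (s / (s - 1))" using s by (simp add: norm_divide)
  then have "norm (E s) \<le> norm (s / (s - 1)) * norm (E s)"
    using mult_right_mono[of 1 "norm (s / (s - 1))" "norm (E s)"] by simp
  with 1 show ?thesis unfolding s_def by (simp only: norm_mult)
qed

lemma measurable_H_line: "1 / 2 < \<sigma> \<Longrightarrow> (\<lambda>t. H (Complex \<sigma> t)) \<in> borel_measurable borel"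
proof (rule borel_measurable_continuous_onI)
  assume "1 / 2 < \<sigma>"
  then show "continuous_on UNIV (\<lambda>t. H (Complex \<sigma> t))"
    by (intro continuous_on_compose2[OF holomorphic_on_imp_continuous_on[OF H_holomorphic]])
      (auto simp: Complex_eq intro!: continuous_intros)
qed

lemma integrable_H_line_3: "integrable lborel (\<lambda>t. H (Complex 3 t))"
proof (rule Bochner_Integration.integrable_bound)
  let ?C = "4 * ((\<Sum>k. \<nu> k powr (- 3)) + \<bar>a\<bar>)"
  show "integrable lborel (\<lambda>t. ?C * (1 + \<bar>t\<bar>) powr (- 1 - 1))"
    using integrable_one_plus_abs_powr[of 1] by (rule integrable_mult_right) simp
  show "AE t in lborel. norm (H (Complex 3 t)) \<le> norm (?C * (1 + \<bar>t\<bar>) powr (- 1 - 1))"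
  proof (intro AE_I2)
    fix t
    have "norm (H (Complex 3 t)) \<le> 4 / 1 * (norm (E (Complex 3 t)) + \<bar>a\<bar>) / (1 + \<bar>t\<bar>)\<^sup>2"
      by (intro norm_H_le) auto
    also have "... \<le> ?C / (1 + \<bar>t\<bar>)\<^sup>2"
      using norm_E_line_3[of t] by (intro divide_right_mono) auto
    also have "... = ?C * (1 + \<bar>t\<bar>) powr (- 1 - 1)"
      by (simp add: powr_minus powr_numeral divide_inverse)
    finally show "norm (H (Complex 3 t)) \<le> norm (?C * (1 + \<bar>t\<bar>) powr (- 1 - 1))" by simp
  qed
qed (use measurable_H_line[of 3] in simp)

text \<open>On \<open>Re s = 3\<close> one has
  \<open>x powr (s + 1) = x ^ 4 * iexp (t * ln x)\<close>, and \<open>x ^ 4\<close> undoes the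
  damping in \<open>f\<close>: this is Fourier inversion at \<open>ln x\<close>.\<close>

lemma perron:
  assumes "x > 0"
  shows "integrable lborel (\<lambda>t. H (Complex 3 t) * of_real x powr (Complex 3 t + 1))"
    "of_real (N1 x - a * M1 x) = (CLBINT t. H (Complex 3 t) * of_real x powr (Complex 3 t + 1)) / of_real (2 * pi)"
proof -
  have e: "H (Complex 3 t) * of_real x powr (Complex 3 t + 1) = of_real (x ^ 4) * (H (Complex 3 t) * iexp (t * ln x))" for t
  proof -
    have "of_real x powr (Complex 3 t + 1) = exp (of_real (4 * ln x) + \<i> * of_real (t * ln x))"
      using assms by (simp add: powr_def Ln_of_real complex_eq_iff exp_eq_polar)
    also have "... = of_real (x ^ 4) * iexp (t * ln x)"
    proof -
      have "exp (4 * ln x) = x ^ 4" using assms exp_of_nat_mult[of 4 "ln x"] by simp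
      then show ?thesis by (simp only: exp_add exp_of_real)
    qed
    finally show ?thesis by simp
  qed
  have [measurable]: "(\<lambda>t. H (Complex 3 t)) \<in> borel_measurable borel" by (rule measurable_H_line) simp
  have i: "integrable lborel (\<lambda>t. H (Complex 3 t) * iexp (t * ln x))"
    by (rule Bochner_Integration.integrable_bound[OF integrable_H_line_3]) (auto simp: norm_mult)
  show "integrable lborel (\<lambda>t. H (Complex 3 t) * of_real x powr (Complex 3 t + 1))"
    unfolding e using i by (rule integrable_mult_right)
  have "integrable lborel f" using fourier_f(1)[of 0] by simp
  then have "f (ln x) = (CLBINT t. H (Complex 3 t) * iexp (t * ln x)) / of_real (2 * pi)"
    by (rule fourier_inversion[OF f_continuous f_bounded _ fourier_f(2)[symmetric] integrable_H_line_3])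
  then have "of_real (N1 x - a * M1 x) = of_real (x ^ 4) * ((CLBINT t. H (Complex 3 t) * iexp (t * ln x)) / of_real (2 * pi))"
  proof -
    have "of_real (N1 x - a * M1 x) = of_real (x ^ 4) * f (ln x)"
      unfolding f_eq[OF assms] of_real_mult[symmetric] using assms by simp
    with \<open>f (ln x) = _\<close> show ?thesis by (simp only:)
  qed
  also have "... = (CLBINT t. H (Complex 3 t) * of_real x powr (Complex 3 t + 1)) / of_real (2 * pi)"
    unfolding e by (subst integral_mult_right_zero) simp
  finally show "of_real (N1 x - a * M1 x) = (CLBINT t. H (Complex 3 t) * of_real x powr (Complex 3 t + 1)) / of_real (2 * pi)" .
qed

text \<open>The difference over \<open>[y, y + h]\<close> is taken before shifting from
  \<open>Re s = 3\<close> to \<open>\<sigma>\<close>. The factor \<open>H\<close> contributes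
  \<open>(1 + \<bar>t\<bar>)^(-2)\<close> and the difference of powers
  \<open>(1 + \<bar>t\<bar>) powr (1 - e)\<close>, which leaves exactly the weight in the hypothesis
  on \<open>E\<close>.\<close>

lemma shifted_bound:
  assumes \<sigma>: "1 / 2 < \<sigma>" "\<sigma> < 1" and e: "0 < e" "e < 1"
    and int: "integrable lborel (\<lambda>t. norm (E (Complex \<sigma> t)) * (1 + \<bar>t\<bar>) powr (- 1 - e))"
  shows "\<exists>K\<ge>0. \<forall>y\<ge>1. \<forall>h>0. \<bar>(N1 (y + h) - a * M1 (y + h)) - (N1 y - a * M1 y)\<bar>
    \<le> K * h * (y + h) powr \<sigma> * ((y + h) / h) powr e"
proof -
  define k where "k = 1 - \<sigma>"
  have k: "0 < k" "k \<le> 1" "k \<le> \<bar>\<sigma> - 1\<bar>" using \<sigma> by (auto simp: k_def)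
  define W where "W t = (norm (E (Complex \<sigma> t)) + \<bar>a\<bar>) * (1 + \<bar>t\<bar>) powr (- 1 - e)" for t
  have iW: "integrable lborel W"
    unfolding W_def distrib_right using int integrable_one_plus_abs_powr[OF e(1)] by simp
  have W0: "W t \<ge> 0" for t by (simp add: W_def)
  \<comment> \<open>24 is 4 * 2 * 3: from \<open>norm_H_le\<close>, from the bounds on
    \<open>Q\<close>, and from \<open>norm (s + 1) \<le> 3 * (1 + \<bar>t\<bar>)\<close>.\<close>
  define K where "K = 24 / k * (LBINT t. W t)"
  have K0: "K \<ge> 0" unfolding K_def using k W0 by (intro mult_nonneg_nonneg Bochner_Integration.integral_nonneg) auto
  obtain B where B: "B \<ge> 0" "\<And>s. \<sigma> \<le> Re s \<Longrightarrow> Re s \<le> 3 \<Longrightarrow> norm (E s) \<le> B * exp (2 * \<bar>Im s\<bar>)"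
    using growth[OF \<sigma>(1)] by blast
  have "\<bar>(N1 (y + h) - a * M1 (y + h)) - (N1 y - a * M1 y)\<bar> \<le> K * h * (y + h) powr \<sigma> * ((y + h) / h) powr e"
    if y: "y \<ge> 1" and h: "h > 0" for y h
  proof -
    define Y where "Y = y + h"
    have Y: "y < Y" "Y \<ge> 1" "Y > 0" "y > 0" "h \<le> Y" using y h by (auto simp: Y_def)
    define Q where "Q s = complex_of_real Y powr (s + 1) - complex_of_real y powr (s + 1)" for s
    define \<Phi> where "\<Phi> s = H s * Q s" for s
    have Q1: "norm (Q s) \<le> 2 * Y powr (Re s + 1)" if "Re s \<ge> 0" for s
    proof -
      have "norm (Q s) \<le> Y powr (Re s + 1) + y powr (Re s + 1)"
        unfolding Q_def using Y by (intro order_trans[OF norm_triangle_ineq4]) (simp add: norm_of_real_powr)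
      also have "y powr (Re s + 1) \<le> Y powr (Re s + 1)" using Y that by (intro powr_mono2) auto
      finally show ?thesis by simp
    qed
    have holQ: "Q holomorphic_on A" for A
      unfolding Q_def using Y by (intro holomorphic_intros) (auto simp: complex_nonpos_Reals_iff)
    have hol\<Phi>: "\<Phi> holomorphic_on {s. Re s > 1 / 2}"
      unfolding \<Phi>_def by (intro holomorphic_on_mult H_holomorphic holQ)
    have bound: "norm (\<Phi> (Complex \<sigma> t)) \<le> (24 / k * h * Y powr \<sigma> * (Y / h) powr e) * W t" for t
    proof -
      let ?s = "Complex \<sigma> t"
      have n1: "norm (?s + 1) \<le> 3 * (1 + \<bar>t\<bar>)"
        using cmod_le[of "?s + 1"] \<sigma> by simp
      have n0: "norm (?s + 1) > 0" using \<sigma> by (auto simp: complex_eq_iff)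
      \<comment> \<open>The trivial bound, written with the same prefactor as the derivative bound
        that follows, so that their minimum can be interpolated.\<close>
      have "norm (Q ?s) \<le> 2 * Y powr \<sigma> * h * (Y / h)"
        using Q1[of ?s] \<sigma> h Y by (simp add: powr_add)
      moreover have "norm (Q ?s) \<le> 2 * Y powr \<sigma> * h * norm (?s + 1)"
      proof -
        have "norm (Q ?s) \<le> norm (?s + 1) * Y powr \<sigma> * h"
          unfolding Q_def using norm_powr_succ_diff_le[of ?s y Y] \<sigma> Y y by (simp add: Y_def)
        also have "... \<le> 2 * (norm (?s + 1) * Y powr \<sigma> * h)" using h by simp
        finally show ?thesis by (simp add: mult_ac)
      qed
      ultimately have "norm (Q ?s) \<le> 2 * Y powr \<sigma> * h * min (Y / h) (norm (?s + 1))"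
        by (simp add: min_def)
      also have "... \<le> 2 * Y powr \<sigma> * h * ((Y / h) powr e * norm (?s + 1) powr (1 - e))"
        using e n0 Y h by (intro mult_left_mono min_le_powr_interpolation) auto
      also have "norm (?s + 1) powr (1 - e) \<le> 3 * (1 + \<bar>t\<bar>) powr (1 - e)"
      proof -
        have "norm (?s + 1) powr (1 - e) \<le> (3 * (1 + \<bar>t\<bar>)) powr (1 - e)"
          using n1 n0 e by (intro powr_mono2) auto
        also have "... = 3 powr (1 - e) * (1 + \<bar>t\<bar>) powr (1 - e)" by (rule powr_mult)
        also have "... \<le> 3 powr 1 * (1 + \<bar>t\<bar>) powr (1 - e)"
          using e by (intro mult_right_mono powr_mono) auto
        finally show ?thesis by simp
      qed
      finally have q: "norm (Q ?s) \<le> 2 * Y powr \<sigma> * h * ((Y / h) powr e * (3 * (1 + \<bar>t\<bar>) powr (1 - e)))"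
        using h by (simp add: mult_left_mono)
      have "norm (\<Phi> ?s) \<le> (4 / k * (norm (E ?s) + \<bar>a\<bar>) / (1 + \<bar>t\<bar>)\<^sup>2) * (2 * Y powr \<sigma> * h * ((Y / h) powr e * (3 * (1 + \<bar>t\<bar>) powr (1 - e))))"
        unfolding \<Phi>_def norm_mult using k by (intro mult_mono norm_H_le \<sigma> q) auto
      also have "... = (24 / k * h * Y powr \<sigma> * (Y / h) powr e) * ((norm (E ?s) + \<bar>a\<bar>) * ((1 + \<bar>t\<bar>) powr (1 - e) / (1 + \<bar>t\<bar>)\<^sup>2))"
        by simp
      also have "(1 + \<bar>t\<bar>) powr (1 - e) / (1 + \<bar>t\<bar>)\<^sup>2 = (1 + \<bar>t\<bar>) powr (- 1 - e)"
      proof -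
        have "(1 + \<bar>t\<bar>) powr (1 - e) / (1 + \<bar>t\<bar>) powr 2 = (1 + \<bar>t\<bar>) powr (1 - e - 2)"
          by (rule powr_diff[symmetric])
        then show ?thesis by (simp add: powr_numeral)
      qed
      finally show ?thesis unfolding W_def .
    qed
    have measQ: "(\<lambda>t. Q (Complex \<sigma> t)) \<in> borel_measurable borel"
      by (intro borel_measurable_continuous_onI continuous_on_compose2[OF holomorphic_on_imp_continuous_on[OF holQ[of UNIV]]])
        (auto simp: Complex_eq intro!: continuous_intros)
    have int\<sigma>: "integrable lborel (\<lambda>t. \<Phi> (Complex \<sigma> t))"
    proof (rule Bochner_Integration.integrable_bound)
      show "integrable lborel (\<lambda>t. (24 / k * h * Y powr \<sigma> * (Y / h) powr e) * W t)" using iW by simp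
      show "AE t in lborel. norm (\<Phi> (Complex \<sigma> t)) \<le> norm ((24 / k * h * Y powr \<sigma> * (Y / h) powr e) * W t)"
        using order_trans[OF bound abs_ge_self] by (intro AE_I2) (simp only: real_norm_def)
      show "(\<lambda>t. \<Phi> (Complex \<sigma> t)) \<in> borel_measurable lborel"
        unfolding \<Phi>_def using measQ measurable_H_line[OF \<sigma>(1)] by simp
    qed
    have \<Phi>3: "\<Phi> (Complex 3 t) = H (Complex 3 t) * of_real Y powr (Complex 3 t + 1) - H (Complex 3 t) * of_real y powr (Complex 3 t + 1)" for t
      by (simp add: \<Phi>_def Q_def algebra_simps)
    have int3: "integrable lborel (\<lambda>t. \<Phi> (Complex 3 t))"
      unfolding \<Phi>3 using perron(1) Y by simp
    have "of_real ((N1 Y - a * M1 Y) - (N1 y - a * M1 y)) = (CLBINT t. \<Phi> (Complex 3 t)) / of_real (2 * pi)"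
      unfolding \<Phi>3 of_real_diff[of "N1 Y - a * M1 Y"] perron(2)[OF Y(3)] perron(2)[OF Y(4)]
      by (subst Bochner_Integration.integral_diff) (auto intro: perron(1) Y simp: diff_divide_distrib)
    also have "(CLBINT t. \<Phi> (Complex 3 t)) = (CLBINT t. \<Phi> (Complex \<sigma> t))"
    proof (rule contour_shift[symmetric, OF hol\<Phi>])
      show "convex {s. 1 / 2 < Re s}" by (rule convex_halfspace_Re_gt)
      let ?B = "(B + \<bar>a\<bar>) * (2 * Y powr 4)"
      show "0 \<le> ?B" using B by simp
      fix s assume s: "\<sigma> \<le> Re s" "Re s \<le> 3" "1 \<le> \<bar>Im s\<bar>"
      have ne: "s \<noteq> 1" using s by auto
      have d: "1 * 1 \<le> norm (s - 1) * norm (s + 1)"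
        using abs_Im_le_cmod[of "s - 1"] abs_Im_le_cmod[of "s + 1"] s by (intro mult_mono) auto
      have "norm (H s) = norm (E s - of_real a) / (norm (s - 1) * norm (s + 1))"
        using H_eq[OF ne] by (simp add: norm_divide norm_mult)
      also have "... \<le> norm (E s - of_real a) / 1" using d by (intro divide_left_mono) auto
      also have "... \<le> norm (E s) + \<bar>a\<bar>" using norm_triangle_ineq4[of "E s" "of_real a"] by simp
      also have "... \<le> B * exp (2 * \<bar>Im s\<bar>) + \<bar>a\<bar> * exp (2 * \<bar>Im s\<bar>)"
        using B(2)[OF s(1,2)] mult_left_mono[of 1 "exp (2 * \<bar>Im s\<bar>)" "\<bar>a\<bar>"] by simp
      finally have hb: "norm (H s) \<le> (B + \<bar>a\<bar>) * exp (2 * \<bar>Im s\<bar>)" by (simp add: distrib_right)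
      have "norm (Q s) \<le> 2 * Y powr (Re s + 1)" using s \<sigma> by (intro Q1) auto
      also have "Y powr (Re s + 1) \<le> Y powr 4" using s Y by (intro powr_mono) auto
      finally have qb: "norm (Q s) \<le> 2 * Y powr 4" by simp
      have "norm (\<Phi> s) \<le> ((B + \<bar>a\<bar>) * exp (2 * \<bar>Im s\<bar>)) * (2 * Y powr 4)"
        unfolding \<Phi>_def norm_mult using B by (intro mult_mono hb qb) auto
      then show "norm (\<Phi> s) \<le> ?B * exp (2 * \<bar>Im s\<bar>)" by (simp add: mult_ac)
    qed (use \<sigma> int\<sigma> int3 in auto)
    finally have "\<bar>(N1 Y - a * M1 Y) - (N1 y - a * M1 y)\<bar> = norm ((CLBINT t. \<Phi> (Complex \<sigma> t)) / of_real (2 * pi))"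
      by (metis norm_of_real)
    also have "... \<le> norm (CLBINT t. \<Phi> (Complex \<sigma> t)) / 1"
      unfolding norm_divide using pi_gt3 by (intro divide_left_mono) auto
    also have "norm (CLBINT t. \<Phi> (Complex \<sigma> t)) \<le> (LBINT t. norm (\<Phi> (Complex \<sigma> t)))" by simp
    also have "... \<le> (LBINT t. (24 / k * h * Y powr \<sigma> * (Y / h) powr e) * W t)"
      using int\<sigma> iW bound by (intro integral_mono) auto
    also have "... = K * h * Y powr \<sigma> * (Y / h) powr e"
      unfolding K_def by (subst integral_mult_right_zero) simp
    finally show ?thesis by (simp add: Y_def)
  qed
  with K0 show ?thesis by blast
qed

text \<open>With \<open>h = sqrt x\<close> the averaging error \<open>a * h / 2\<close> has order
  \<open>x powr (1 / 2)\<close>, while \<open>(x / h) powr e\<close> costs only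
  \<open>x powr (e / 2)\<close>.\<close>

lemma counting_bound:
  assumes \<sigma>: "1 / 2 < \<sigma>" "\<sigma> < 1" and e: "0 < e" "e < 1"
    and int: "integrable lborel (\<lambda>t. norm (E (Complex \<sigma> t)) * (1 + \<bar>t\<bar>) powr (- 1 - e))"
  shows "\<exists>K. \<forall>x\<ge>4. \<bar>real (card {k. \<nu> k \<le> x}) - a * x\<bar> \<le> K * x powr (\<sigma> + e / 2)"
proof -
  obtain K where K: "K \<ge> 0" and bnd: "\<And>y h. y \<ge> 1 \<Longrightarrow> h > 0 \<Longrightarrow> \<bar>(N1 (y + h) - a * M1 (y + h)) - (N1 y - a * M1 y)\<bar>
    \<le> K * h * (y + h) powr \<sigma> * ((y + h) / h) powr e"
    using shifted_bound[OF assms] by blast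
  have "\<bar>real (card {k. \<nu> k \<le> x}) - a * x\<bar> \<le> (4 * K + \<bar>a\<bar>) * x powr (\<sigma> + e / 2)" if x: "x \<ge> 4" for x
  proof -
    define h where "h = sqrt x"
    define P where "P = x powr (\<sigma> + e / 2)"
    have hh: "h * h = x" using x by (simp add: h_def)
    have "2 \<le> h" unfolding h_def using x by (intro real_le_rsqrt) simp
    then have h: "h > 0" "2 \<le> h" "2 * h \<le> x" using hh mult_right_mono[of 2 h h] by auto
    have hP: "h \<le> P"
    proof -
      have "h = x powr (1 / 2)" using x by (simp add: h_def powr_half_sqrt)
      also have "... \<le> P" unfolding P_def using x \<sigma> e by (intro powr_mono) auto
      finally show ?thesis .
    qed
    \<comment> \<open>\<open>M1\<close> is quadratic, so its difference quotient is the midpoint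
      \<open>y + h / 2\<close>. The cases \<open>y = x\<close> and \<open>y = x - h\<close> are
      needed; \<open>x \<ge> 4\<close> gives \<open>2 * h \<le> x\<close>, hence
      \<open>x - h \<ge> 1\<close>.\<close>
    have main: "\<bar>(N1 (y + h) - N1 y) / h - a * (y + h / 2)\<bar> \<le> 4 * K * P" if y: "1 \<le> y" "y + h \<le> 2 * x" for y
    proof -
      have M: "M1 (y + h) - M1 y = h * (y + h / 2)"
      proof -
        have M1: "M1 u = (u\<^sup>2 - 1) / 2" if "u \<ge> 1" for u
          using one_le_power[OF that, of 2] by (simp add: M1_def)
        show ?thesis using y h by (simp add: M1 power2_eq_square field_simps)
      qed
      have "(y + h) powr \<sigma> * ((y + h) / h) powr e \<le> (2 * x) powr \<sigma> * (2 * h) powr e"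
        using y h \<sigma> e x hh by (intro mult_mono powr_mono2) (auto simp: divide_le_eq mult_ac)
      also have "... = (2 powr \<sigma> * 2 powr e) * (x powr \<sigma> * h powr e)"
        using x h by (simp add: powr_mult)
      also have "h powr e = x powr (e / 2)"
      proof -
        have "h = x powr (1 / 2)" using x by (simp add: h_def powr_half_sqrt)
        then show ?thesis by (simp add: powr_powr)
      qed
      also have "x powr \<sigma> * x powr (e / 2) = P" by (simp add: P_def powr_add)
      also have "2 powr \<sigma> * 2 powr e * P \<le> 4 * P"
      proof (rule mult_right_mono)
        have "2 powr \<sigma> * 2 powr e \<le> 2 powr 1 * 2 powr (1 :: real)"
          using \<sigma> e by (intro mult_mono powr_mono) auto
        then show "2 powr \<sigma> * 2 powr e \<le> 4" by simp
      qed (simp add: P_def)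
      finally have pw: "(y + h) powr \<sigma> * ((y + h) / h) powr e \<le> 4 * P" .
      have "\<bar>(N1 (y + h) - N1 y) - a * (M1 (y + h) - M1 y)\<bar> \<le> K * h * ((y + h) powr \<sigma> * ((y + h) / h) powr e)"
        using bnd[OF y(1) h(1)] by (simp add: algebra_simps)
      also have "... \<le> K * h * (4 * P)" using K h pw by (intro mult_left_mono) auto
      finally have "\<bar>(N1 (y + h) - N1 y) - a * (h * (y + h / 2))\<bar> / h \<le> K * h * (4 * P) / h"
        unfolding M using h by (intro divide_right_mono) auto
      moreover have "\<bar>(N1 (y + h) - N1 y) - a * (h * (y + h / 2))\<bar> / h = \<bar>(N1 (y + h) - N1 y) / h - a * (y + h / 2)\<bar>"
      proof -
        have "(N1 (y + h) - N1 y) / h - a * (y + h / 2) = ((N1 (y + h) - N1 y) - a * (h * (y + h / 2))) / h"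
          using h by (simp add: field_simps)
        then show ?thesis using h by (simp add: abs_divide)
      qed
      ultimately show ?thesis using h by (simp add: mult_ac)
    qed
    let ?N = "real (card {k. \<nu> k \<le> x})"
    have up: "?N \<le> (N1 (x + h) - N1 x) / h"
      using N1_diff_ge[OF h(1), of x] h by (simp add: pos_le_divide_eq mult.commute)
    have lo: "(N1 x - N1 (x - h)) / h \<le> ?N"
      using N1_diff_le[OF h(1), of "x - h"] h by (simp add: pos_divide_le_eq mult.commute)
    have m1: "\<bar>(N1 (x + h) - N1 x) / h - a * (x + h / 2)\<bar> \<le> 4 * K * P"
      by (rule main) (use x h in auto)
    have m2: "\<bar>(N1 x - N1 (x - h)) / h - a * (x - h / 2)\<bar> \<le> 4 * K * P"
      using main[of "x - h"] x h by (simp add: algebra_simps)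
    have ah: "\<bar>a * (h / 2)\<bar> \<le> \<bar>a\<bar> * P"
      unfolding abs_mult using hP h by (intro mult_left_mono) auto
    have "?N - a * x \<le> 4 * K * P + \<bar>a\<bar> * P"
      using up m1 ah by (simp add: distrib_left abs_le_iff)
    moreover have "- (4 * K * P + \<bar>a\<bar> * P) \<le> ?N - a * x"
      using lo m2 ah by (simp add: right_diff_distrib abs_le_iff)
    ultimately show ?thesis unfolding P_def[symmetric] by (simp add: abs_le_iff distrib_right)
  qed
  then show ?thesis by blast
qed

end

section \<open>The chosen system\<close>

lemma ex_rank_finite:
  fixes A :: "real set"
  assumes "finite A" "n < card A"
  shows "\<exists>v\<in>A. card {u \<in> A. u < v} = n"
  using assms
proof (induction arbitrary: n rule: finite_linorder_max_induct)
  case (insert b A)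
  have b: "b \<notin> A" using insert.hyps by auto
  show ?case
  proof (cases "n < card A")
    case True
    then obtain v where v: "v \<in> A" "card {u \<in> A. u < v} = n" using insert.IH by blast
    have "{u \<in> insert b A. u < v} = {u \<in> A. u < v}" using v(1) insert.hyps by fastforce
    then have "card {u \<in> insert b A. u < v} = n" using v(2) by (simp only:)
    then show ?thesis using v(1) by blast
  next
    case False
    then have "n = card A" using insert.prems insert.hyps b by simp
    moreover have "{u \<in> insert b A. u < b} = A" using insert.hyps b by auto
    ultimately have "card {u \<in> insert b A. u < b} = n" by (simp only:)
    then show ?thesis by blast
  qed
qed simp

lemma rank_unique:
  fixes S :: "real set"
  assumes fin: "\<And>x. finite {u \<in> S. u \<le> x}" and "v \<in> S" "w \<in> S" "v < w"
  shows "card {u \<in> S. u < v} < card {u \<in> S. u < w}"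
proof (rule psubset_card_mono)
  show "finite {u \<in> S. u < w}" by (rule finite_subset[OF _ fin[of w]]) auto
qed (use assms in auto)

text \<open>Makes the definite description in \<open>beurling_nu\<close> meaningful: local
  finiteness gives uniqueness, infinitude gives an element of every rank.\<close>

lemma ex1_rank:
  fixes S :: "real set"
  assumes fin: "\<And>x. finite {u \<in> S. u \<le> x}" and inf: "infinite S"
  shows "\<exists>!v. v \<in> S \<and> card {u \<in> S. u < v} = n"
proof (rule ex_ex1I)
  obtain F where F: "F \<subseteq> S" "finite F" "card F = Suc n"
    using infinite_arbitrarily_large[OF inf, of "Suc n"] by auto
  define x where "x = Max F"
  have "F \<subseteq> {u \<in> S. u \<le> x}" using F by (auto simp: x_def)
  then have "n < card {u \<in> S. u \<le> x}" using card_mono[OF fin[of x], of F] F(3) by simp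
  from ex_rank_finite[OF fin this]
  obtain v where v: "v \<in> S" "v \<le> x" "card {u \<in> {u \<in> S. u \<le> x}. u < v} = n" by blast
  moreover have "{u \<in> {u \<in> S. u \<le> x}. u < v} = {u \<in> S. u < v}" using v(2) by auto
  ultimately show "\<exists>v. v \<in> S \<and> card {u \<in> S. u < v} = n" by auto
next
  fix v w assume "v \<in> S \<and> card {u \<in> S. u < v} = n" "w \<in> S \<and> card {u \<in> S. u < w} = n"
  then show "v = w" using rank_unique[OF fin, of v w] rank_unique[OF fin, of w v] by (cases v w rule: linorder_cases) auto
qed

lemma beurling_integers_eq: "beurling_integers q = range (beurling_prod q)"
  by (auto simp: beurling_integers_def beurling_prod_def)

locale separated_choice = beurling_choice +
  fixes C :: real
  assumes good: "q n \<notin> bad_set sep_const n q"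
    and potential: "(\<integral>\<^sup>+p. ennreal (exp (\<Sum>i<n. increment i (q i) p)) \<partial>line_measure) \<le> ennreal C"
begin

abbreviation P :: "nat multiset \<Rightarrow> real" where "P \<equiv> beurling_prod q"

lemma q_ge_1: "1 \<le> q n"
  using q_ge[of n] by linarith

lemma P_ge_1: "1 \<le> P M"
  by (rule beurling_prod_ge_1) (rule q_ge_1)

lemma P_pos: "0 < P M"
  using P_ge_1[of M] by linarith

lemma nat_size_le_P: "nat_size M \<le> P M"
proof (induction M)
  case (add i M)
  then have "(real i + 2) * nat_size M \<le> q i * P M"
    using q_ge[of i] q_pos[of i] nat_size_pos[of M] by (intro mult_mono) auto
  then show ?case by (simp add: nat_size_def beurling_prod_def)
qed (simp add: nat_size_def beurling_prod_def)

text \<open>The common part \<open>D\<close> is cancelled so that the disjoint case applies, and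
  multiplying back by \<open>P D \<ge> 1\<close> only widens the gap. \<open>nat_size_le_P\<close>
  turns the index threshold into one in the sizes of the products.\<close>

lemma P_separation:
  assumes "M \<noteq> M'"
  shows "sep_const / (P M * P M')\<^sup>2 \<le> \<bar>P M - P M'\<bar>"
proof -
  define D where "D = M \<inter># M'"
  define A B where "A = M - D" and "B = M' - D"
  have M: "M = A + D" "M' = B + D"
    by (rule multiset_eqI, simp add: A_def B_def D_def)+
  have disj: "A \<inter># B = {#}"
    by (rule multiset_eqI) (simp add: A_def B_def D_def)
  have "A \<noteq> B" using assms M by auto
  have AB: "P A \<le> P M" "P B \<le> P M'"
    using P_ge_1[of D] P_pos mult_left_mono[of 1 "P D"] by (auto simp: M beurling_prod_union)
  have "sep_const / (P M * P M')\<^sup>2 \<le> sep_const / (nat_size A * nat_size B)\<^sup>2"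
  proof (rule divide_left_mono)
    have "nat_size A * nat_size B \<le> P M * P M'"
      using order_trans[OF nat_size_le_P AB(1)] order_trans[OF nat_size_le_P AB(2)] nat_size_pos[of B] P_pos[of M]
      by (intro mult_mono) auto
    then show "(nat_size A * nat_size B)\<^sup>2 \<le> (P M * P M')\<^sup>2"
      using nat_size_pos[of A] nat_size_pos[of B] by (intro power_mono) auto
  qed (use sep_const_pos nat_size_pos[of A] nat_size_pos[of B] P_pos in \<open>auto simp: less_imp_le less_imp_neq[symmetric]\<close>)
  also have "... \<le> \<bar>P A - P B\<bar>"
    by (rule beurling_prod_separation[OF q_ge_1 good disj \<open>A \<noteq> B\<close>])
  also have "... \<le> \<bar>P A - P B\<bar> * P D"
    using mult_left_mono[OF P_ge_1[of D], of "\<bar>P A - P B\<bar>"] by simp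
  also have "... = \<bar>(P A - P B) * P D\<bar>" using P_pos[of D] by (simp add: abs_mult)
  also have "(P A - P B) * P D = P M - P M'" by (simp add: M beurling_prod_union algebra_simps)
  finally show ?thesis .
qed

text \<open>Unique factorization is the qualitative form of the positive separation.\<close>

lemma inj_P: "inj P"
proof (rule injI, rule ccontr)
  fix M M' assume "P M = P M'" "M \<noteq> M'"
  then have "sep_const / (P M * P M')\<^sup>2 \<le> 0" using P_separation by fastforce
  moreover have "0 < sep_const / (P M * P M')\<^sup>2"
    using sep_const_pos P_pos by (intro divide_pos_pos zero_less_power mult_pos_pos)
  ultimately show False by simp
qed

lemma ln_P:
  assumes "finite A" "set_mset M \<subseteq> A"
  shows "ln (P M) = (\<Sum>n\<in>A. real (count M n) * ln (q n))"
  using assms(2)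
proof (induction M)
  case (add i M)
  have "(\<Sum>n\<in>A. real (count (add_mset i M) n) * ln (q n)) = (\<Sum>n\<in>A. real (count M n) * ln (q n) + (if n = i then ln (q n) else 0))"
    by (intro sum.cong refl) (simp add: algebra_simps)
  also have "... = (\<Sum>n\<in>A. real (count M n) * ln (q n)) + ln (q i)"
    using add.prems assms(1) by (simp add: sum.distrib sum.delta)
  also have "... = ln (P M) + ln (q i)" using add by simp
  also have "... = ln (q i * P M)" using q_pos[of i] P_pos[of M] by (simp only: ln_mult_pos add.commute)
  also have "q i * P M = P (add_mset i M)" by (simp add: beurling_prod_def)
  finally show ?case by simp
qed (simp add: beurling_prod_def)

lemma beurling_primes_q: "beurling_primes q"
  unfolding beurling_primes_def
proof (intro conjI allI impI)
  show "strict_mono q" by (rule strict_mono_q)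
  show "1 < q 0" using q_ge[of 0] by simp
  show "filterlim q at_top sequentially"
  proof (rule filterlim_at_top_mono[OF filterlim_real_sequentially])
    have "real n \<le> q n" for n using q_ge[of n] by simp
    then show "\<forall>\<^sub>F n in sequentially. real n \<le> q n" by simp
  qed
next
  fix c :: "nat \<Rightarrow> rat" and m
  assume fin: "finite {n. c n \<noteq> 0}" and sum0: "(\<Sum>n\<in>{n. c n \<noteq> 0}. of_rat (c n) * ln (q n)) = 0"
  define A where "A = {n. c n \<noteq> 0}"
  have finA: "finite A" using fin by (simp add: A_def)
  \<comment> \<open>A common denominator turns the rational relation into an integral one.\<close>
  define d where "d = (\<Prod>n\<in>A. snd (quotient_of (c n)))"
  have d: "d > 0" unfolding d_def by (intro prod_pos) (simp add: quotient_of_denom_pos')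
  have ex: "\<exists>z :: int. of_int d * c n = of_int z" if "n \<in> A" for n
  proof -
    obtain x y where xy: "quotient_of (c n) = (x, y)" by (cases "quotient_of (c n)")
    have "c n = of_int x / of_int y" "y \<noteq> 0"
      using quotient_of_div[OF xy] quotient_of_denom_pos[OF xy] by auto
    moreover have "d = y * (\<Prod>n\<in>A - {n}. snd (quotient_of (c n)))"
      unfolding d_def using finA that xy by (simp add: prod.remove)
    ultimately have "of_int d * c n = of_int ((\<Prod>n\<in>A - {n}. snd (quotient_of (c n))) * x)"
      by simp
    then show ?thesis by blast
  qed
  then obtain z :: "nat \<Rightarrow> int" where z: "\<And>n. n \<in> A \<Longrightarrow> of_int d * c n = of_int (z n)" by metis
  have zr: "real_of_int (z n) = of_int d * of_rat (c n)" if "n \<in> A" for n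
    using arg_cong[OF z[OF that], of "of_rat :: rat \<Rightarrow> real"] by (simp add: of_rat_mult)
  \<comment> \<open>Positive and negative coefficients form two multisets; the relation says that
    their products agree, so by \<open>inj_P\<close> they coincide and every \<open>z n\<close>
    vanishes.\<close>
  define M where "M = (\<Sum>n\<in>A. replicate_mset (nat (z n)) n)"
  define M' where "M' = (\<Sum>n\<in>A. replicate_mset (nat (- z n)) n)"
  have cM: "count M n = (if n \<in> A then nat (z n) else 0)" "count M' n = (if n \<in> A then nat (- z n) else 0)" for n
    unfolding M_def M'_def using finA by (simp_all add: count_sum sum.delta)
  have sub: "set_mset M \<subseteq> A" "set_mset M' \<subseteq> A"
    by (auto simp: set_mset_def cM split: if_splits)
  have "ln (P M) - ln (P M') = (\<Sum>n\<in>A. real_of_int (z n) * ln (q n))"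
    unfolding ln_P[OF finA sub(1)] ln_P[OF finA sub(2)] sum_subtractf[symmetric]
  proof (intro sum.cong refl)
    fix n assume "n \<in> A"
    have "real (nat (z n)) - real (nat (- z n)) = real_of_int (z n)" by (cases "z n \<ge> 0") auto
    with \<open>n \<in> A\<close> show "real (count M n) * ln (q n) - real (count M' n) * ln (q n) = real_of_int (z n) * ln (q n)"
      by (simp only: cM if_True left_diff_distrib[symmetric])
  qed
  also have "... = of_int d * (\<Sum>n\<in>A. of_rat (c n) * ln (q n))"
    by (simp add: sum_distrib_left zr mult.assoc)
  finally have "ln (P M) = ln (P M')" using sum0 by (simp add: A_def)
  then have "M = M'" using P_pos inj_P by (auto dest: injD)
  then have nz: "nat (z n) = nat (- z n)" if "n \<in> A" for n using cM[of n] that by metis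
  have "z n = 0" if "n \<in> A" for n using nz[OF that] by arith
  then have "c n = 0" if "n \<in> A" for n using z[OF that] d that by simp
  then show "c m = 0" by (auto simp: A_def)
qed

lemma P_powr: "complex_of_real (P M) powr (-s) = prod_mset (image_mset (\<lambda>n. complex_of_real (q n) powr (-s)) M)"
proof (induction M)
  case (add i M)
  have "complex_of_real (P (add_mset i M)) powr (-s) = (complex_of_real (q i) * complex_of_real (P M)) powr (-s)"
    by (simp add: beurling_prod_def)
  also have "... = complex_of_real (q i) powr (-s) * complex_of_real (P M) powr (-s)"
    using q_pos[of i] P_pos[of M] by (intro powr_times_real) auto
  finally show ?case by (simp add: add.IH)
qed (simp add: beurling_prod_def)

lemma zeta_multisets:
  assumes s: "Re s > 1"
  shows "(\<lambda>M. norm (complex_of_real (P M) powr (-s))) summable_on UNIV"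
    "infsum (\<lambda>M. complex_of_real (P M) powr (-s)) UNIV = s / (s - 1) * exp (G s)"
proof -
  let ?f = "\<lambda>n. complex_of_real (q n) powr (-s)"
  have le: "norm (?f n) \<le> (real n + 2) powr (- Re s)" for n using s by (intro norm_q_powr_le) auto
  have half: "norm (?f n) \<le> 1 / 2" for n
  proof -
    have "(real n + 2) powr (- Re s) \<le> (real n + 2) powr (- 1)" using s by (intro powr_mono) auto
    also have "... \<le> 2 powr (- 1)" by (intro powr_mono2') auto
    finally show ?thesis using le[of n] by (simp add: powr_minus)
  qed
  have summ: "summable (\<lambda>n. norm (?f n))"
    by (rule summable_comparison_test'[OF summable_shifted_powr[OF s], of 0]) (use le in simp)
  show "(\<lambda>M. norm (complex_of_real (P M) powr (-s))) summable_on UNIV"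
    unfolding P_powr by (rule euler_product(1)[OF half summ])
  show "infsum (\<lambda>M. complex_of_real (P M) powr (-s)) UNIV = s / (s - 1) * exp (G s)"
    unfolding P_powr euler_product(3)[OF half summ] by (rule Euler_exponent[OF s])
qed

lemma zeta_integers:
  assumes s: "Re s > 1"
  shows "(\<lambda>v. norm (complex_of_real v powr (-s))) summable_on beurling_integers q"
    "beurling_zeta q s = s / (s - 1) * exp (G s)"
  unfolding beurling_zeta_def beurling_integers_eq
  using zeta_multisets[OF s] by (simp_all add: summable_on_reindex[OF inj_P] infsum_reindex[OF inj_P] o_def)

text \<open>An arbitrary enumeration, not ordered by size; it turns sums over multisets into series
  for \<open>zeta_continuation\<close>.\<close>

definition enum :: "nat \<Rightarrow> nat multiset" where "enum = from_nat_into UNIV"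

lemma bij_enum: "bij enum"
proof -
  have "infinite (UNIV :: nat multiset set)"
  proof
    assume "finite (UNIV :: nat multiset set)"
    then have "finite (range (\<lambda>n :: nat. {#n#}))" by (rule finite_subset[rotated]) auto
    then show False by (subst (asm) finite_image_iff) (auto simp: inj_on_def)
  qed
  then show ?thesis unfolding enum_def by (rule bij_betw_from_nat_into[OF countable_multisets])
qed

lemma inj_P_enum: "inj (\<lambda>k. P (enum k))"
  using inj_compose[OF inj_P bij_is_inj[OF bij_enum]] by (simp add: o_def)

lemma zeta_enum:
  assumes s: "Re s > 1"
  shows "summable (\<lambda>k. norm (complex_of_real (P (enum k)) powr (-s)))"
    "(\<Sum>k. complex_of_real (P (enum k)) powr (-s)) = s / (s - 1) * exp (G s)"
proof -
  show "summable (\<lambda>k. norm (complex_of_real (P (enum k)) powr (-s)))"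
    using summable_on_reindex_bij_betw[OF bij_enum, of "\<lambda>M. norm (complex_of_real (P M) powr (-s))"] zeta_multisets(1)[OF s]
    by (intro summable_on_imp_summable) simp
  have "((\<lambda>M. complex_of_real (P M) powr (-s)) has_sum (s / (s - 1) * exp (G s))) UNIV"
    using has_sum_infsum[OF abs_summable_summable[OF zeta_multisets(1)[OF s]]] zeta_multisets(2)[OF s] by simp
  then have "((\<lambda>k. complex_of_real (P (enum k)) powr (-s)) has_sum (s / (s - 1) * exp (G s))) UNIV"
    using has_sum_reindex_bij_betw[OF bij_enum, of "\<lambda>M. complex_of_real (P M) powr (-s)"] by simp
  then show "(\<Sum>k. complex_of_real (P (enum k)) powr (-s)) = s / (s - 1) * exp (G s)"
    using has_sum_imp_sums sums_unique by metis
qed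

lemma norm_P_powr: "norm (complex_of_real (P M) powr (-s)) = P M powr (- Re s)"
  using P_pos by (simp add: norm_of_real_powr)

text \<open>At real \<open>s > 1\<close> both zeta and \<open>s / (s - 1)\<close> are positive, so
  \<open>exp (G s)\<close> is a nonnegative real. This passes to the limit at 1, where the
  exponential cannot vanish; \<open>G 1\<close> itself need not be shown real.\<close>

lemma exp_G_1_pos: "\<exists>a>0. exp (G 1) = complex_of_real a"
proof -
  define s where "s n = complex_of_real (1 + 1 / real (Suc n))" for n
  have s: "Re (s n) > 1" for n by (simp add: s_def)
  have lim: "s \<longlonglongrightarrow> 1"
    unfolding s_def using tendsto_of_real[OF tendsto_add[OF tendsto_const[of 1] LIMSEQ_Suc[OF lim_const_over_n[of "1 :: real"]]], where 'a = complex]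
    by simp
  have "\<forall>z\<in>{s. 1 / 2 < Re s}. isCont G z"
    using holomorphic_on_imp_continuous_on[OF G_holomorphic] continuous_on_eq_continuous_at[OF open_halfspace_Re_gt]
    by blast
  then have "isCont G 1" by (rule bspec) simp
  then have "(\<lambda>n. exp (G (s n))) \<longlonglongrightarrow> exp (G 1)"
    by (intro tendsto_exp isCont_tendsto_compose[OF _ lim])
  moreover have "exp (G (s n)) \<in> \<real>\<^sub>\<ge>\<^sub>0" for n
  proof -
    define e where "e = 1 / real (Suc n)"
    have e: "e > 0" "s n = of_real (1 + e)" by (simp_all add: e_def s_def)
    have "complex_of_real (P (enum k)) powr (- s n) = of_real (P (enum k) powr (- (1 + e)))" for k
      unfolding e(2) of_real_minus[symmetric] using P_pos by (intro powr_of_real less_imp_le)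
    moreover have summ: "summable (\<lambda>k. P (enum k) powr (- (1 + e)))"
      using zeta_enum(1)[OF s, of n] unfolding norm_P_powr e(2) by simp
    ultimately have "s n / (s n - 1) * exp (G (s n)) = of_real (\<Sum>k. P (enum k) powr (- (1 + e)))"
      using zeta_enum(2)[OF s, of n] by (simp add: suminf_of_real)
    moreover have "s n / (s n - 1) = of_real ((1 + e) / e)" by (simp add: e(2))
    moreover have pos: "(1 + e) / e > 0" using e(1) by simp
    ultimately have "exp (G (s n)) * of_real ((1 + e) / e) = of_real (\<Sum>k. P (enum k) powr (- (1 + e)))"
      by (simp only: mult.commute)
    then have "exp (G (s n)) = of_real (\<Sum>k. P (enum k) powr (- (1 + e))) / of_real ((1 + e) / e)"
      by (rule eq_divide_imp[rotated]) (metis pos of_real_eq_0_iff less_irrefl)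
    then have "exp (G (s n)) = of_real ((\<Sum>k. P (enum k) powr (- (1 + e))) / ((1 + e) / e))"
      by (simp only: of_real_divide)
    moreover have "0 \<le> (\<Sum>k. P (enum k) powr (- (1 + e))) / ((1 + e) / e)"
      using pos by (intro divide_nonneg_pos suminf_nonneg summ) simp_all
    ultimately show ?thesis by (simp only: nonneg_Reals_of_real_iff)
  qed
  ultimately have "exp (G 1) \<in> \<real>\<^sub>\<ge>\<^sub>0"
    by (rule closed_sequentially[OF closed_nonneg_Reals_complex, rotated])
  then obtain a where a: "exp (G 1) = of_real a" "a \<ge> 0" by (auto elim: nonneg_Reals_cases)
  moreover have "a \<noteq> 0" using a by (metis exp_not_eq_zero of_real_0)
  ultimately show ?thesis by (intro exI[of _ a]) auto
qed

text \<open>The potential bound at every finite stage passes to the limit by Fatou's lemma. The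
  remaining parts of \<open>G\<close>, namely the prime powers and \<open>T 0\<close>, are bounded
  on the line.\<close>

lemma integrable_exp_G:
  "integrable lborel (\<lambda>t. norm (exp (G (Complex (line m) t))) * (1 + \<bar>t\<bar>) powr (- 1 - decay m))"
proof -
  define V where "V = (\<Sum>n. var_bound m n)"
  have summV: "summable (var_bound m)"
    unfolding var_bound_def using summable_shifted_powr[of "2 * line m"] line_gt_half[of m]
    by (intro summable_mult) simp
  define SX where "SX t = Re (\<Sum>n. X n (Complex (line m) t))" for t
  define u where "u n t = line_density (m, t) * exp (\<Sum>i<n. increment i (q i) (m, t))" for n t
  define v where "v t = line_density (m, t) * exp (SX t - V)" for t
  have lim: "(\<lambda>n. u n t) \<longlonglongrightarrow> v t" for t
  proof -
    have X: "summable (\<lambda>n. X n (Complex (line m) t))"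
      using line_gt_half[of m] by (intro summable_X) simp
    have "(\<lambda>n. (\<Sum>i<n. Re (X i (Complex (line m) t))) - (\<Sum>i<n. var_bound m i)) \<longlonglongrightarrow> SX t - V"
      unfolding SX_def V_def
      by (intro tendsto_diff summable_LIMSEQ summV) (use tendsto_Re[OF summable_LIMSEQ[OF X]] in simp)
    then have "(\<lambda>n. \<Sum>i<n. increment i (q i) (m, t)) \<longlonglongrightarrow> SX t - V"
      by (simp add: increment_def X_def sum_subtractf)
    then show ?thesis unfolding u_def v_def by (intro tendsto_intros)
  qed
  have meas_inc: "increment i x \<in> borel_measurable line_measure" for i x
    using measurable_Pair2[OF measurable_increment[of i], of x] by simp
  have ubound: "(\<integral>\<^sup>+t. ennreal (u n t) \<partial>lborel) \<le> ennreal C" for n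
  proof -
    let ?F = "\<lambda>p. ennreal (exp (\<Sum>i<n. increment i (q i) p))"
    have "?F \<in> borel_measurable line_measure" using meas_inc by measurable
    then have F: "?F \<in> borel_measurable (count_space UNIV \<Otimes>\<^sub>M lborel)"
      by (simp cong: measurable_cong_sets add: sets_line_measure)
    have "(\<integral>\<^sup>+t. ennreal (u n t) \<partial>lborel) = (\<integral>\<^sup>+t. ennreal (line_density (m, t)) * ?F (m, t) \<partial>lborel)"
      unfolding u_def by (intro nn_integral_cong) (simp add: ennreal_mult line_density_nonneg)
    \<comment> \<open>The potential sums over all lines with nonnegative terms, so it dominates the
      term of the single line \<open>m\<close>.\<close>
    also have "... = (\<Sum>k\<in>{m}. \<integral>\<^sup>+t. ennreal (line_density (k, t)) * ?F (k, t) \<partial>lborel)" by simp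
    also have "... \<le> (\<Sum>k. \<integral>\<^sup>+t. ennreal (line_density (k, t)) * ?F (k, t) \<partial>lborel)"
      by (rule sum_le_suminf) auto
    also have "... = (\<integral>\<^sup>+p. ?F p \<partial>line_measure)" by (rule nn_integral_line_measure[OF F, symmetric])
    also have "... \<le> ennreal C" by (rule potential)
    finally show ?thesis .
  qed
  have measu: "u n \<in> borel_measurable lborel" for n
  proof -
    have "(\<lambda>t. increment i (q i) (m, t)) \<in> borel_measurable borel" for i
      unfolding increment_def prod.case Complex_eq powr_def by measurable
    moreover have "(\<lambda>t. line_density (m, t)) \<in> borel_measurable borel"
      unfolding line_density_def prod.case by measurable
    ultimately show ?thesis unfolding u_def by measurable
  qed
  have measv: "v \<in> borel_measurable lborel"
    by (rule borel_measurable_LIMSEQ_real[OF lim measu])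
  have "(\<integral>\<^sup>+t. ennreal (v t) \<partial>lborel) = (\<integral>\<^sup>+t. liminf (\<lambda>n. ennreal (u n t)) \<partial>lborel)"
    by (intro nn_integral_cong lim_imp_Liminf[symmetric] tendsto_ennrealI lim) simp
  also have "... \<le> liminf (\<lambda>n. \<integral>\<^sup>+t. ennreal (u n t) \<partial>lborel)"
    by (rule nn_integral_liminf) (use measu in measurable)
  also have "... \<le> liminf (\<lambda>n. ennreal C)"
    by (intro Liminf_mono always_eventually allI ubound)
  also have "... = ennreal C" by (rule Liminf_const) simp
  finally have "(\<integral>\<^sup>+t. ennreal (v t) \<partial>lborel) \<le> ennreal C" .
  then have vfin: "(\<integral>\<^sup>+t. ennreal (norm (v t)) \<partial>lborel) < \<infinity>"
    by (simp add: v_def abs_mult line_density_nonneg abs_of_nonneg le_less_trans)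
  have intv: "integrable lborel v"
    using integrableI_bounded[OF measv vfin] .
  define Rb where "Rb = (\<Sum>n. 4 * (real n + 2) powr (- 2 * line m)) + 1"
  \<comment> \<open>\<open>total_weight m * 2 ^ m\<close> undoes the normalization in
    \<open>line_density\<close>, \<open>exp V\<close> removes the compensators, and
    \<open>exp Rb\<close> covers the bounded part of \<open>G\<close>.\<close>
  define K where "K = exp (V + Rb) * (total_weight m * 2 ^ m)"
  show ?thesis
  proof (rule Bochner_Integration.integrable_bound)
    show "integrable lborel (\<lambda>t. K * v t)" using intv by simp
    have "continuous_on UNIV (\<lambda>t. exp (G (Complex (line m) t)))"
      using line_gt_half[of m]
      by (intro continuous_on_exp continuous_on_compose2[OF holomorphic_on_imp_continuous_on[OF G_holomorphic]])
        (auto simp: Complex_eq intro!: continuous_intros)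
    then have [measurable]: "(\<lambda>t. exp (G (Complex (line m) t))) \<in> borel_measurable borel"
      by (rule borel_measurable_continuous_onI)
    show "(\<lambda>t. norm (exp (G (Complex (line m) t))) * (1 + \<bar>t\<bar>) powr (- 1 - decay m)) \<in> borel_measurable lborel"
      by measurable
    show "AE t in lborel. norm (norm (exp (G (Complex (line m) t))) * (1 + \<bar>t\<bar>) powr (- 1 - decay m)) \<le> norm (K * v t)"
    proof (intro AE_I2)
      fix t
      let ?s = "Complex (line m) t"
      have s: "Re ?s > 1 / 2" "Re ?s \<ge> 0" using line_gt_half[of m] by auto
      have "Re (G ?s) = SX t + Re (\<Sum>n. R n ?s) - Re (T 0 ?s)"
        unfolding G_split[OF s(1)] SX_def by simp
      also have "... \<le> SX t + norm (\<Sum>n. R n ?s) + norm (T 0 ?s)"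
        using complex_Re_le_cmod[of "\<Sum>n. R n ?s"] abs_Re_le_cmod[of "T 0 ?s"] by linarith
      also have "... \<le> SX t + Rb"
        using suminf_R_bound[of "line m" ?s] line_gt_half[of m] norm_T_le_1[OF s(2), of 0] by (simp add: Rb_def)
      finally have "exp (Re (G ?s)) \<le> exp (V + Rb) * exp (SX t - V)"
        by (simp add: exp_add[symmetric])
      then have "norm (exp (G ?s)) * weight m t \<le> (exp (V + Rb) * exp (SX t - V)) * weight m t"
        using weight_pos[of m t] by (intro mult_right_mono) auto
      also have "... = K * v t"
        using total_weight_pos[of m] by (simp add: K_def v_def line_density_def power_divide)
      finally have "norm (exp (G ?s)) * weight m t \<le> K * v t" .
      then show "norm (norm (exp (G ?s)) * (1 + \<bar>t\<bar>) powr (- 1 - decay m)) \<le> norm (K * v t)"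
        by (simp add: weight_def)
    qed
  qed
qed

lemma zeta_continuation_enum:
  assumes "exp (G 1) = complex_of_real a"
  shows "zeta_continuation (\<lambda>k. P (enum k)) (\<lambda>s. exp (G s)) a"
proof
  show "1 \<le> P (enum k)" for k by (rule P_ge_1)
  show "summable (\<lambda>k. P (enum k) powr (- \<sigma>))" if "1 < \<sigma>" for \<sigma> :: real
    using zeta_enum(1)[of "of_real \<sigma>"] that by (simp add: norm_P_powr)
  show "(\<Sum>k. complex_of_real (P (enum k)) powr (-s)) = s / (s - 1) * exp (G s)" if "1 < Re s" for s
    by (rule zeta_enum(2)[OF that])
  show "(\<lambda>s. exp (G s)) holomorphic_on {s. 1 / 2 < Re s}"
    by (intro holomorphic_on_exp' G_holomorphic)
  show "\<exists>B\<ge>0. \<forall>s. \<sigma> \<le> Re s \<longrightarrow> Re s \<le> 3 \<longrightarrow> norm (exp (G s)) \<le> B * exp (2 * \<bar>Im s\<bar>)" if \<sigma>: "1 / 2 < \<sigma>" for \<sigma>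
  proof -
    obtain C' where C': "C' \<ge> 0" "\<And>s. \<sigma> \<le> Re s \<Longrightarrow> norm (G s) \<le> C' + 2 * norm s"
      using G_bound[OF \<sigma>] by blast
    \<comment> \<open>In the strip \<open>norm s \<le> 3 + \<bar>Im s\<bar>\<close>, and the
      coefficient 2 in \<open>G_bound\<close> makes the 6.\<close>
    have "norm (exp (G s)) \<le> exp (C' + 6) * exp (2 * \<bar>Im s\<bar>)" if s: "\<sigma> \<le> Re s" "Re s \<le> 3" for s
    proof -
      have "norm s \<le> 3 + \<bar>Im s\<bar>" using cmod_le[of s] s \<sigma> by simp
      then have "norm (G s) \<le> (C' + 6) + 2 * \<bar>Im s\<bar>" using C'(2)[OF s(1)] by simp
      then have "exp (norm (G s)) \<le> exp ((C' + 6) + 2 * \<bar>Im s\<bar>)" by (simp only: exp_le_cancel_iff)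
      then show ?thesis using norm_exp[of "G s"] unfolding exp_add by linarith
    qed
    then show ?thesis by (intro exI[of _ "exp (C' + 6)"]) auto
  qed
  show "exp (G 1) = of_real a" by fact
qed

section \<open>Counting integers and primes; Bohr's condition\<close>

lemma beurling_N_eq: "beurling_N q x = real (card {k. P (enum k) \<le> x})"
proof -
  have "{v \<in> beurling_integers q. v \<le> x} = (\<lambda>k. P (enum k)) ` {k. P (enum k) \<le> x}"
    unfolding beurling_integers_eq using bij_is_surj[OF bij_enum] by (auto simp: image_iff) (metis surjD)
  then show ?thesis
    unfolding beurling_N_def using inj_P_enum by (simp add: card_image inj_on_subset)
qed

lemma beurling_N_asymptotics:
  assumes a: "exp (G 1) = complex_of_real a" and \<epsilon>: "\<epsilon> > 0"
  shows "(\<lambda>x. beurling_N q x - a * x) \<in> O[at_top](\<lambda>x. x powr (1 / 2 + \<epsilon>))"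
proof -
  interpret zeta_continuation "\<lambda>k. P (enum k)" "\<lambda>s. exp (G s)" a
    by (rule zeta_continuation_enum[OF a])
  \<comment> \<open>The exponent obtained on line \<open>m\<close> is
    \<open>1 / 2 + (3 / 2) / (m + 3)\<close>, which is below
    \<open>1 / 2 + 2 / (m + 3)\<close>.\<close>
  obtain m :: nat where m: "2 / \<epsilon> \<le> real m" using real_arch_simple by blast
  have l: "line m < 1" "decay m < 1" by (simp_all add: line_def decay_def field_simps)
  obtain K where K: "\<And>x. x \<ge> 4 \<Longrightarrow> \<bar>real (card {k. P (enum k) \<le> x}) - a * x\<bar> \<le> K * x powr (line m + decay m / 2)"
    using counting_bound[OF line_gt_half l(1) decay_pos l(2) integrable_exp_G] by blast
  have "2 / (real m + 3) \<le> \<epsilon>"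
    using m \<epsilon> by (simp add: field_simps)
  moreover have "line m + decay m / 2 \<le> 1 / 2 + 2 / (real m + 3)"
    by (simp add: line_def decay_def field_simps)
  ultimately have ex: "line m + decay m / 2 \<le> 1 / 2 + \<epsilon>" by linarith
  show ?thesis
  proof (rule bigoI[where c = "\<bar>K\<bar>"], rule eventually_mono[OF eventually_ge_at_top[of 4]])
    fix x :: real assume x: "4 \<le> x"
    have "\<bar>beurling_N q x - a * x\<bar> \<le> K * x powr (line m + decay m / 2)"
      unfolding beurling_N_eq by (rule K[OF x])
    also have "... \<le> \<bar>K\<bar> * x powr (1 / 2 + \<epsilon>)"
      using x ex by (intro mult_mono powr_mono) auto
    finally show "norm (beurling_N q x - a * x) \<le> \<bar>K\<bar> * norm (x powr (1 / 2 + \<epsilon>))" by simp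
  qed
qed

text \<open>With \<open>L = li_beurling x\<close>, the relation \<open>q n \<le> x\<close> implies
  \<open>n + 1 \<le> L\<close> and follows from \<open>n + 2 \<le> L\<close>; so the count lies
  between \<open>\<lfloor>L\<rfloor> - 1\<close> and \<open>\<lfloor>L\<rfloor>\<close> as soon as
  \<open>L \<ge> 1\<close>, and is 0 below that.\<close>

lemma beurling_pi_bound:
  assumes x: "x \<ge> 1" shows "\<bar>beurling_pi q x - li_beurling x\<bar> \<le> 2"
proof -
  define L where "L = li_beurling x"
  have li1: "li_beurling 1 = 0" by (simp add: li_beurling_def)
  have L0: "L \<ge> 0" using li_beurling_diff_bounds(3)[of 1 x] x by (simp add: L_def li1 order_trans[OF ln_ge_zero[OF x]])
  have mono: "li_beurling u \<le> li_beurling v" if "1 \<le> u" "u \<le> v" for u v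
    using li_beurling_strict_mono[of u v] that by (cases "u = v") auto
  have sub1: "{n. q n \<le> x} \<subseteq> {n. real n + 1 \<le> L}"
  proof
    fix n assume "n \<in> {n. q n \<le> x}"
    then have "xs (Suc n) \<le> x" using q_gt[of n] by simp
    then show "n \<in> {n. real n + 1 \<le> L}" using mono[OF xs_ge_1, of "Suc n" x] li_xs[of "Suc n"] by (simp add: L_def)
  qed
  have sub2: "{n. real n + 2 \<le> L} \<subseteq> {n. q n \<le> x}"
  proof
    fix n assume n: "n \<in> {n. real n + 2 \<le> L}"
    have "xs (Suc (Suc n)) \<le> x"
    proof (rule ccontr)
      assume "\<not> ?thesis"
      then have "L < li_beurling (xs (Suc (Suc n)))" unfolding L_def using x by (intro li_beurling_strict_mono) auto
      then show False using n li_xs[of "Suc (Suc n)"] by simp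
    qed
    then show "n \<in> {n. q n \<le> x}" using q_le[of n] by simp
  qed
  have sub3: "{n. real n + 1 \<le> L} \<subseteq> {..<nat \<lfloor>L\<rfloor>}"
    by (auto simp: le_floor_iff zless_nat_eq_int_zless less_le) linarith+
  have fin: "finite {n. q n \<le> x}" by (rule finite_subset[OF order_trans[OF sub1 sub3]]) simp
  have "card {n. q n \<le> x} \<le> card {..<nat \<lfloor>L\<rfloor>}"
    using sub1 sub3 by (intro card_mono) auto
  then have "real (card {n. q n \<le> x}) \<le> real (nat \<lfloor>L\<rfloor>)" by simp
  also have "... \<le> L" using L0 by simp
  finally have up: "beurling_pi q x \<le> L" by (simp add: beurling_pi_def)
  have "{..<nat (\<lfloor>L\<rfloor> - 1)} \<subseteq> {n. real n + 2 \<le> L}"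
  proof
    fix n assume "n \<in> {..<nat (\<lfloor>L\<rfloor> - 1)}"
    then have "int n + 2 \<le> \<lfloor>L\<rfloor>" by auto
    then show "n \<in> {n. real n + 2 \<le> L}" by (simp add: le_floor_iff)
  qed
  then have "card {..<nat (\<lfloor>L\<rfloor> - 1)} \<le> card {n. q n \<le> x}"
    using sub2 by (intro card_mono fin) auto
  then have "real (nat (\<lfloor>L\<rfloor> - 1)) \<le> beurling_pi q x" by (simp add: beurling_pi_def)
  moreover have "L - 2 \<le> real (nat (\<lfloor>L\<rfloor> - 1))" by linarith
  ultimately show ?thesis using up by (simp add: L_def)
qed

lemma finite_integers_le: "finite {u \<in> beurling_integers q. u \<le> x}"
proof -
  obtain a where "exp (G 1) = complex_of_real a" using exp_G_1_pos by blast
  then interpret zeta_continuation "\<lambda>k. P (enum k)" "\<lambda>s. exp (G s)" a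
    by (rule zeta_continuation_enum)
  have "{u \<in> beurling_integers q. u \<le> x} \<subseteq> (\<lambda>k. P (enum k)) ` {k. P (enum k) \<le> x}"
    unfolding beurling_integers_eq using bij_is_surj[OF bij_enum] by (auto simp: image_iff) (metis surjD)
  then show ?thesis using finite_le by (meson finite_imageI finite_subset)
qed

text \<open>Exponent 4 arises because both products in \<open>P_separation\<close> are at most the
  larger one and their product is squared.\<close>

lemma bohr_condition:
  "beurling_nu q (Suc n) - beurling_nu q n \<ge> sep_const * beurling_nu q (Suc n) powr (- 4)"
proof -
  let ?S = "beurling_integers q"
  have inf: "infinite ?S"
    using range_inj_infinite[OF inj_P_enum] by (rule infinite_super[rotated]) (auto simp: beurling_integers_eq)
  have nu: "beurling_nu q k \<in> ?S \<and> card {u \<in> ?S. u < beurling_nu q k} = k" for k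
    unfolding beurling_nu_def by (rule theI'[OF ex1_rank[OF finite_integers_le inf]])
  have less: "beurling_nu q n < beurling_nu q (Suc n)"
  proof (rule ccontr)
    assume "\<not> ?thesis"
    then have "beurling_nu q (Suc n) < beurling_nu q n \<or> beurling_nu q (Suc n) = beurling_nu q n" by auto
    then show False
      using rank_unique[OF finite_integers_le, of "beurling_nu q (Suc n)" "beurling_nu q n"] nu[of n] nu[of "Suc n"] by auto
  qed
  obtain M M' where M: "beurling_nu q (Suc n) = P M" "beurling_nu q n = P M'"
    using nu unfolding beurling_integers_eq by (metis imageE)
  have lt: "P M' < P M" using less by (simp add: M)
  have "P M * P M' \<le> P M * P M" using lt P_pos[of M] by (intro mult_left_mono) auto
  then have "(P M * P M')\<^sup>2 \<le> (P M * P M)\<^sup>2" using P_pos by (intro power_mono) (auto intro: less_imp_le)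
  also have "(P M * P M)\<^sup>2 = P M ^ 4" by (simp add: power2_eq_square power4_eq_xxxx)
  finally have "sep_const / P M ^ 4 \<le> sep_const / (P M * P M')\<^sup>2"
    using sep_const_pos P_pos by (intro divide_left_mono mult_pos_pos zero_less_power) (auto intro: less_imp_le)
  also have "... \<le> \<bar>P M - P M'\<bar>" using lt by (intro P_separation) auto
  also have "... = P M - P M'" using lt by simp
  also have "sep_const / P M ^ 4 = sep_const * P M powr (- 4)"
    using P_pos[of M] by (simp add: powr_minus divide_inverse powr_numeral)
  finally show ?thesis by (simp add: M)
qed

end

theorem theorem1p3:
  shows "\<exists>q. beurling_primes q \<and>
    (\<exists>\<sigma>0 Z.
        (\<forall>s. Re s > \<sigma>0 \<longrightarrow>
           (\<lambda>v. norm (complex_of_real v powr (-s))) summable_on beurling_integers q \<and>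
           Z s = beurling_zeta q s) \<and>
        Z holomorphic_on ({s. Re s > 1/2} - {1}) \<and>
        is_pole Z 1 \<and> zorder Z 1 = -1 \<and>
        (\<forall>s. Re s > 1/2 \<and> s \<noteq> 1 \<longrightarrow> Z s \<noteq> 0)) \<and>
    (\<lambda>x. beurling_pi q x - li_beurling x) \<in> O[at_top](\<lambda>_. 1) \<and>
    (\<exists>a>0. \<forall>\<epsilon>>0. (\<lambda>x. beurling_N q x - a * x) \<in> O[at_top](\<lambda>x. x powr (1/2 + \<epsilon>))) \<and>
    (\<exists>c1>0. \<exists>c2>0. \<forall>n. beurling_nu q (Suc n) - beurling_nu q n \<ge>
                          c1 * beurling_nu q (Suc n) powr (-c2))"
proof -
  obtain xs where xs: "xs 0 = 1" "strict_mono xs" "\<And>n. li_beurling (xs n) = real n" "\<And>n. real n + 1 \<le> xs n"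
    using ex_li_grid by blast
  interpret li_grid xs by unfold_locales (use xs in auto)
  obtain q C where q: "\<And>n. xs (Suc n) < q n" "\<And>n. q n \<le> xs (Suc (Suc n))" "\<And>n. q n \<notin> bad_set sep_const n q"
    "\<And>n. (\<integral>\<^sup>+p. ennreal (exp (\<Sum>i<n. increment i (q i) p)) \<partial>line_measure) \<le> ennreal C"
    using ex_choice by blast
  interpret separated_choice xs q C by unfold_locales (use q in auto)
  let ?U = "{s :: complex. Re s > 1 / 2}"
  define F where "F s = s * exp (G s)" for s
  \<comment> \<open>The explicit exponent 1 matches the form of the library facts on poles and their
    orders.\<close>
  define Z where "Z s = F s / (s - 1) ^ 1" for s
  have holF: "F holomorphic_on ?U"
    unfolding F_def by (intro holomorphic_intros holomorphic_on_exp' G_holomorphic)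
  have U: "open ?U" "1 \<in> ?U" by (rule open_halfspace_Re_gt) simp
  have F1: "F 1 \<noteq> 0" by (simp add: F_def)
  have zeta: "(\<lambda>v. norm (complex_of_real v powr (-s))) summable_on beurling_integers q \<and> Z s = beurling_zeta q s"
    if "Re s > 1" for s
    using zeta_integers[OF that] by (simp add: Z_def F_def)
  have holZ: "Z holomorphic_on ?U - {1}"
    unfolding Z_def by (intro holomorphic_intros holomorphic_on_subset[OF holF]) auto
  have pole: "is_pole Z 1"
    unfolding Z_def by (rule is_pole_basic[OF holF U F1]) simp
  have zorder: "zorder Z 1 = -1"
    unfolding Z_def using zorder_nonzero_div_power[OF U holF F1, of 1] by simp
  \<comment> \<open>The exponential has no zeros, and the only zero of the factor \<open>s\<close>
    lies outside the half-plane.\<close>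
  have nonzero: "Z s \<noteq> 0" if "Re s > 1 / 2 \<and> s \<noteq> 1" for s
    using that by (auto simp: Z_def F_def)
  show ?thesis
  proof (rule exI[of _ q], intro conjI)
    show "beurling_primes q" by (rule beurling_primes_q)
    show "\<exists>\<sigma>0 Z. (\<forall>s. Re s > \<sigma>0 \<longrightarrow> (\<lambda>v. norm (complex_of_real v powr (-s))) summable_on beurling_integers q \<and> Z s = beurling_zeta q s) \<and>
        Z holomorphic_on (?U - {1}) \<and> is_pole Z 1 \<and> zorder Z 1 = -1 \<and> (\<forall>s. Re s > 1/2 \<and> s \<noteq> 1 \<longrightarrow> Z s \<noteq> 0)"
      by (rule exI[of _ 1], rule exI[of _ Z]) (use zeta holZ pole zorder nonzero in blast)
    show "(\<lambda>x. beurling_pi q x - li_beurling x) \<in> O[at_top](\<lambda>_. 1)"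
      by (rule bigoI[where c = 2], rule eventually_mono[OF eventually_ge_at_top[of 1]]) (use beurling_pi_bound in simp)
    show "\<exists>a>0. \<forall>\<epsilon>>0. (\<lambda>x. beurling_N q x - a * x) \<in> O[at_top](\<lambda>x. x powr (1/2 + \<epsilon>))"
      using exp_G_1_pos beurling_N_asymptotics by meson
    show "\<exists>c1>0. \<exists>c2>0. \<forall>n. beurling_nu q (Suc n) - beurling_nu q n \<ge> c1 * beurling_nu q (Suc n) powr (-c2)"
      by (rule exI[of _ sep_const], rule conjI[OF sep_const_pos], rule exI[of _ 4]) (use bohr_condition in simp)
  qed
qed

end
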